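(* Let $G\in\mathcal{C}$, $N\unlhd G$, and let $(H,H,\vartheta)\in\mathcal{L}_N$ be of height $n$ with $i$-th node $(H_i,A_i,\vartheta_i)$, $1\le i\le n$. Let $K=\ker\vartheta$. Then (i) $\displaystyle \alpha_{(G,H,K)}=\frac{[\operatorname{Cen}_G(\varepsilon(H,K)):\operatorname{Cen}_{H_{n-1}}(\varepsilon(H,K))]}{\prod_{2\le i\le n-1}[\operatorname{Cen}_{H_{i-1}}(e(H_i,H,K)):H_i]}$; (ii) $\alpha_{(G,H,K)}=1$ if and only if $\operatorname{Cen}_{H_{i-1}}(e(H_i,H,K))=\operatorname{Cen}_{H_{i-1}}(\varepsilon(H,K))H_i$ for all $2\le i\le n-1$; (iii) if $(H,H,\vartheta)$ is good, then in (i) and (ii) the subgroup $\operatorname{Cen}_{H_{i-1}}(e(H_i,H,K))$ can be replaced by $N_{H_{i-1}}(\ker\vartheta_i)$ for all $2\le i\le n-1$.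
   Context: All groups are finite. $\mathcal{C}$ is the class of finite groups $G$ such that every subgroup and every quotient group of $G$ is either abelian or contains a non-central abelian normal subgroup. For a character $\psi$ of $H\le G$ and $x\in G$, $\psi^x(g)=\psi(xgx^{-1})$; $\psi^G$ the induced character; $1_N$ trivial character; $\operatorname{Cen}_G(a)$ the centralizer in $G$ of an element $a\in\mathbb{Q}G$ under conjugation. For $K\unlhd H\le M$: $\widehat{H}=\frac1{|H|}\sum_{h\in H}h$; $\varepsilon(H,K)=\widehat K$ if $H=K$, else $\prod(\widehat K-\widehat L)$ over all $L\unlhd H$ with $L/K$ a minimal normal subgroup of $H/K$; $e(M,H,K)$ is the sum of all distinct $M$-conjugates of $\varepsilon(H,K)$. A Shoda pair of $M$ is $(H,K)$ with $K\unlhd H\le M$, $H/K$ cyclic, and $g\in M$, $[H,g]\cap H\subseteq K$ imply $g\in H$; then there is a unique rational number $\alpha_{(M,H,K)}$ such that $\alpha_{(M,H,K)}e(M,H,K)$ is a primitive central idempotent of $\mathbb{Q}M$. Fix $N\unlhd G$. An $N$-linear character triple of $G$ is $(H,A,\vartheta)$ with $H\le G$, $A\unlhd H$, $\vartheta$ a linear character of $A$ invariant in $H$, and $\ker(\vartheta^G)=N$. For $B\unlhd M\le G$ and linear $\lambda$ of $B$, $\widetilde{\operatorname{Lin}}(M|\lambda)$ is the set of linear characters of $M$ whose restriction to $B$ contains $\lambda$ and whose induction to $G$ has kernel $N$. For each triple a normal subgroup $\mathcal{A}=\mathcal{A}_{(H,A,\vartheta)}$ of $H$ is fixed, of maximal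 order among normal subgroups of $H$ containing $\ker\vartheta$ with abelian quotient by $\ker\vartheta$. $\operatorname{Aut}(\mathbb{C}|\vartheta)\times H$ (field automorphisms of $\mathbb{C}$ fixing $\mathbb{Q}(\vartheta)$, times $H$) acts on $\widetilde{\operatorname{Lin}}(\mathcal{A}|\vartheta)$ by $(\sigma,h)\cdot\varphi=\sigma\circ\varphi^h$; fix orbit representatives $\mathfrak{Lin}(\mathcal{A}|\vartheta)$. If $H\ne A$, $Cl(H,A,\vartheta)=\{(I_H(\varphi),\mathcal{A},\varphi):\varphi\in\mathfrak{Lin}(\mathcal{A}|\vartheta)\}$, $I_H(\varphi)=\{h\in H:\varphi^h=\varphi\}$; if $H=A$ it is empty. $\mathcal{G}_N$ is the directed graph of $N$-linear triples reachable from $(G,N,1_N)$ with edges $(u,v)$ whenever $v\in Cl(u)$; each vertex is reached by a unique directed path from $(G,N,1_N)$. $\mathcal{L}_N$ is the set of vertices of $\mathcal{G}_N$ of the form $(H,H,\vartheta)$. For such a leaf with path $v_1=(G,N,1_N),\dots,v_n=(H,H,\vartheta)$, $n$ is its height and $v_i=(H_i,A_i,\vartheta_i)$ its $i$-th node. The leaf is good if for every $1<i\le n$ and $x\in N_{H_{i-1}}(\ker\vartheta_i)$ there is a field automorphism $\sigma$ of $\mathbb{C}$ with $(\vartheta^{H_i})^x=\sigma\circ\vartheta^{H_i}$. *)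

theory Defs
  imports "HOL-Algebra.Algebra" "HOL-Library.Function_Algebras" Complex_Main
begin

type_synonym 'a triple = "'a set \<times> 'a set \<times> ('a \<Rightarrow> complex)"

definition grp_center :: "('a,'b) monoid_scheme \<Rightarrow> 'a set" where
  "grp_center Gr = {x \<in> carrier Gr. \<forall>y\<in>carrier Gr. x \<otimes>\<^bsub>Gr\<^esub> y = y \<otimes>\<^bsub>Gr\<^esub> x}"

definition cls_prop :: "('a,'b) monoid_scheme \<Rightarrow> bool" where
  "cls_prop Gr \<longleftrightarrow> comm_group Gr \<or>
     (\<exists>A. A \<lhd> Gr \<and> comm_group (Gr\<lparr>carrier := A\<rparr>) \<and> \<not> A \<subseteq> grp_center Gr)"

definition class_C :: "('a,'b) monoid_scheme \<Rightarrow> bool" where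
  "class_C G \<longleftrightarrow> group G \<and> finite (carrier G) \<and>
     (\<forall>H. subgroup H G \<longrightarrow> cls_prop (G\<lparr>carrier := H\<rparr>)) \<and>
     (\<forall>M. M \<lhd> G \<longrightarrow> cls_prop (G Mod M))"

section \<open>Characters (complex valued functions, extended by 0 outside their domain)\<close>

definition fld_aut :: "(complex \<Rightarrow> complex) \<Rightarrow> bool" where
  "fld_aut \<sigma> \<longleftrightarrow> bij \<sigma> \<and> (\<forall>x y. \<sigma> (x + y) = \<sigma> x + \<sigma> y) \<and>
     (\<forall>x y. \<sigma> (x * y) = \<sigma> x * \<sigma> y) \<and> \<sigma> 1 = 1"

definition lin_char :: "('a,'b) monoid_scheme \<Rightarrow> 'a set \<Rightarrow> ('a \<Rightarrow> complex) \<Rightarrow> bool" where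
  "lin_char G A \<phi> \<longleftrightarrow> (\<forall>a\<in>A. \<phi> a \<noteq> 0) \<and> (\<forall>a\<in>A. \<forall>b\<in>A. \<phi> (a \<otimes>\<^bsub>G\<^esub> b) = \<phi> a * \<phi> b) \<and>
     (\<forall>x. x \<notin> A \<longrightarrow> \<phi> x = 0)"

definition char_conj :: "('a,'b) monoid_scheme \<Rightarrow> 'a \<Rightarrow> ('a \<Rightarrow> complex) \<Rightarrow> 'a \<Rightarrow> complex" where
  "char_conj G x \<psi> = (\<lambda>g. if g \<in> carrier G then \<psi> (x \<otimes>\<^bsub>G\<^esub> g \<otimes>\<^bsub>G\<^esub> inv\<^bsub>G\<^esub> x) else 0)"

definition induced :: "('a,'b) monoid_scheme \<Rightarrow> 'a set \<Rightarrow> 'a set \<Rightarrow> ('a \<Rightarrow> complex) \<Rightarrow> 'a \<Rightarrow> complex" where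
  "induced G H M \<psi> = (\<lambda>g. if g \<in> M then
      (\<Sum>x\<in>M. if x \<otimes>\<^bsub>G\<^esub> g \<otimes>\<^bsub>G\<^esub> inv\<^bsub>G\<^esub> x \<in> H then \<psi> (x \<otimes>\<^bsub>G\<^esub> g \<otimes>\<^bsub>G\<^esub> inv\<^bsub>G\<^esub> x) else 0)
        / of_nat (card H) else 0)"

definition char_ker :: "('a,'b) monoid_scheme \<Rightarrow> 'a set \<Rightarrow> ('a \<Rightarrow> complex) \<Rightarrow> 'a set" where
  "char_ker G M \<chi> = {g \<in> M. \<chi> g = \<chi> \<one>\<^bsub>G\<^esub>}"

definition one_char :: "'a set \<Rightarrow> 'a \<Rightarrow> complex" where
  "one_char M = (\<lambda>x. if x \<in> M then 1 else 0)"

definition N_lin_triple :: "('a,'b) monoid_scheme \<Rightarrow> 'a set \<Rightarrow> 'a triple \<Rightarrow> bool" where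
  "N_lin_triple G N t \<longleftrightarrow> (case t of (H, A, \<theta>) \<Rightarrow>
     subgroup H G \<and> A \<lhd> G\<lparr>carrier := H\<rparr> \<and> lin_char G A \<theta> \<and>
     (\<forall>h\<in>H. \<forall>a\<in>A. \<theta> (h \<otimes>\<^bsub>G\<^esub> a \<otimes>\<^bsub>G\<^esub> inv\<^bsub>G\<^esub> h) = \<theta> a) \<and>
     char_ker G (carrier G) (induced G A (carrier G) \<theta>) = N)"

definition abel_over :: "('a,'b) monoid_scheme \<Rightarrow> 'a set \<Rightarrow> 'a set \<Rightarrow> 'a set \<Rightarrow> bool" where
  "abel_over G H K Sx \<longleftrightarrow> Sx \<lhd> G\<lparr>carrier := H\<rparr> \<and> K \<subseteq> Sx \<and> K \<lhd> G\<lparr>carrier := Sx\<rparr> \<and>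
     comm_group (G\<lparr>carrier := Sx\<rparr> Mod K)"

definition valid_Acal :: "('a,'b) monoid_scheme \<Rightarrow> 'a set \<Rightarrow> ('a triple \<Rightarrow> 'a set) \<Rightarrow> bool" where
  "valid_Acal G N Ac \<longleftrightarrow> (\<forall>H A \<theta>. N_lin_triple G N (H, A, \<theta>) \<longrightarrow>
     abel_over G H (char_ker G A \<theta>) (Ac (H, A, \<theta>)) \<and>
     (\<forall>Sx. abel_over G H (char_ker G A \<theta>) Sx \<longrightarrow> card Sx \<le> card (Ac (H, A, \<theta>))))"

definition Lin_tilde :: "('a,'b) monoid_scheme \<Rightarrow> 'a set \<Rightarrow> 'a set \<Rightarrow> 'a set \<Rightarrow> ('a \<Rightarrow> complex)
    \<Rightarrow> ('a \<Rightarrow> complex) set" where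
  "Lin_tilde G N B M lam = {\<phi>. lin_char G M \<phi> \<and> (\<forall>b\<in>B. \<phi> b = lam b) \<and>
     char_ker G (carrier G) (induced G M (carrier G) \<phi>) = N}"

definition in_orbit :: "('a,'b) monoid_scheme \<Rightarrow> 'a set \<Rightarrow> 'a set \<Rightarrow> ('a \<Rightarrow> complex)
    \<Rightarrow> ('a \<Rightarrow> complex) \<Rightarrow> ('a \<Rightarrow> complex) \<Rightarrow> bool" where
  "in_orbit G H A \<theta> \<phi> \<phi>' \<longleftrightarrow> (\<exists>\<sigma> h. fld_aut \<sigma> \<and> (\<forall>a\<in>A. \<sigma> (\<theta> a) = \<theta> a) \<and> h \<in> H \<and>
     \<phi>' = \<sigma> \<circ> char_conj G h \<phi>)"

definition valid_reps :: "('a,'b) monoid_scheme \<Rightarrow> 'a set \<Rightarrow> ('a triple \<Rightarrow> 'a set)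
    \<Rightarrow> ('a triple \<Rightarrow> ('a \<Rightarrow> complex) set) \<Rightarrow> bool" where
  "valid_reps G N Ac R \<longleftrightarrow> (\<forall>H A \<theta>. N_lin_triple G N (H, A, \<theta>) \<longrightarrow>
     R (H, A, \<theta>) \<subseteq> Lin_tilde G N A (Ac (H, A, \<theta>)) \<theta> \<and>
     (\<forall>\<phi> \<in> Lin_tilde G N A (Ac (H, A, \<theta>)) \<theta>. \<exists>!\<psi>. \<psi> \<in> R (H, A, \<theta>) \<and> in_orbit G H A \<theta> \<psi> \<phi>))"

definition inertia :: "('a,'b) monoid_scheme \<Rightarrow> 'a set \<Rightarrow> ('a \<Rightarrow> complex) \<Rightarrow> 'a set" where
  "inertia G H \<phi> = {h \<in> H. char_conj G h \<phi> = \<phi>}"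

definition Cl :: "('a,'b) monoid_scheme \<Rightarrow> ('a triple \<Rightarrow> 'a set) \<Rightarrow> ('a triple \<Rightarrow> ('a \<Rightarrow> complex) set)
    \<Rightarrow> 'a triple \<Rightarrow> 'a triple set" where
  "Cl G Ac R t = (case t of (H, A, \<theta>) \<Rightarrow>
     if H = A then {} else (\<lambda>\<phi>. (inertia G H \<phi>, Ac t, \<phi>)) ` R t)"

definition is_path :: "('a,'b) monoid_scheme \<Rightarrow> 'a set \<Rightarrow> ('a triple \<Rightarrow> 'a set)
    \<Rightarrow> ('a triple \<Rightarrow> ('a \<Rightarrow> complex) set) \<Rightarrow> 'a triple list \<Rightarrow> bool" where
  "is_path G N Ac R vs \<longleftrightarrow> vs \<noteq> [] \<and> vs ! 0 = (carrier G, N, one_char N) \<and>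
     (\<forall>v\<in>set vs. N_lin_triple G N v) \<and>
     (\<forall>i. Suc i < length vs \<longrightarrow> vs ! Suc i \<in> Cl G Ac R (vs ! i))"

text \<open>1-based access to the nodes \<open>v_i = (H_i, A_i, \<theta>_i)\<close>\<close>
definition nodeH :: "'a triple list \<Rightarrow> nat \<Rightarrow> 'a set" where
  "nodeH vs i = fst (vs ! (i - 1))"
definition nodeA :: "'a triple list \<Rightarrow> nat \<Rightarrow> 'a set" where
  "nodeA vs i = fst (snd (vs ! (i - 1)))"
definition nodeT :: "'a triple list \<Rightarrow> nat \<Rightarrow> 'a \<Rightarrow> complex" where
  "nodeT vs i = snd (snd (vs ! (i - 1)))"

section \<open>The rational group algebra QG (functions carrier G \<rightarrow> rat)\<close>

definition qg_elem :: "('a,'b) monoid_scheme \<Rightarrow> ('a \<Rightarrow> rat) \<Rightarrow> bool" where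
  "qg_elem G a \<longleftrightarrow> (\<forall>x. x \<notin> carrier G \<longrightarrow> a x = 0)"

definition conv :: "('a,'b) monoid_scheme \<Rightarrow> ('a \<Rightarrow> rat) \<Rightarrow> ('a \<Rightarrow> rat) \<Rightarrow> 'a \<Rightarrow> rat" where
  "conv G a b = (\<lambda>x. if x \<in> carrier G then (\<Sum>y\<in>carrier G. a y * b (inv\<^bsub>G\<^esub> y \<otimes>\<^bsub>G\<^esub> x)) else 0)"

definition qg_one :: "('a,'b) monoid_scheme \<Rightarrow> 'a \<Rightarrow> rat" where
  "qg_one G = (\<lambda>x. if x = \<one>\<^bsub>G\<^esub> then 1 else 0)"

definition hat :: "'a set \<Rightarrow> 'a \<Rightarrow> rat" where
  "hat S = (\<lambda>x. if x \<in> S then 1 / of_nat (card S) else 0)"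

text \<open>g a g^-1 in QG\<close>
definition qg_conj :: "('a,'b) monoid_scheme \<Rightarrow> 'a \<Rightarrow> ('a \<Rightarrow> rat) \<Rightarrow> 'a \<Rightarrow> rat" where
  "qg_conj G g a = (\<lambda>x. if x \<in> carrier G then a (inv\<^bsub>G\<^esub> g \<otimes>\<^bsub>G\<^esub> x \<otimes>\<^bsub>G\<^esub> g) else 0)"

definition Cen :: "('a,'b) monoid_scheme \<Rightarrow> 'a set \<Rightarrow> ('a \<Rightarrow> rat) \<Rightarrow> 'a set" where
  "Cen G M a = {g \<in> M. qg_conj G g a = a}"

definition min_normal :: "('c,'d) monoid_scheme \<Rightarrow> 'c set \<Rightarrow> bool" where
  "min_normal Gr Y \<longleftrightarrow> Y \<lhd> Gr \<and> Y \<noteq> {\<one>\<^bsub>Gr\<^esub>} \<and>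
     (\<forall>Z. Z \<lhd> Gr \<and> Z \<noteq> {\<one>\<^bsub>Gr\<^esub>} \<and> Z \<subseteq> Y \<longrightarrow> Z = Y)"

definition eps_factors :: "('a,'b) monoid_scheme \<Rightarrow> 'a set \<Rightarrow> 'a set \<Rightarrow> 'a set set" where
  "eps_factors G H K = {L. L \<lhd> G\<lparr>carrier := H\<rparr> \<and> K \<subseteq> L \<and>
     min_normal (G\<lparr>carrier := H\<rparr> Mod K) ((\<lambda>l. K #>\<^bsub>G\<^esub> l) ` L)}"

text \<open>the (commuting) product over eps_factors is taken with Finite_Set.fold\<close>
definition eps :: "('a,'b) monoid_scheme \<Rightarrow> 'a set \<Rightarrow> 'a set \<Rightarrow> 'a \<Rightarrow> rat" where
  "eps G H K = (if H = K then hat K else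
     Finite_Set.fold (\<lambda>L acc. conv G (hat K - hat L) acc) (qg_one G) (eps_factors G H K))"

definition e_sum :: "('a,'b) monoid_scheme \<Rightarrow> 'a set \<Rightarrow> 'a set \<Rightarrow> 'a set \<Rightarrow> 'a \<Rightarrow> rat" where
  "e_sum G M H K = \<Sum> ((\<lambda>g. qg_conj G g (eps G H K)) ` M)"

definition central_idem :: "('a,'b) monoid_scheme \<Rightarrow> ('a \<Rightarrow> rat) \<Rightarrow> bool" where
  "central_idem G e \<longleftrightarrow> qg_elem G e \<and> conv G e e = e \<and>
     (\<forall>a. qg_elem G a \<longrightarrow> conv G e a = conv G a e)"

definition prim_central_idem :: "('a,'b) monoid_scheme \<Rightarrow> ('a \<Rightarrow> rat) \<Rightarrow> bool" where
  "prim_central_idem G e \<longleftrightarrow> central_idem G e \<and> e \<noteq> 0 \<and>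
     \<not> (\<exists>f1 f2. central_idem G f1 \<and> central_idem G f2 \<and> f1 \<noteq> 0 \<and> f2 \<noteq> 0 \<and>
           conv G f1 f2 = 0 \<and> e = f1 + f2)"

definition alpha :: "('a,'b) monoid_scheme \<Rightarrow> 'a set \<Rightarrow> 'a set \<Rightarrow> rat" where
  "alpha G H K = (THE \<alpha>. prim_central_idem G (\<lambda>x. \<alpha> * e_sum G (carrier G) H K x))"

definition nrm :: "('a,'b) monoid_scheme \<Rightarrow> 'a set \<Rightarrow> 'a set \<Rightarrow> 'a set" where
  "nrm G M K = {x \<in> M. x <#\<^bsub>G\<^esub> K #>\<^bsub>G\<^esub> inv\<^bsub>G\<^esub> x = K}"

definition good_leaf :: "('a,'b) monoid_scheme \<Rightarrow> 'a triple list \<Rightarrow> bool" where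
  "good_leaf G vs \<longleftrightarrow> (let n = length vs; H = nodeH vs n; \<theta> = nodeT vs n in
     \<forall>i \<in> {2..n}. \<forall>x \<in> nrm G (nodeH vs (i - 1)) (char_ker G (nodeA vs i) (nodeT vs i)).
       \<exists>\<sigma>. fld_aut \<sigma> \<and> char_conj G x (induced G H (nodeH vs i) \<theta>) = \<sigma> \<circ> induced G H (nodeH vs i) \<theta>)"

end

theory Submission
  imports "HOL-Computational_Algebra.Polynomial" "HOL-Number_Theory.Residues" Defs
begin

text \<open>
  Everything is computed with complex-valued functions on \<open>G\<close> under convolution; neither
  irreducible representations nor Galois theory are needed. A linear character \<open>\<theta>\<close> of \<open>H\<close> gives the
  idempotent \<open>e\<close> with values \<open>\<theta>(h\<inverse>) / |H|\<close>, and the sum \<open>E M\<close> of its conjugates under \<open>M\<close>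
  (up to the factor \<open>1 / |H|\<close>) is a primitive central idempotent of \<open>\<complex>M\<close>, because \<open>e (x e x\<inverse>) = 0\<close>
  for \<open>x \<in> M - H\<close>. The Galois group of the cyclotomic field is replaced by the units
  \<open>k\<close> modulo \<open>|G|\<close>, acting by \<open>(k \<cdot> a)(g) = a(g^k)\<close>; the only arithmetic input is that a rational
  relation between roots of unity survives such a power map. In these terms \<open>\<epsilon>(H, K)\<close> and
  \<open>e(M, H, K)\<close> are multiples of the sums over all \<open>k\<close> of \<open>k \<cdot> e\<close> and \<open>k \<cdot> E M\<close>, and
  \<open>\<alpha> = |Cen \<epsilon>| |Stab e| / (|H| |Stab (E G)|)\<close>, where \<open>Stab\<close> is taken in the group of units.

  Along the path, \<open>H_i\<close> is the inertia group in \<open>H_{i-1}\<close> of the restriction of \<open>\<theta>\<close> to the normal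
  subgroup \<open>A_i\<close>, so that \<open>x E(H_i) x\<inverse>\<close> and \<open>k \<cdot> E(H_i)\<close> are equal as soon as their product is
  nonzero. Counting the pairs \<open>(x, k)\<close> with \<open>x E(H_i) x\<inverse> = k \<cdot> E(H_i)\<close> in two ways gives
  \<open>[Cen(e(H_i, H, K)) : H_i] = [Stab E(H_{i-1}) : Stab E(H_i)]\<close>, and the product over \<open>i\<close> telescopes.
\<close>

section \<open>Rational relations between roots of unity\<close>

text \<open>The power map \<open>pw k\<close> is additive and commutes with conjugation, but in
  general it does not respect convolution, so facts about products cannot simply be transported
  along it. What rescues the Galois action is that, for a unit \<open>k\<close>, it turns
  \<open>ee H \<theta>\<close> and \<open>EE M H \<theta>\<close> into the same expressions for the
  linear character \<open>pw k \<theta>\<close>, which inherits Shoda's condition; whatever is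
  proved for \<theta> thus holds for its conjugates. Arithmetic enters through primitivity over the
  rationals: a rational central idempotent acts on \<open>EE\<close> by a scalar 0 or 1 that is a
  rational combination of roots of unity, and this scalar must not change when the roots are raised
  to the power \<open>k\<close>. Along the path a single character suffices at all nodes. The
  \<open>A_i\<close> increase, because a normal subgroup of maximal order with abelian quotient by
  \<open>ker \<theta>_i\<close> contains \<open>A_i\<close>, and every \<open>\<theta>_i\<close> is
  the restriction of the leaf character \<theta>.\<close>

lemma prime_dvd_binomial_expansion:
  fixes a b :: "'r::comm_ring_1"
  assumes "Factorial_Ring.prime (p::nat)"
  shows "of_nat p dvd (a + b) ^ p - (a ^ p + b ^ p)"
proof -
  have p0: "p > 0" using assms prime_gt_0_nat by blast
  have "(a + b) ^ p = (\<Sum>k\<le>p. of_nat (p choose k) * a ^ k * b ^ (p - k))"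
    by (rule binomial_ring)
  also have "\<dots> = (\<Sum>k\<in>insert 0 (insert p {0<..<p}). of_nat (p choose k) * a ^ k * b ^ (p - k))"
    using p0 by (intro sum.cong) auto
  also have "\<dots> = b ^ p + (a ^ p + (\<Sum>k\<in>{0<..<p}. of_nat (p choose k) * a ^ k * b ^ (p - k)))"
    using p0 by simp
  finally have eq: "(a + b) ^ p - (a ^ p + b ^ p) =
      (\<Sum>k\<in>{0<..<p}. of_nat (p choose k) * a ^ k * b ^ (p - k))"
    by simp
  have "of_nat p dvd (of_nat (p choose k) * a ^ k * b ^ (p - k) :: 'r)" if "k \<in> {0<..<p}" for k
  proof -
    have "p dvd (p choose k)"
      using that assms by (intro dvd_choose_prime) auto
    then obtain c where "p choose k = p * c" ..
    then show ?thesis by (simp add: mult.assoc)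
  qed
  then show ?thesis unfolding eq by (rule dvd_sum)
qed

text \<open>The Frobenius congruence between f(X^p) and f(X)^p modulo p, by induction on the
  coefficients: the constant term is Fermat's little theorem, the rest is
  \<open>prime_dvd_binomial_expansion\<close>.\<close>

lemma prime_dvd_pcompose_power:
  assumes "Factorial_Ring.prime (p::nat)"
  shows "(of_nat p :: int poly) dvd pcompose P (Polynomial.monom 1 p) - P ^ p"
proof (induction P)
  case 0
  then show ?case using assms prime_gt_0_nat by (simp add: power_0_left)
next
  case (pCons a P)
  let ?m = "Polynomial.monom 1 p :: int poly"
  have 1: "(of_nat p :: int poly) dvd ([:a:] + [:0,1:] * P) ^ p - ([:a:] ^ p + ([:0,1:] * P) ^ p)"
    by (rule prime_dvd_binomial_expansion[OF assms])
  have 2: "(of_nat p :: int poly) dvd [:a:] - [:a:] ^ p"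
  proof -
    have p0: "p > 0" using assms prime_gt_0_nat by blast
    \<comment> \<open>\<open>fermat_theorem\<close> is applied to natural numbers, so the integer
      coefficient is replaced by its residue.\<close>
    define n where "n = nat (a mod int p)"
    have an: "[a = int n] (mod int p)" using p0 by (simp add: n_def cong_def)
    have "[n ^ p = n] (mod p)"
    proof (cases "p dvd n")
      case True
      then have "p dvd n ^ p" using p0 by (simp add: dvd_trans[OF _ dvd_power])
      then show ?thesis using True by (simp add: cong_def mod_eq_0_iff_dvd)
    next
      case False
      then have "[n ^ (p - 1) = 1] (mod p)" using assms fermat_theorem by blast
      then have "[n * n ^ (p - 1) = n * 1] (mod p)" by (intro cong_mult) auto
      then show ?thesis using p0 by (simp flip: power_Suc)
    qed
    then have "[int n ^ p = int n] (mod int p)" by (simp flip: cong_int_iff)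
    then have "[a ^ p = a] (mod int p)"
      using an by (meson cong_pow cong_sym cong_trans)
    then have "int p dvd a - a ^ p" by (simp add: cong_iff_dvd_diff dvd_diff_commute)
    then obtain c where "a - a ^ p = int p * c" ..
    then have "[:a:] - [:a:] ^ p = of_nat p * [:c:]"
      by (simp add: poly_const_pow of_nat_poly)
    then show ?thesis unfolding dvd_def by blast
  qed
  have 3: "pcompose (pCons a P) ?m = [:a:] + [:0,1:] ^ p * pcompose P ?m"
    by (simp add: pcompose_pCons Polynomial.monom_altdef)
  have 4: "pCons a P = [:a:] + [:0,1:] * P" by simp
  have "pcompose (pCons a P) ?m - pCons a P ^ p = 
     ([:a:] - [:a:] ^ p) + [:0,1:] ^ p * (pcompose P ?m - P ^ p)
     - (([:a:] + [:0,1:] * P) ^ p - ([:a:] ^ p + ([:0,1:] * P) ^ p))"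
    unfolding 3 4[symmetric] by (simp add: algebra_simps power_mult_distrib del: mult_pCons_left mult_pCons_right)
  then show ?case
    using 1 2 pCons.IH by (metis dvd_add dvd_diff dvd_mult)
qed

text \<open>Pseudo-division multiplies the dividend by a power of the leading coefficient, which is
  1 here.\<close>

lemma monic_division:
  fixes f :: "int poly"
  assumes "Polynomial.lead_coeff f = 1"
  obtains q r where "P = f * q + r" "r = 0 \<or> Polynomial.degree r < Polynomial.degree f"
proof -
  obtain q r where qr: "pseudo_divmod P f = (q, r)" by fastforce
  have "f \<noteq> 0" using assms by auto
  from pseudo_divmod[OF this qr] assms that show ?thesis by simp
qed

lemma monic_division_unique:
  fixes f :: "int poly"
  assumes "Polynomial.lead_coeff f = 1" "f * q + r = f * q' + r'"
    "r = 0 \<or> Polynomial.degree r < Polynomial.degree f" "r' = 0 \<or> Polynomial.degree r' < Polynomial.degree f"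
  shows "r = r'"
proof (rule ccontr)
  assume ne: "r \<noteq> r'"
  have eq: "f * (q - q') = r' - r" using assms(2) by (simp add: algebra_simps)
  then have "q - q' \<noteq> 0" using ne by auto
  moreover have "f \<noteq> 0" using assms(1) by auto
  ultimately have "Polynomial.degree (r' - r) \<ge> Polynomial.degree f"
    unfolding eq[symmetric] by (simp add: degree_mult_eq)
  moreover have "Polynomial.degree (r' - r) < Polynomial.degree f"
  proof (cases "Polynomial.degree f = 0")
    case True then show ?thesis using assms(3,4) ne by auto
  next
    case False
    then show ?thesis using assms(3,4) by (auto intro!: degree_diff_less)
  qed
  ultimately show False by simp
qed

section \<open>Integer polynomials evaluated at complex numbers\<close>

definition int_ev :: "int poly \<Rightarrow> complex \<Rightarrow> complex" where
  "int_ev P z = poly (map_poly of_int P) z"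

lemma int_ev_0 [simp]: "int_ev 0 z = 0"
  by (simp add: int_ev_def)

lemma int_ev_pCons [simp]: "int_ev (pCons a P) z = of_int a + z * int_ev P z"
  by (cases "a = 0 \<and> P = 0") (auto simp: int_ev_def map_poly_pCons)

lemma int_ev_add [simp]: "int_ev (P + Q) z = int_ev P z + int_ev Q z"
proof (induction P arbitrary: Q)
  case (pCons a P)
  show ?case using pCons.IH by (cases Q) (simp add: algebra_simps del: int_ev_pCons(1) add: int_ev_pCons)
qed simp

lemma int_ev_smult [simp]: "int_ev (Polynomial.smult c P) z = of_int c * int_ev P z"
  by (induction P) (simp_all add: algebra_simps)

lemma int_ev_minus [simp]: "int_ev (- P) z = - int_ev P z"
  using int_ev_smult[of "-1" P z] by simp

lemma int_ev_diff [simp]: "int_ev (P - Q) z = int_ev P z - int_ev Q z"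
  using int_ev_add[of P "- Q" z] by simp

lemma int_ev_1 [simp]: "int_ev 1 z = 1"
  by (simp add: one_pCons)

lemma int_ev_mult [simp]: "int_ev (P * Q) z = int_ev P z * int_ev Q z"
  by (induction P) (simp_all add: algebra_simps)

lemma int_ev_monom [simp]: "int_ev (Polynomial.monom c n) z = of_int c * z ^ n"
  by (induction n) (simp_all add: monom_Suc monom_0)

lemma int_ev_sum [simp]: "int_ev (\<Sum>i\<in>I. P i) z = (\<Sum>i\<in>I. int_ev (P i) z)"
  by (induction I rule: infinite_finite_induct) auto

lemma int_ev_pcompose [simp]: "int_ev (pcompose P Q) z = int_ev P (int_ev Q z)"
  by (induction P) (simp_all add: pcompose_pCons)

text \<open>\<open>f\<close> is the minimal polynomial of \<open>z\<close>, found without leaving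
  the integers: the primitive part of a nonzero vanishing polynomial of least degree divides every
  vanishing polynomial by Gauss's lemma, and since it divides the monic X^m - 1 its leading
  coefficient is a unit.\<close>

lemma exists_monic_divisor:
  fixes z :: complex
  assumes "z ^ m = 1" "m > 0"
  obtains f where "Polynomial.lead_coeff f = 1" "int_ev f z = 0"
    "f dvd Polynomial.monom 1 m - 1" "\<And>P. int_ev P z = 0 \<Longrightarrow> f dvd P"
proof -
  let ?X = "Polynomial.monom 1 m - 1 :: int poly"
  have X0: "int_ev ?X z = 0"
    using assms by simp
  have Xlead: "Polynomial.lead_coeff ?X = 1" and Xne: "?X \<noteq> 0"
  proof -
    have "Polynomial.degree ?X = m"
      using assms(2) by (simp add: diff_conv_add_uminus degree_add_eq_left Polynomial.degree_monom_eq del: add_uminus_conv_diff)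
    then show "Polynomial.lead_coeff ?X = 1" using assms(2) by simp
    then show "?X \<noteq> 0" by (metis leading_coeff_0_iff zero_neq_one)
  qed
  define S where "S = {P. P \<noteq> 0 \<and> int_ev P z = 0}"
  have "?X \<in> S" using X0 Xne by (simp add: S_def)
  then obtain f0 where f0: "f0 \<in> S" "\<And>g. g \<in> S \<Longrightarrow> Polynomial.degree f0 \<le> Polynomial.degree g"
    using ex_has_least_nat[of "\<lambda>P. P \<in> S" ?X Polynomial.degree] by blast
  define f1 where "f1 = primitive_part f0"
  have f0f1: "f0 = Polynomial.smult (content f0) f1" by (simp add: f1_def)
  have f0ne: "f0 \<noteq> 0" using f0 by (simp add: S_def)
  then have c0: "content f0 \<noteq> 0" by simp
  have f1: "f1 \<noteq> 0" "int_ev f1 z = 0" "content f1 = 1" "Polynomial.degree f1 = Polynomial.degree f0"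
    using f0(1) c0 f0ne f0f1 int_ev_smult[of "content f0" f1 z] unfolding S_def f1_def by auto
  have dvd1: "f1 dvd P" if "int_ev P z = 0" for P
  proof -
    obtain q r where qr: "pseudo_divmod P f1 = (q, r)" by fastforce
    define c where "c = Polynomial.lead_coeff f1 ^ (Suc (Polynomial.degree P) - Polynomial.degree f1)"
    have c: "c \<noteq> 0" using f1(1) by (simp add: c_def del: power_Suc)
    from pseudo_divmod[OF f1(1) qr] have e: "Polynomial.smult c P = f1 * q + r"
      and r: "r = 0 \<or> Polynomial.degree r < Polynomial.degree f1" by (simp_all add: c_def)
    have "int_ev r z = 0"
      using arg_cong[OF e, of "\<lambda>P. int_ev P z"] that f1 by simp
    then have "r = 0" using r f0(2)[of r] f1 unfolding S_def mem_Collect_eq by linarith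
    then have e: "Polynomial.smult c P = f1 * q" using e by simp
    \<comment> \<open>As \<open>f1\<close> has content 1, the factor \<open>c\<close> introduced by
      pseudo-division divides the content of \<open>q\<close> and can be cancelled.\<close>
    then have "normalize c * content P = content q"
      using arg_cong[OF e, of content] unfolding content_smult content_mult f1(3) by simp
    then have "c dvd content q" by (metis dvd_triv_left normalize_dvd_iff)
    then have "[:c:] dvd q" by (simp add: const_poly_dvd_iff_dvd_content)
    then obtain q' where "q = [:c:] * q'" ..
    then have "Polynomial.smult c P = Polynomial.smult c (f1 * q')" using e by simp
    then have "P = f1 * q'" using c by (metis smult_cancel)
    then show ?thesis by simp
  qed
  have "Polynomial.lead_coeff f1 dvd 1"
    using dvd1[OF X0] Xlead by (metis dvdE dvd_triv_left lead_coeff_mult)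
  then have u: "Polynomial.lead_coeff f1 * Polynomial.lead_coeff f1 = 1"
    by (simp add: zdvd1_eq abs_if split: if_splits) 
  \<comment> \<open>The leading coefficient is 1 or -1, and multiplying by it makes the polynomial
    monic.\<close>
  define f where "f = Polynomial.smult (Polynomial.lead_coeff f1) f1"
  have "Polynomial.lead_coeff f = 1" using u f1(1) by (simp add: f_def)
  moreover have dvd: "f dvd P" if P: "int_ev P z = 0" for P
  proof -
    obtain Q where "P = f1 * Q" using dvd1[OF P] ..
    then have "P = f * Polynomial.smult (Polynomial.lead_coeff f1) Q" using u by (simp add: f_def)
    then show ?thesis unfolding dvd_def by blast
  qed
  ultimately show ?thesis using that[of f] dvd[OF X0] f1 by (simp add: f_def)
qed

text \<open>To \<open>k\<close> is added \<open>m\<close> times the product of the primes up to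
  \<open>B\<close> that do not divide \<open>k\<close>. A prime up to \<open>B\<close> then divides
  exactly one of the two summands, hence not their sum.\<close>

lemma coprime_as_product_of_large_primes:
  fixes k m B :: nat
  assumes "coprime k m" "m > 0"
  obtains k' where "k' > 0" "k' mod m = k mod m" "\<And>p. Factorial_Ring.prime p \<Longrightarrow> p dvd k' \<Longrightarrow> p > B"
proof -
  define Q where "Q = {q. Factorial_Ring.prime q \<and> q \<le> B \<and> \<not> q dvd k}"
  have fin: "finite Q" by (rule finite_subset[of _ "{..B}"]) (auto simp: Q_def)
  define k' where "k' = k + m * \<Prod>Q"
  have "\<Prod>Q > 0" using fin by (intro prod_pos) (auto simp: Q_def prime_gt_0_nat)
  then have "k' > 0" using assms by (simp add: k'_def)
  moreover have "k' mod m = k mod m" by (simp add: k'_def)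
  moreover have "p > B" if p: "Factorial_Ring.prime p" "p dvd k'" for p
  proof (rule ccontr)
    assume "\<not> p > B"
    show False
    proof (cases "p dvd k")
      case True
      then have "p dvd m * \<Prod>Q" using that(2) unfolding k'_def by (metis dvd_add_right_iff)
      moreover have "\<not> p dvd m" using True assms that
        by (metis coprime_common_divisor not_prime_unit)
      ultimately have "p dvd \<Prod>Q" using that by (simp add: prime_dvd_mult_iff)
      then obtain q where "q \<in> Q" "p dvd q" using p(1) fin prime_dvd_prod_iff[of Q p "\<lambda>x. x"] by auto
      then show False using True p primes_dvd_imp_eq unfolding Q_def by blast
    next
      case False
      then have "p \<in> Q" using that \<open>\<not> p > B\<close> by (simp add: Q_def)
      then have "p dvd m * \<Prod>Q" using fin dvd_prodI[of Q p "\<lambda>x. x"] by (simp add: dvd_mult)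
      then show False using that(2) False unfolding k'_def by (metis dvd_add_left_iff)
    qed
  qed
  ultimately show ?thesis using that by blast
qed

text \<open>Landau's argument: modulo a monic divisor \<open>f\<close> of \<open>X^m - 1\<close> the remainders of the
  \<open>f(X^k)\<close> take finitely many values, and for a prime \<open>p\<close> the remainder of \<open>f(X^p)\<close> is
  divisible by \<open>p\<close>; hence it vanishes for all large \<open>p\<close>. Every \<open>k\<close> coprime to \<open>m\<close> is
  congruent modulo \<open>m\<close> to a product of large primes.\<close>

lemma monic_divisor_root_power:
  fixes z :: complex
  assumes "m > 0" "coprime k m" "Polynomial.lead_coeff f = 1" "f dvd Polynomial.monom 1 m - 1" "int_ev f z = 0"
  shows "int_ev f (z ^ k) = 0"
proof -
  let ?X = "Polynomial.monom 1 m - 1 :: int poly"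
  let ?f = "\<lambda>k. pcompose f (Polynomial.monom 1 k)"
  have zm: "w ^ m = 1" if "int_ev f w = 0" for w
  proof -
    obtain g where "?X = f * g" using assms(4) ..
    then have "int_ev ?X w = 0" using that by simp
    then show ?thesis by simp
  qed
  have "\<forall>k. \<exists>q r. ?f k = f * q + r \<and> (r = 0 \<or> Polynomial.degree r < Polynomial.degree f)"
    using monic_division[OF assms(3)] by metis
  then obtain q r where qr: "\<And>k. ?f k = f * q k + r k"
    "\<And>k. r k = 0 \<or> Polynomial.degree (r k) < Polynomial.degree f" by metis
  have congX: "f dvd Polynomial.monom 1 (i + m * j) - Polynomial.monom 1 i" for i j
  proof (induction j)
    case (Suc j)
    have "Polynomial.monom 1 (i + m * Suc j) - Polynomial.monom 1 i =
       Polynomial.monom 1 (i + m * j) * ?X + (Polynomial.monom 1 (i + m * j) - Polynomial.monom 1 i)"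
      by (simp add: algebra_simps mult_monom)
    then show ?case using Suc assms(4) by (metis dvd_add dvd_mult)
  qed simp
  \<comment> \<open>Applied to two powers of X that are congruent modulo \<open>f\<close>, this
    shows that the remainder of f(X^k) depends only on k modulo \<open>m\<close>.\<close>
  have comp_dvd: "(a - b) dvd pcompose P a - pcompose P b" for P a b :: "int poly"
  proof (induction P)
    case (pCons c P)
    have "pcompose (pCons c P) a - pcompose (pCons c P) b =
       a * (pcompose P a - pcompose P b) + (a - b) * pcompose P b"
      by (simp add: pcompose_pCons algebra_simps)
    then show ?case using pCons.IH by (metis dvd_add dvd_mult dvd_triv_left)
  qed simp
  have rmod: "r k = r (k mod m)" for k
  proof -
    have "f dvd Polynomial.monom 1 k - Polynomial.monom 1 (k mod m)"
      using congX[of "k mod m" "k div m"] by simp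
    then have "f dvd ?f k - ?f (k mod m)" using comp_dvd dvd_trans by blast
    then obtain g where "?f k - ?f (k mod m) = f * g" ..
    then have "f * q k + r k = f * (q (k mod m) + g) + r (k mod m)"
      using qr(1)[of k] qr(1)[of "k mod m"] by (simp add: algebra_simps)
    then show ?thesis using monic_division_unique[OF assms(3)] qr(2) by blast
  qed
  \<comment> \<open>One bound serves all remainders: \<open>rmod\<close> leaves only finitely many
    of them, and coefficients beyond the degree of \<open>f\<close> vanish.\<close>
  define B where "B = Max ((\<lambda>(k, i). nat \<bar>poly.coeff (r k) i\<bar>) ` ({..<m} \<times> {..Polynomial.degree f}))"
  have B: "nat \<bar>poly.coeff (r k) i\<bar> \<le> B" for k i
  proof (cases "i \<le> Polynomial.degree f")
    case True
    have "nat \<bar>poly.coeff (r (k mod m)) i\<bar> \<le> B"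
      unfolding B_def using True assms(1) by (intro Max_ge) auto
    then show ?thesis by (simp add: rmod[of k])
  next
    case False
    then have "poly.coeff (r k) i = 0" using qr(2)[of k] by (auto intro: coeff_eq_0)
    then show ?thesis by simp
  qed
  have large: "r p = 0" if p: "Factorial_Ring.prime p" "p > B" for p
  proof -
    obtain h where h: "?f p - f ^ p = of_nat p * h"
      using prime_dvd_pcompose_power[OF p(1)] by (metis dvdE)
    obtain q' r' where q': "h = f * q' + r'" "r' = 0 \<or> Polynomial.degree r' < Polynomial.degree f"
      using monic_division[OF assms(3)] .
    have "p > 0" using p prime_gt_0_nat by blast
    then have "f ^ p = f * f ^ (p - 1)" by (metis power_eq_if not_gr_zero)
    then have "f * q p + r p = f * (f ^ (p - 1) + of_nat p * q') + of_nat p * r'"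
      using h qr(1)[of p] unfolding q' by (simp add: algebra_simps)
    moreover have "of_nat p * r' = 0 \<or> Polynomial.degree (of_nat p * r') < Polynomial.degree f"
      using q'(2) by (auto simp: of_nat_poly)
    ultimately have rp: "r p = of_nat p * r'"
      using monic_division_unique[OF assms(3)] qr(2) by blast
    have "poly.coeff r' i = 0" for i
    proof (rule ccontr)
      assume "poly.coeff r' i \<noteq> 0"
      then have "1 \<le> \<bar>poly.coeff r' i\<bar>" by linarith
      then have "int p \<le> int p * \<bar>poly.coeff r' i\<bar>" by (simp add: mult_le_cancel_left1)
      also have "\<dots> = \<bar>poly.coeff (r p) i\<bar>" by (simp add: rp of_nat_poly abs_mult)
      finally show False using B[of p i] p by linarith
    qed
    then have "r' = 0" by (simp add: poly_eq_iff)
    then show ?thesis by (simp add: rp)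
  qed
  have step: "int_ev f (w ^ p) = 0" if "Factorial_Ring.prime p" "p > B" "int_ev f w = 0" for p w
  proof -
    have "int_ev f (w ^ p) = int_ev (?f p) w" by simp
    also have "\<dots> = 0" unfolding qr(1) using that large by simp
    finally show ?thesis .
  qed
  obtain k' where k': "k' > 0" "k' mod m = k mod m" "\<And>p. Factorial_Ring.prime p \<Longrightarrow> p dvd k' \<Longrightarrow> p > B"
    using coprime_as_product_of_large_primes[OF assms(2,1)] by metis
  \<comment> \<open>\<open>step\<close> is applied once per prime factor of the exponent, the root
    \<open>w\<close> being replaced by \<open>w ^ p\<close> each time.\<close>
  have "int_ev f (w ^ l) = 0" if "l > 0" "\<And>p. Factorial_Ring.prime p \<Longrightarrow> p dvd l \<Longrightarrow> p > B" "int_ev f w = 0" for l w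
    using that
  proof (induction l arbitrary: w rule: less_induct)
    case (less l)
    show ?case
    proof (cases "l = 1")
      case False
      then obtain p where p: "Factorial_Ring.prime p" "p dvd l" using prime_factor_nat by blast
      then obtain l' where l': "l = p * l'" by (elim dvdE)
      have pB: "p > B" using less.prems(2) p by blast
      have "int_ev f ((w ^ p) ^ l') = 0"
      proof (rule less.IH)
        show "l' < l" using l' less.prems(1) prime_gt_1_nat[OF p(1)] by simp
        show "l' > 0" using l' less.prems(1) by simp
        show "q > B" if "Factorial_Ring.prime q" "q dvd l'" for q
          using less.prems(2) that l' by simp
        show "int_ev f (w ^ p) = 0" using step[OF p(1) pB less.prems(3)] .
      qed
      then show ?thesis by (simp add: l' power_mult)
    qed (use less in simp)
  qed
  then have "int_ev f (z ^ k') = 0" using k' assms(5) by blast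
  moreover have "z ^ k' = z ^ k"
  proof -
    have "z ^ l = z ^ (l mod m)" for l
    proof -
      have "z ^ l = z ^ (m * (l div m) + l mod m)" by simp
      also have "\<dots> = z ^ (l mod m)" unfolding power_add power_mult using zm[OF assms(5)] by simp
      finally show ?thesis .
    qed
    then show ?thesis using k'(2) by metis
  qed
  ultimately show ?thesis by simp
qed

text \<open>All \<open>z i\<close> are powers of one primitive root \<open>w\<close>, so after
  clearing denominators the relation is an integer polynomial vanishing at \<open>w\<close>. It is
  divisible by the monic polynomial of \<open>exists_monic_divisor\<close>, which also vanishes at
  \<open>w ^ k\<close>.\<close>

lemma rational_relation_power:
  fixes f :: "'i \<Rightarrow> rat" and z :: "'i \<Rightarrow> complex"
  assumes "finite I" "m > 0" "coprime k m" "\<And>i. i \<in> I \<Longrightarrow> z i ^ m = 1"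
    "(\<Sum>i\<in>I. of_rat (f i) * z i) = 0"
  shows "(\<Sum>i\<in>I. of_rat (f i) * z i ^ k) = 0"
proof -
  define w where "w = cis (2 * pi / m)"
  have wm: "w ^ m = 1" using assms(2) by (simp add: w_def Complex.DeMoivre)
  have "\<forall>i\<in>I. \<exists>a. z i = w ^ a"
  proof
    fix i assume "i \<in> I"
    then have "z i \<in> {z. z ^ m = 1}" using assms(4) by simp
    then obtain a where "z i = cis (2 * pi * real a / real m)"
      using bij_betw_imp_surj_on[OF bij_betw_roots_unity[OF assms(2)]] by blast
    then have "z i = w ^ a" by (simp add: w_def Complex.DeMoivre mult_ac)
    then show "\<exists>a. z i = w ^ a" ..
  qed
  then obtain a where a: "\<And>i. i \<in> I \<Longrightarrow> z i = w ^ a i" by metis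
  obtain D :: int where D: "D > 0" "\<And>i. i \<in> I \<Longrightarrow> of_int D * f i \<in> \<int>"
  proof -
    define D where "D = (\<Prod>i\<in>I. snd (quotient_of (f i)))"
    have "of_int D * f i \<in> \<int>" if "i \<in> I" for i
    proof -
      have "D = snd (quotient_of (f i)) * (\<Prod>i\<in>I-{i}. snd (quotient_of (f i)))"
        unfolding D_def using that assms(1) by (simp add: prod.remove)
      moreover have "f i * of_int (snd (quotient_of (f i))) = of_int (fst (quotient_of (f i)))"
        using quotient_of_div[of "f i"] quotient_of_denom_pos[of "f i"] by (metis less_irrefl nonzero_eq_divide_eq of_int_eq_0_iff prod.collapse)
      ultimately have "of_int D * f i = of_int (fst (quotient_of (f i)) * (\<Prod>i\<in>I-{i}. snd (quotient_of (f i))))"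
        by (simp add: mult_ac)
      then show ?thesis using Ints_of_int by metis
    qed
    moreover have "D > 0" unfolding D_def by (intro prod_pos) (metis quotient_of_denom_pos')
    ultimately show ?thesis using that by blast
  qed
  then have "\<forall>i\<in>I. \<exists>b. of_int D * f i = of_int b" by (metis Ints_cases)
  then obtain b where b: "\<And>i. i \<in> I \<Longrightarrow> of_int D * f i = of_int (b i)" by metis
  have b': "of_int D * of_rat (f i) = (of_int (b i) :: complex)" if "i \<in> I" for i
    using arg_cong[OF b[OF that], of "of_rat :: rat \<Rightarrow> complex"] by (simp add: of_rat_mult)
  define P where "P = (\<Sum>i\<in>I. Polynomial.monom (b i) (a i))"
  have ev: "int_ev P (w ^ j) = of_int D * (\<Sum>i\<in>I. of_rat (f i) * z i ^ j)" for j
    unfolding P_def int_ev_sum sum_distrib_left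
    by (intro sum.cong) (auto simp: a b'[symmetric] mult_ac simp flip: power_mult)
  have "int_ev P w = 0" using ev[of 1] assms(5) by simp
  obtain h where h: "Polynomial.lead_coeff h = 1" "int_ev h w = 0" "h dvd Polynomial.monom 1 m - 1"
    "\<And>P. int_ev P w = 0 \<Longrightarrow> h dvd P"
    using exists_monic_divisor[OF wm assms(2)] by blast
  have "int_ev h (w ^ k) = 0" using monic_divisor_root_power[OF assms(2,3) h(1,3,2)] .
  then have "int_ev P (w ^ k) = 0" using h(4)[OF \<open>int_ev P w = 0\<close>] by (auto elim!: dvdE)
  then show ?thesis using D(1) by (simp add: ev)
qed

section \<open>The complex group algebra\<close>

lemma sum_fun_apply: "(\<Sum>i\<in>I. f i) x = (\<Sum>i\<in>I. f i x)"
  by (induction I rule: infinite_finite_induct) auto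

definition smul :: "complex \<Rightarrow> ('a \<Rightarrow> complex) \<Rightarrow> 'a \<Rightarrow> complex" where
  "smul c a = (\<lambda>x. c * a x)"

lemma smul_apply [simp]: "smul c a x = c * a x"
  by (simp add: smul_def)

lemma smul_smul [simp]: "smul c (smul d a) = smul (c * d) a"
  by (simp add: fun_eq_iff)

lemma smul_one [simp]: "smul 1 a = a"
  by (simp add: fun_eq_iff)

lemma smul_sum: "smul c (\<Sum>i\<in>I. f i) = (\<Sum>i\<in>I. smul c (f i))"
  by (simp add: fun_eq_iff sum_fun_apply sum_distrib_left)

lemma sum_const_fun: "(\<Sum>i\<in>I. (a :: 'a \<Rightarrow> complex)) = smul (of_nat (card I)) a"
  by (simp add: fun_eq_iff sum_fun_apply)

text \<open>The right-hand sum runs over a set and so counts each value once, as e(M, H, K) does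
  with distinct conjugates. Sums over a group and sums over an orbit differ by the common size of
  the fibres.\<close>

lemma sum_over_fibres:
  assumes "finite A" "\<And>y. y \<in> f ` A \<Longrightarrow> card {x \<in> A. f x = y} = c"
  shows "(\<Sum>x\<in>A. f x) = smul (of_nat c) (\<Sum>(f ` A))"
proof -
  have "(\<Sum>x\<in>A. f x) = (\<Sum>y\<in>f ` A. \<Sum>x\<in>{x \<in> A. f x = y}. f x)"
    using assms(1) by (rule sum.image_gen)
  also have "\<dots> = (\<Sum>y\<in>f ` A. smul (of_nat c) y)"
  proof (rule sum.cong[OF refl])
    fix y assume y: "y \<in> f ` A"
    have "(\<Sum>x\<in>{x \<in> A. f x = y}. f x) = (\<Sum>x\<in>{x \<in> A. f x = y}. y)" by (rule sum.cong) auto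
    then show "(\<Sum>x\<in>{x \<in> A. f x = y}. f x) = smul (of_nat c) y"
      using assms(2)[OF y] by (simp add: sum_const_fun del: sum_constant)
  qed
  finally show ?thesis by (simp add: smul_sum)
qed

lemma smul_0 [simp]: "smul 0 a = 0" "smul c 0 = 0"
  by (simp_all add: fun_eq_iff)

lemma smul_cancel_iff: "smul c a = smul d a \<longleftrightarrow> c = d \<or> a = 0"
  by (auto simp: fun_eq_iff)

lemma smul_eq_0_iff: "smul c a = 0 \<longleftrightarrow> c = 0 \<or> a = 0"
  by (auto simp: fun_eq_iff)

definition supp_on :: "'a set \<Rightarrow> ('a \<Rightarrow> complex) \<Rightarrow> bool" where
  "supp_on M a \<longleftrightarrow> (\<forall>x. x \<notin> M \<longrightarrow> a x = 0)"

lemma supp_on_sum: "(\<And>i. i \<in> I \<Longrightarrow> supp_on M (f i)) \<Longrightarrow> supp_on M (\<Sum>i\<in>I. f i)"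
  by (auto simp: supp_on_def sum_fun_apply)

lemma supp_on_smul: "supp_on M a \<Longrightarrow> supp_on M (smul c a)"
  by (simp add: supp_on_def)

lemma supp_on_mono: "supp_on M a \<Longrightarrow> M \<subseteq> M' \<Longrightarrow> supp_on M' a"
  by (auto simp: supp_on_def)

locale fin_group = group G for G (structure) +
  assumes fin: "finite (carrier G)"
begin

lemma subgroup_finite: "subgroup M G \<Longrightarrow> finite M"
  using fin finite_subset subgroup.subset by blast

lemma subgroup_card_pos: "subgroup M G \<Longrightarrow> card M > 0"
  using subgroup_finite subgroup.one_closed by (metis card_gt_0_iff empty_iff)

lemma mult_cancel_inv [simp]:
  "x \<in> carrier G \<Longrightarrow> y \<in> carrier G \<Longrightarrow> x \<otimes> (inv x \<otimes> y) = y"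
  "x \<in> carrier G \<Longrightarrow> y \<in> carrier G \<Longrightarrow> inv x \<otimes> (x \<otimes> y) = y"
  by (simp_all flip: m_assoc)

lemma conj_mult: "g \<in> carrier G \<Longrightarrow> x \<in> carrier G \<Longrightarrow> y \<in> carrier G \<Longrightarrow>
    inv g \<otimes> (x \<otimes> y) \<otimes> g = (inv g \<otimes> x \<otimes> g) \<otimes> (inv g \<otimes> y \<otimes> g)"
  by (simp add: m_assoc)

lemma conj_inv: "g \<in> carrier G \<Longrightarrow> x \<in> carrier G \<Longrightarrow>
    inv (inv g \<otimes> x \<otimes> g) = inv g \<otimes> inv x \<otimes> g"
  by (simp add: inv_mult_group m_assoc)

lemma conj_comp: "g \<in> carrier G \<Longrightarrow> h \<in> carrier G \<Longrightarrow> x \<in> carrier G \<Longrightarrow>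
    inv (g \<otimes> h) \<otimes> x \<otimes> (g \<otimes> h) = inv h \<otimes> (inv g \<otimes> x \<otimes> g) \<otimes> h"
  by (simp add: inv_mult_group m_assoc)

lemma conj_cancel [simp]: "g \<in> carrier G \<Longrightarrow> x \<in> carrier G \<Longrightarrow> inv g \<otimes> (g \<otimes> x \<otimes> inv g) \<otimes> g = x"
    "g \<in> carrier G \<Longrightarrow> x \<in> carrier G \<Longrightarrow> g \<otimes> (inv g \<otimes> x \<otimes> g) \<otimes> inv g = x"
  by (simp_all add: m_assoc)

lemma conj_pow: "g \<in> carrier G \<Longrightarrow> x \<in> carrier G \<Longrightarrow>
    (inv g \<otimes> x \<otimes> g) [^] (k::nat) = inv g \<otimes> x [^] k \<otimes> g"
  by (induction k) (simp_all add: conj_mult)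

lemma sum_reindex_subgroup_mult_right:
  assumes "subgroup M G" "d \<in> M"
  shows "(\<Sum>y\<in>M. f (y \<otimes> d)) = (\<Sum>y\<in>M. f y)"
  using assms subgroup.mem_carrier[OF assms(1)]
  by (intro sum.reindex_bij_witness[of _ "\<lambda>y. y \<otimes> inv d" "\<lambda>y. y \<otimes> d"])
     (auto simp: m_assoc subgroup.m_closed subgroup.m_inv_closed)

lemma sum_reindex_subgroup_mult_left:
  assumes "subgroup M G" "d \<in> M"
  shows "(\<Sum>y\<in>M. f (d \<otimes> y)) = (\<Sum>y\<in>M. f y)"
  using assms subgroup.mem_carrier[OF assms(1)]
  by (intro sum.reindex_bij_witness[of _ "\<lambda>y. inv d \<otimes> y" "\<lambda>y. d \<otimes> y"])
     (auto simp: subgroup.m_closed subgroup.m_inv_closed)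

lemma sum_reindex_mult_right:
  "d \<in> carrier G \<Longrightarrow> (\<Sum>y\<in>carrier G. f (y \<otimes> d)) = (\<Sum>y\<in>carrier G. f y)"
  using sum_reindex_subgroup_mult_right[OF subgroup_self] .

lemma sum_reindex_mult_left:
  "d \<in> carrier G \<Longrightarrow> (\<Sum>y\<in>carrier G. f (d \<otimes> y)) = (\<Sum>y\<in>carrier G. f y)"
  using sum_reindex_subgroup_mult_left[OF subgroup_self] .

section \<open>Convolution, conjugation and power maps\<close>

definition cv :: "('a \<Rightarrow> complex) \<Rightarrow> ('a \<Rightarrow> complex) \<Rightarrow> 'a \<Rightarrow> complex" where
  "cv a b = (\<lambda>x. if x \<in> carrier G then \<Sum>y\<in>carrier G. a y * b (inv y \<otimes> x) else 0)"

definition cj :: "'a \<Rightarrow> ('a \<Rightarrow> complex) \<Rightarrow> 'a \<Rightarrow> complex" where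
  "cj g a = (\<lambda>x. if x \<in> carrier G then a (inv g \<otimes> x \<otimes> g) else 0)"

definition pw :: "nat \<Rightarrow> ('a \<Rightarrow> complex) \<Rightarrow> 'a \<Rightarrow> complex" where
  "pw k a = (\<lambda>x. if x \<in> carrier G then a (x [^] k) else 0)"

lemma cv_assoc: "cv (cv a b) c = cv a (cv b c)"
proof
  fix x
  show "cv (cv a b) c x = cv a (cv b c) x"
  proof (cases "x \<in> carrier G")
    case True
    have "cv (cv a b) c x = (\<Sum>y\<in>carrier G. \<Sum>z\<in>carrier G. a z * b (inv z \<otimes> y) * c (inv y \<otimes> x))"
      using True by (simp add: cv_def sum_distrib_right)
    also have "\<dots> = (\<Sum>z\<in>carrier G. \<Sum>y\<in>carrier G. a z * b (inv z \<otimes> y) * c (inv y \<otimes> x))"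
      by (rule sum.swap)
    also have "\<dots> = (\<Sum>z\<in>carrier G. \<Sum>w\<in>carrier G. a z * b w * c (inv w \<otimes> (inv z \<otimes> x)))"
    proof (rule sum.cong[OF refl])
      fix z assume z: "z \<in> carrier G"
      have "(\<Sum>y\<in>carrier G. a z * b (inv z \<otimes> y) * c (inv y \<otimes> x)) =
        (\<Sum>w\<in>carrier G. a z * b (inv z \<otimes> (z \<otimes> w)) * c (inv (z \<otimes> w) \<otimes> x))"
        using sum_reindex_mult_left[OF z, of "\<lambda>y. a z * b (inv z \<otimes> y) * c (inv y \<otimes> x)"] by simp
      also have "\<dots> = (\<Sum>w\<in>carrier G. a z * b w * c (inv w \<otimes> (inv z \<otimes> x)))"
        using z True by (intro sum.cong refl) (simp add: inv_mult_group m_assoc)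
      finally show "(\<Sum>y\<in>carrier G. a z * b (inv z \<otimes> y) * c (inv y \<otimes> x)) =
        (\<Sum>w\<in>carrier G. a z * b w * c (inv w \<otimes> (inv z \<otimes> x)))" .
    qed
    also have "\<dots> = cv a (cv b c) x"
      using True by (simp add: cv_def sum_distrib_left mult.assoc)
    finally show ?thesis .
  qed (simp add: cv_def)
qed

lemma cv_sum_left: "cv (\<Sum>i\<in>I. f i) b = (\<Sum>i\<in>I. cv (f i) b)"
proof
  fix x
  show "cv (\<Sum>i\<in>I. f i) b x = (\<Sum>i\<in>I. cv (f i) b) x"
    by (simp add: cv_def sum_fun_apply sum_distrib_right sum.swap[of _ I])
qed

lemma cv_sum_right: "cv a (\<Sum>i\<in>I. f i) = (\<Sum>i\<in>I. cv a (f i))"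
proof
  fix x
  show "cv a (\<Sum>i\<in>I. f i) x = (\<Sum>i\<in>I. cv a (f i)) x"
    by (simp add: cv_def sum_fun_apply sum_distrib_left sum.swap[of _ I])
qed

lemma cv_smul_left [simp]: "cv (smul c a) b = smul c (cv a b)"
  by (auto simp: fun_eq_iff cv_def sum_distrib_left mult.assoc)

lemma cv_smul_right [simp]: "cv a (smul c b) = smul c (cv a b)"
  by (auto simp: fun_eq_iff cv_def sum_distrib_left mult_ac)

lemma cv_0 [simp]: "cv 0 a = 0" "cv a 0 = 0"
  by (auto simp: fun_eq_iff cv_def)

lemma cv_diff_left: "cv (a - b) c = cv a c - cv b c"
  by (auto simp: fun_eq_iff cv_def algebra_simps sum_subtractf)

lemma cv_diff_right: "cv c (a - b) = cv c a - cv c b"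
  by (auto simp: fun_eq_iff cv_def algebra_simps sum_subtractf)

lemma cv_supp:
  assumes "subgroup M G" "supp_on M a" "supp_on M b"
  shows "supp_on M (cv a b)"
  unfolding supp_on_def
proof (intro allI impI)
  fix x assume x: "x \<notin> M"
  have "a y * b (inv y \<otimes> x) = 0" if "y \<in> carrier G" "x \<in> carrier G" for y
  proof (cases "y \<in> M")
    case True
    then have "inv y \<otimes> x \<notin> M"
      using x that assms(1) by (metis inv_solve_left subgroup.m_closed subgroup.mem_carrier)
    then show ?thesis using assms(3) by (simp add: supp_on_def)
  qed (use assms(2) in \<open>simp add: supp_on_def\<close>)
  then show "cv a b x = 0" unfolding cv_def by (auto intro!: sum.neutral)
qed

lemma cj_cv: 
  assumes g: "g \<in> carrier G"
  shows "cj g (cv a b) = cv (cj g a) (cj g b)"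
proof
  fix x
  show "cj g (cv a b) x = cv (cj g a) (cj g b) x"
  proof (cases "x \<in> carrier G")
    case True
    have "cj g (cv a b) x = (\<Sum>y\<in>carrier G. a y * b (inv y \<otimes> (inv g \<otimes> x \<otimes> g)))"
      using True g by (simp add: cj_def cv_def)
    also have "\<dots> = (\<Sum>z\<in>carrier G. a (inv g \<otimes> z \<otimes> g) * b (inv g \<otimes> (inv z \<otimes> x) \<otimes> g))"
      using g True
      by (intro sum.reindex_bij_witness[of _ "\<lambda>z. inv g \<otimes> z \<otimes> g" "\<lambda>y. g \<otimes> y \<otimes> inv g"])
         (auto simp: inv_mult_group m_assoc)
    also have "\<dots> = cv (cj g a) (cj g b) x"
      using True g by (simp add: cj_def cv_def)
    finally show ?thesis .
  qed (simp add: cv_def cj_def)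
qed

lemma cj_cj [simp]: "g \<in> carrier G \<Longrightarrow> h \<in> carrier G \<Longrightarrow> cj g (cj h a) = cj (g \<otimes> h) a"
  by (auto simp: fun_eq_iff cj_def conj_comp)

lemma cj_one: "supp_on (carrier G) a \<Longrightarrow> cj \<one> a = a"
  by (auto simp: fun_eq_iff cj_def supp_on_def)

lemma cj_inv_cancel: "g \<in> carrier G \<Longrightarrow> supp_on (carrier G) a \<Longrightarrow> cj (inv g) (cj g a) = a"
    "g \<in> carrier G \<Longrightarrow> supp_on (carrier G) a \<Longrightarrow> cj g (cj (inv g) a) = a"
  by (simp_all add: cj_one)

lemma cj_0 [simp]: "cj g 0 = 0"
  by (simp add: fun_eq_iff cj_def)

lemma cj_sum: "cj g (\<Sum>i\<in>I. f i) = (\<Sum>i\<in>I. cj g (f i))"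
  by (auto simp: fun_eq_iff cj_def sum_fun_apply)

lemma cj_smul [simp]: "cj g (smul c a) = smul c (cj g a)"
  by (auto simp: fun_eq_iff cj_def)

text \<open>The fibre over \<open>cj g0 a\<close> is the left coset of the stabilizer of
  \<open>a\<close> given by \<open>g0\<close>.\<close>

lemma card_cj_fibre:
  assumes M: "subgroup M G" and a: "supp_on (carrier G) a" and g0: "g0 \<in> M"
  shows "card {g \<in> M. cj g a = cj g0 a} = card {g \<in> M. cj g a = a}"
proof -
  have MG: "g \<in> carrier G" if "g \<in> M" for g using that M subgroup.mem_carrier by metis
  have "{g \<in> M. cj g a = cj g0 a} = (\<lambda>u. g0 \<otimes> u) ` {g \<in> M. cj g a = a}"
  proof (intro equalityI subsetI)
    fix g assume "g \<in> {g \<in> M. cj g a = cj g0 a}"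
    then have g: "g \<in> M" "cj g a = cj g0 a" by auto
    have "cj (inv g0) (cj g a) = a" using g(2) cj_inv_cancel(1)[OF MG[OF g0] a] by simp
    then have "cj (inv g0 \<otimes> g) a = a"
      unfolding cj_cj[OF inv_closed[OF MG[OF g0]] MG[OF g(1)]] .
    moreover have "inv g0 \<otimes> g \<in> M" using M g g0 by (simp add: subgroup.m_closed subgroup.m_inv_closed)
    moreover have "g = g0 \<otimes> (inv g0 \<otimes> g)" using MG g g0 by simp
    ultimately show "g \<in> (\<lambda>u. g0 \<otimes> u) ` {g \<in> M. cj g a = a}" by blast
  next
    fix g assume "g \<in> (\<lambda>u. g0 \<otimes> u) ` {g \<in> M. cj g a = a}"
    then obtain u where u: "u \<in> M" "cj u a = a" "g = g0 \<otimes> u" by blast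
    have "cj g0 (cj u a) = cj g0 a" unfolding u(2) ..
    then have "cj (g0 \<otimes> u) a = cj g0 a" unfolding cj_cj[OF MG[OF g0] MG[OF u(1)]] .
    then show "g \<in> {g \<in> M. cj g a = cj g0 a}"
      using u(1,3) g0 M by (simp add: subgroup.m_closed)
  qed
  moreover have "inj_on (\<lambda>u. g0 \<otimes> u) {g \<in> M. cj g a = a}"
    using g0 MG by (intro inj_onI) auto
  ultimately show ?thesis by (simp add: card_image)
qed

lemma pw_cj: "g \<in> carrier G \<Longrightarrow> pw k (cj g a) = cj g (pw k a)"
  by (auto simp: fun_eq_iff cj_def pw_def conj_pow)

lemma pw_pw: "pw j (pw k a) = pw (j * k) a"
  by (auto simp: fun_eq_iff pw_def nat_pow_pow)

lemma pw_sum: "pw k (\<Sum>i\<in>I. f i) = (\<Sum>i\<in>I. pw k (f i))"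
  by (auto simp: fun_eq_iff pw_def sum_fun_apply)

lemma pw_smul [simp]: "pw k (smul c a) = smul c (pw k a)"
  by (auto simp: fun_eq_iff pw_def)

lemma pw_supp: "supp_on (carrier G) (pw k a)"
  by (simp add: supp_on_def pw_def)

lemma pow_mod_order: "x \<in> carrier G \<Longrightarrow> x [^] (k mod order G) = x [^] (k::nat)"
proof -
  assume x: "x \<in> carrier G"
  have "x [^] k = x [^] (order G * (k div order G) + k mod order G)" by simp
  also have "\<dots> = (x [^] order G) [^] (k div order G) \<otimes> x [^] (k mod order G)"
    using x by (simp only: nat_pow_mult[symmetric] nat_pow_pow)
  finally show ?thesis using x by (simp add: pow_order_eq_1)
qed

lemma pw_mod: "pw (k mod order G) a = pw k a"
  by (auto simp: fun_eq_iff pw_def pow_mod_order)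

lemma pw_1: "supp_on (carrier G) a \<Longrightarrow> pw 1 a = a"
  by (auto simp: fun_eq_iff pw_def supp_on_def)

lemma order_pos: "order G > 0"
  using fin order_gt_0_iff_finite by blast

text \<open>Units are kept as representatives below \<open>order G\<close>. For the trivial group
  the only one is 0, which is why the neutral unit is written \<open>1 mod order G\<close>
  throughout.\<close>

definition units_mod :: "nat set" where
  "units_mod = {k. k < order G \<and> coprime k (order G)}"

lemma units_mod_finite: "finite units_mod"
  by (simp add: units_mod_def)

lemma units_mod_mult: "j \<in> units_mod \<Longrightarrow> k \<in> units_mod \<Longrightarrow> (j * k) mod order G \<in> units_mod"
  using order_pos by (simp add: units_mod_def)

lemma units_mod_one: "1 mod order G \<in> units_mod"
  using order_pos by (simp add: units_mod_def)

lemma units_mod_inverse: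
  assumes "k \<in> units_mod"
  obtains l where "l \<in> units_mod" "(k * l) mod order G = 1 mod order G"
proof -
  have "coprime k (order G)" using assms by (simp add: units_mod_def)
  then obtain x where x: "[k * x = 1] (mod order G)"
    using cong_solve_coprime_nat by auto
  then have "coprime x (order G)"
    by (metis cong_imp_coprime cong_sym coprime_1_left coprime_mult_left_iff)
  then have "x mod order G \<in> units_mod" using order_pos by (simp add: units_mod_def)
  moreover have "(k * (x mod order G)) mod order G = 1 mod order G"
    using x by (simp add: cong_def mod_mult_right_eq)
  ultimately show ?thesis using that by blast
qed

lemma units_mod_mult_bij:
  assumes "k \<in> units_mod"
  shows "bij_betw (\<lambda>j. (k * j) mod order G) units_mod units_mod"
proof -
  have inj: "inj_on (\<lambda>j. (k * j) mod order G) units_mod"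
  proof (rule inj_onI)
    fix i j assume ij: "i \<in> units_mod" "j \<in> units_mod" "(k * i) mod order G = (k * j) mod order G"
    then have "[i = j] (mod order G)"
      using assms by (simp add: units_mod_def cong_mult_lcancel_nat flip: cong_def)
    then show "i = j" using ij by (simp add: units_mod_def cong_def)
  qed
  moreover have "(\<lambda>j. (k * j) mod order G) ` units_mod \<subseteq> units_mod"
    using units_mod_mult[OF assms] by auto
  ultimately show ?thesis
    using units_mod_finite by (simp add: bij_betw_def card_image card_subset_eq)
qed

lemma pw_inj:
  assumes "k \<in> units_mod" "supp_on (carrier G) a" "supp_on (carrier G) b"
  shows "pw k a = pw k b \<longleftrightarrow> a = b"
proof
  assume eq: "pw k a = pw k b"
  obtain l where l: "l \<in> units_mod" "(k * l) mod order G = 1 mod order G"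
    using units_mod_inverse[OF assms(1)] .
  have "pw l (pw k c) = c" if "supp_on (carrier G) c" for c
    using l(2) pw_mod[of "l * k" c] pw_mod[of 1 c] pw_1[OF that] by (simp add: pw_pw mult.commute)
  then show "a = b" using eq assms by metis
qed auto

lemma card_pw_fibre:
  assumes "k0 \<in> units_mod" "supp_on (carrier G) a"
  shows "card {k \<in> units_mod. pw k a = pw k0 a} = card {k \<in> units_mod. pw k a = a}"
proof -
  have bij: "bij_betw (\<lambda>j. (k0 * j) mod order G) units_mod units_mod"
    by (rule units_mod_mult_bij[OF assms(1)])
  have iff: "pw ((k0 * j) mod order G) a = pw k0 a \<longleftrightarrow> pw j a = a" for j
    unfolding pw_mod pw_pw[symmetric] by (rule pw_inj[OF assms(1) pw_supp assms(2)])
  have "{k \<in> units_mod. pw k a = pw k0 a} = (\<lambda>j. (k0 * j) mod order G) ` {k \<in> units_mod. pw k a = a}"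
  proof (intro equalityI subsetI)
    fix k assume k: "k \<in> {k \<in> units_mod. pw k a = pw k0 a}"
    then obtain j where "j \<in> units_mod" "k = (k0 * j) mod order G"
      using bij by (auto simp: bij_betw_def)
    then show "k \<in> (\<lambda>j. (k0 * j) mod order G) ` {k \<in> units_mod. pw k a = a}"
      using k iff by blast
  next
    fix k assume "k \<in> (\<lambda>j. (k0 * j) mod order G) ` {k \<in> units_mod. pw k a = a}"
    then show "k \<in> {k \<in> units_mod. pw k a = pw k0 a}"
      using iff bij by (auto simp: bij_betw_def)
  qed
  moreover have "inj_on (\<lambda>j. (k0 * j) mod order G) {k \<in> units_mod. pw k a = a}"
    using bij by (auto simp: bij_betw_def inj_on_def)
  ultimately show ?thesis by (simp add: card_image)
qed

lemma sum_pw_reindex: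
  assumes "k \<in> units_mod"
  shows "(\<Sum>j\<in>units_mod. pw (k * j) a) = (\<Sum>j\<in>units_mod. pw j a)"
proof -
  have "(\<Sum>j\<in>units_mod. pw (k * j) a) = (\<Sum>j\<in>units_mod. pw ((k * j) mod order G) a)"
    by (simp add: pw_mod)
  also have "\<dots> = (\<Sum>j\<in>units_mod. pw j a)"
    by (rule sum.reindex_bij_betw[OF units_mod_mult_bij[OF assms]])
  finally show ?thesis .
qed

text \<open>For a subgroup \<open>M\<close> these are the central elements of the complex group
  algebra of \<open>M\<close>.\<close>

definition inv_on :: "'a set \<Rightarrow> ('a \<Rightarrow> complex) \<Rightarrow> bool" where
  "inv_on M f \<longleftrightarrow> supp_on M f \<and> (\<forall>u\<in>M. cj u f = f)"

lemma inv_on_commute: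
  assumes "subgroup M G" "inv_on M f" "supp_on M b"
  shows "cv f b = cv b f"
proof
  fix x
  show "cv f b x = cv b f x"
  proof (cases "x \<in> M")
    case False
    then show ?thesis
      using cv_supp[OF assms(1)] assms by (simp add: supp_on_def inv_on_def)
  next
    case True
    then have x: "x \<in> carrier G" using assms(1) subgroup.mem_carrier by metis
    have "cv b f x = (\<Sum>z\<in>carrier G. b z * f (inv z \<otimes> x))" using x by (simp add: cv_def)
    also have "\<dots> = (\<Sum>y\<in>carrier G. b (inv y \<otimes> x) * f (inv x \<otimes> y \<otimes> x))"
      using x by (intro sum.reindex_bij_witness[of _ "\<lambda>y. inv y \<otimes> x" "\<lambda>z. x \<otimes> inv z"])
        (auto simp: inv_mult_group m_assoc)
    also have "\<dots> = (\<Sum>y\<in>carrier G. f y * b (inv y \<otimes> x))"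
    proof (intro sum.cong refl)
      fix y assume y: "y \<in> carrier G"
      have "cj x f y = f y" using assms True by (simp add: inv_on_def)
      then show "b (inv y \<otimes> x) * f (inv x \<otimes> y \<otimes> x) = f y * b (inv y \<otimes> x)"
        using y by (simp add: cj_def)
    qed
    also have "\<dots> = cv f b x" using x by (simp add: cv_def)
    finally show ?thesis by simp
  qed
qed

text \<open>Primitivity is expressed by the centre acting on \<open>F\<close> through scalars. This
  is the form that \<open>central_cv_ee\<close> delivers, and it makes two such elements equal or
  orthogonal.\<close>

definition prim_on :: "'a set \<Rightarrow> ('a \<Rightarrow> complex) \<Rightarrow> bool" where
  "prim_on M F \<longleftrightarrow> inv_on M F \<and> cv F F = F \<and> F \<noteq> 0 \<and> (\<forall>f. inv_on M f \<longrightarrow> (\<exists>c. cv f F = smul c F))"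

text \<open>The product \<open>cv E F\<close> is a scalar multiple of \<open>F\<close>; idempotence
  of \<open>E\<close> makes the scalar 0 or 1, and it is not 0. By symmetry the product equals both
  factors.\<close>

lemma prim_on_eq:
  assumes M: "subgroup M G" and "prim_on M E" "prim_on M F" "cv E F \<noteq> 0"
  shows "E = F"
proof -
  have comm: "cv E F = cv F E" using assms inv_on_commute by (auto simp: prim_on_def inv_on_def)
  have absorb: "cv A B = B" if AB: "prim_on M A" "prim_on M B" "cv A B \<noteq> 0" for A B
  proof -
    obtain c where c: "cv A B = smul c B" using AB unfolding prim_on_def by blast
    have "cv A (cv A B) = cv A B" using AB by (simp add: prim_on_def flip: cv_assoc)
    then have "smul (c * c) B = smul c B" by (simp add: c)
    then have "c * c = c" using AB by (simp add: smul_cancel_iff prim_on_def)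
    then show ?thesis using c AB(3) by (auto simp: c)
  qed
  show ?thesis using absorb[of E F] absorb[of F E] assms comm by metis
qed

lemma inv_on_conj:
  assumes "subgroup M G" "inv_on M F" "x \<in> carrier G"
    "\<And>u. u \<in> M \<Longrightarrow> inv x \<otimes> u \<otimes> x \<in> M" "\<And>u. u \<in> M \<Longrightarrow> x \<otimes> u \<otimes> inv x \<in> M"
  shows "inv_on M (cj x F)"
  unfolding inv_on_def
proof
  show "supp_on M (cj x F)"
    unfolding supp_on_def
  proof (intro allI impI)
    fix y assume y: "y \<notin> M"
    show "cj x F y = 0"
    proof (cases "y \<in> carrier G")
      case True
      then have "inv x \<otimes> y \<otimes> x \<notin> M" using y assms(3) assms(5)[of "inv x \<otimes> y \<otimes> x"] by auto
      then show ?thesis using assms(2) by (simp add: cj_def inv_on_def supp_on_def)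
    qed (simp add: cj_def)
  qed
  show "\<forall>u\<in>M. cj u (cj x F) = cj x F"
  proof
    fix u assume u: "u \<in> M"
    then have uc: "u \<in> carrier G" using assms(1) subgroup.mem_carrier by metis
    have "u \<otimes> x = x \<otimes> (inv x \<otimes> u \<otimes> x)" using assms(3) uc by (simp add: m_assoc)
    then have "cj u (cj x F) = cj x (cj (inv x \<otimes> u \<otimes> x) F)" using assms(3) uc by simp
    then show "cj u (cj x F) = cj x F" using assms(2,4) u by (simp add: inv_on_def)
  qed
qed

text \<open>Here \<open>x\<close> only has to normalize \<open>M\<close>, not to lie in it:
  conjugation by \<open>inv x\<close> takes central elements to central elements and moves the
  question back to \<open>F\<close>.\<close>

lemma prim_on_conj:
  assumes M: "subgroup M G" and F: "prim_on M F" and x: "x \<in> carrier G"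
    and nrm: "\<And>u. u \<in> M \<Longrightarrow> inv x \<otimes> u \<otimes> x \<in> M" "\<And>u. u \<in> M \<Longrightarrow> x \<otimes> u \<otimes> inv x \<in> M"
  shows "prim_on M (cj x F)"
proof -
  have suppF: "supp_on (carrier G) F"
    using F M supp_on_mono subgroup.subset by (metis prim_on_def inv_on_def)
  have "inv_on M (cj x F)" using inv_on_conj[OF M _ x nrm] F by (simp add: prim_on_def)
  moreover have "cv (cj x F) (cj x F) = cj x F" using F x by (simp add: prim_on_def flip: cj_cv)
  moreover have "cj x F \<noteq> 0"
  proof
    assume "cj x F = 0"
    then have "cj (inv x) (cj x F) = 0" by simp
    then show False using cj_inv_cancel(1)[OF x suppF] F by (simp add: prim_on_def)
  qed
  moreover have "\<exists>c. cv f (cj x F) = smul c (cj x F)" if f: "inv_on M f" for f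
  proof -
    have suppf: "supp_on (carrier G) f"
      using f M supp_on_mono subgroup.subset by (metis inv_on_def)
    have "inv_on M (cj (inv x) f)" using inv_on_conj[OF M f, of "inv x"] x nrm by simp
    then obtain c where c: "cv (cj (inv x) f) F = smul c F" using F by (auto simp: prim_on_def)
    have "cv f (cj x F) = cj x (cv (cj (inv x) f) F)"
      using x by (simp add: cj_cv cj_one suppf)
    then show ?thesis using c by auto
  qed
  ultimately show ?thesis by (simp add: prim_on_def)
qed

end

section \<open>Idempotents induced from linear characters\<close>

context fin_group begin

definition ee :: "'a set \<Rightarrow> ('a \<Rightarrow> complex) \<Rightarrow> 'a \<Rightarrow> complex" where
  "ee H \<phi> = (\<lambda>x. if x \<in> H then \<phi> (inv x) / of_nat (card H) else 0)"

definition EE :: "'a set \<Rightarrow> 'a set \<Rightarrow> ('a \<Rightarrow> complex) \<Rightarrow> 'a \<Rightarrow> complex" where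
  "EE M H \<phi> = smul (1 / of_nat (card H)) (\<Sum>x\<in>M. cj x (ee H \<phi>))"

text \<open>Mackey's criterion for the character of \<open>M\<close> induced from \<phi> to be
  irreducible: no element outside \<open>H\<close> stabilizes \<phi> on the part of \<open>H\<close>
  that it conjugates into \<open>H\<close>.\<close>

definition shoda_on :: "'a set \<Rightarrow> 'a set \<Rightarrow> ('a \<Rightarrow> complex) \<Rightarrow> bool" where
  "shoda_on M H \<phi> \<longleftrightarrow> (\<forall>x\<in>M - H. \<exists>h\<in>H. x \<otimes> h \<otimes> inv x \<in> H \<and> \<phi> (x \<otimes> h \<otimes> inv x) \<noteq> \<phi> h)"

text \<open>Shifting the summation variable by \<open>d\<close> multiplies each value of the
  convolution by \<open>s * t\<close>, so a factor different from 1 forces it to vanish.\<close>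

lemma cv_orthogonal:
  assumes "d \<in> carrier G" "\<And>y. y \<in> carrier G \<Longrightarrow> a (y \<otimes> d) = s * a y"
    "\<And>z. z \<in> carrier G \<Longrightarrow> b (inv d \<otimes> z) = t * b z" "s * t \<noteq> 1"
  shows "cv a b = 0"
proof
  fix x
  show "cv a b x = 0 x"
  proof (cases "x \<in> carrier G")
    case True
    have "cv a b x = (\<Sum>y\<in>carrier G. a (y \<otimes> d) * b (inv (y \<otimes> d) \<otimes> x))"
      using sum_reindex_mult_right[OF assms(1), of "\<lambda>y. a y * b (inv y \<otimes> x)"] True by (simp add: cv_def)
    also have "\<dots> = (\<Sum>y\<in>carrier G. (s * t) * (a y * b (inv y \<otimes> x)))"
      using assms(1-3) True by (intro sum.cong) (auto simp: inv_mult_group m_assoc)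
    also have "\<dots> = (s * t) * cv a b x"
      using True by (simp add: cv_def sum_distrib_left)
    finally show ?thesis using assms(4) by simp
  qed (simp add: cv_def)
qed

end

locale lin_sub = fin_group +
  fixes H \<theta>
  assumes H: "subgroup H G" and lin: "lin_char G H \<theta>"
begin

lemma H_carrier: "h \<in> H \<Longrightarrow> h \<in> carrier G"
  using H subgroup.mem_carrier by metis

lemma H_closed [simp]: "h \<in> H \<Longrightarrow> k \<in> H \<Longrightarrow> h \<otimes> k \<in> H" "\<one> \<in> H" "h \<in> H \<Longrightarrow> inv h \<in> H"
  using H by (auto simp: subgroup.m_closed subgroup.one_closed subgroup.m_inv_closed)

lemma H_mult_iff: "d \<in> H \<Longrightarrow> y \<in> carrier G \<Longrightarrow> y \<otimes> d \<in> H \<longleftrightarrow> y \<in> H"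
    "d \<in> H \<Longrightarrow> y \<in> carrier G \<Longrightarrow> d \<otimes> y \<in> H \<longleftrightarrow> y \<in> H"
proof -
  assume d: "d \<in> H" "y \<in> carrier G"
  have "y = (y \<otimes> d) \<otimes> inv d" "y = inv d \<otimes> (d \<otimes> y)" using d H_carrier by (simp_all add: m_assoc)
  then show "y \<otimes> d \<in> H \<longleftrightarrow> y \<in> H" "d \<otimes> y \<in> H \<longleftrightarrow> y \<in> H"
    using d H_closed by metis+
qed

lemma H_inv_iff: "y \<in> carrier G \<Longrightarrow> inv y \<in> H \<longleftrightarrow> y \<in> H"
  using H_closed(3) inv_inv by metis

lemma finite_H: "finite H" and card_H: "card H > 0" "card H \<noteq> 0"
  using subgroup_finite[OF H] subgroup_card_pos[OF H] by auto

lemma theta_mult: "h \<in> H \<Longrightarrow> k \<in> H \<Longrightarrow> \<theta> (h \<otimes> k) = \<theta> h * \<theta> k"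
  using lin by (simp add: lin_char_def)

lemma theta_nz: "h \<in> H \<Longrightarrow> \<theta> h \<noteq> 0"
  using lin by (simp add: lin_char_def)

lemma theta_out: "h \<notin> H \<Longrightarrow> \<theta> h = 0"
  using lin by (simp add: lin_char_def)

lemma theta_one [simp]: "\<theta> \<one> = 1"
  using theta_mult[of \<one> \<one>] theta_nz[of \<one>] by simp

lemma theta_inv: "h \<in> H \<Longrightarrow> \<theta> (inv h) = inverse (\<theta> h)"
  using theta_mult[of h "inv h"] theta_nz[of h] H_carrier by (simp add: field_simps)

lemma pow_closed: "h \<in> H \<Longrightarrow> h [^] (k::nat) \<in> H"
  by (induction k) auto

lemma theta_pow: "h \<in> H \<Longrightarrow> \<theta> (h [^] (k::nat)) = \<theta> h ^ k"
  by (induction k) (auto simp: theta_mult pow_closed)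

lemma theta_root: "h \<in> H \<Longrightarrow> \<theta> h ^ order G = 1"
  using theta_pow[of h "order G"] H_carrier by (simp add: pow_order_eq_1)

lemma ee_alt: "x \<in> carrier G \<Longrightarrow> ee H \<theta> x = \<theta> (inv x) / of_nat (card H)"
  using theta_out H_inv_iff by (auto simp: ee_def)

lemma ee_supp: "supp_on H (ee H \<theta>)"
  by (simp add: supp_on_def ee_def)

lemma ee_supp_carrier: "supp_on (carrier G) (ee H \<theta>)"
  using ee_supp supp_on_mono H subgroup.subset by metis

lemma ee_mult_right: "d \<in> H \<Longrightarrow> y \<in> carrier G \<Longrightarrow> ee H \<theta> (y \<otimes> d) = inverse (\<theta> d) * ee H \<theta> y"
  using H_carrier H_mult_iff by (auto simp: ee_def inv_mult_group theta_mult theta_inv)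

lemma ee_mult_left: "d \<in> H \<Longrightarrow> y \<in> carrier G \<Longrightarrow> ee H \<theta> (d \<otimes> y) = inverse (\<theta> d) * ee H \<theta> y"
  using H_carrier H_mult_iff by (auto simp: ee_def inv_mult_group theta_mult theta_inv)

lemma ee_conj: "d \<in> H \<Longrightarrow> cj d (ee H \<theta>) = ee H \<theta>"
proof
  fix x assume d: "d \<in> H"
  have dc: "d \<in> carrier G" using d H_carrier by simp
  show "cj d (ee H \<theta>) x = ee H \<theta> x"
  proof (cases "x \<in> carrier G")
    case True
    then show ?thesis
      using d dc theta_nz[OF d] by (simp add: cj_def m_assoc ee_mult_left ee_mult_right theta_inv)
  qed (use ee_supp_carrier in \<open>auto simp: cj_def supp_on_def\<close>)
qed

lemma ee_idem: "cv (ee H \<theta>) (ee H \<theta>) = ee H \<theta>"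
proof
  fix x
  show "cv (ee H \<theta>) (ee H \<theta>) x = ee H \<theta> x"
  proof (cases "x \<in> carrier G")
    case True
    have "cv (ee H \<theta>) (ee H \<theta>) x = (\<Sum>y\<in>carrier G. ee H \<theta> y * ee H \<theta> (inv y \<otimes> x))"
      using True by (simp add: cv_def)
    also have "\<dots> = (\<Sum>y\<in>H. ee H \<theta> y * ee H \<theta> (inv y \<otimes> x))"
      using H subgroup.subset fin by (intro sum.mono_neutral_right) (auto simp: ee_def)
    also have "\<dots> = (\<Sum>y\<in>H. ee H \<theta> x / of_nat (card H))"
    proof (rule sum.cong[OF refl])
      fix y assume y: "y \<in> H"
      have "ee H \<theta> (inv y \<otimes> x) = \<theta> y * ee H \<theta> x"
        using True y by (simp add: ee_mult_left theta_inv)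
      then show "ee H \<theta> y * ee H \<theta> (inv y \<otimes> x) = ee H \<theta> x / of_nat (card H)"
        using y theta_nz[OF y] by (simp add: ee_def[of H \<theta>, THEN fun_cong, of y] theta_inv)
    qed
    also have "\<dots> = ee H \<theta> x" using card_H by simp
    finally show ?thesis .
  qed (simp add: cv_def ee_def H_carrier, use H_carrier in blast)
qed

lemma ee_one: "ee H \<theta> \<one> = 1 / of_nat (card H)"
  by (simp add: ee_def)

lemma ee_nz: "ee H \<theta> \<noteq> 0"
  using ee_one card_H by (metis divide_eq_0_iff of_nat_eq_0_iff zero_fun_apply zero_neq_one)

lemma pw_theta: "x \<in> H \<Longrightarrow> pw k \<theta> x = \<theta> x ^ k"
  using theta_pow H_carrier by (simp add: pw_def)

lemma pow_units_in_H:
  assumes "k \<in> units_mod" "x \<in> carrier G"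
  shows "x [^] k \<in> H \<longleftrightarrow> x \<in> H"
proof
  assume x: "x [^] k \<in> H"
  obtain l where l: "l \<in> units_mod" "(k * l) mod order G = 1 mod order G"
    using units_mod_inverse[OF assms(1)] .
  have "x = x [^] (k * l)"
    using l(2) assms(2) pow_mod_order[of x "k * l"] pow_mod_order[of x 1] by simp
  also have "\<dots> = (x [^] k) [^] l" using assms(2) by (simp add: nat_pow_pow)
  finally have eq: "x = (x [^] k) [^] l" .
  show "x \<in> H" using pow_closed[OF x, of l] unfolding eq[symmetric] .
qed (rule pow_closed)

lemma pw_lin_sub:
  assumes k: "k \<in> units_mod"
  shows "lin_sub G H (pw k \<theta>)"
proof (intro lin_sub.intro lin_sub_axioms.intro fin_group_axioms H)
  have "pw k \<theta> x = 0" if "x \<notin> H" for x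
    using pow_units_in_H[OF k] that theta_out by (simp add: pw_def)
  then show "lin_char G H (pw k \<theta>)"
    using theta_pow H_carrier theta_mult theta_nz by (simp add: lin_char_def pw_def power_mult_distrib)
qed

lemma pw_ee:
  assumes k: "k \<in> units_mod"
  shows "pw k (ee H \<theta>) = ee H (pw k \<theta>)"
proof
  fix x
  show "pw k (ee H \<theta>) x = ee H (pw k \<theta>) x"
    using pow_units_in_H[OF k, of x] H_carrier by (auto simp: pw_def ee_def nat_pow_inv)
qed

lemma theta_pow_inj:
  assumes "k \<in> units_mod" "h \<in> H" "h' \<in> H" "\<theta> h ^ k = \<theta> h' ^ k"
  shows "\<theta> h = \<theta> h'"
proof -
  obtain l where l: "l \<in> units_mod" "(k * l) mod order G = 1 mod order G"
    using units_mod_inverse[OF assms(1)] .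
  have "(\<theta> h ^ k) ^ l = \<theta> h" if "h \<in> H" for h
  proof -
    have "h [^] (k * l) = h"
      using l(2) pow_mod_order[of h "k * l"] pow_mod_order[of h 1] H_carrier[OF that] by simp
    then show ?thesis using theta_pow[OF that, of "k * l"] by (simp add: power_mult)
  qed
  then show ?thesis using assms by metis
qed

text \<open>Raising to a unit power is injective on the values of \<theta>, so an element that
  separates two of them still does so.\<close>

lemma shoda_pw:
  assumes k: "k \<in> units_mod" and "shoda_on M H \<theta>"
  shows "shoda_on M H (pw k \<theta>)"
  unfolding shoda_on_def
proof
  fix x assume x: "x \<in> M - H"
  then obtain h where h: "h \<in> H" "x \<otimes> h \<otimes> inv x \<in> H" "\<theta> (x \<otimes> h \<otimes> inv x) \<noteq> \<theta> h"
    using assms(2) by (auto simp: shoda_on_def)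
  then have "pw k \<theta> (x \<otimes> h \<otimes> inv x) \<noteq> pw k \<theta> h"
    using theta_pow_inj[OF k h(2) h(1)] by (auto simp: pw_theta)
  then show "\<exists>h\<in>H. x \<otimes> h \<otimes> inv x \<in> H \<and> pw k \<theta> (x \<otimes> h \<otimes> inv x) \<noteq> pw k \<theta> h"
    using h by blast
qed

lemma pw_EE:
  assumes "k \<in> units_mod" "M \<subseteq> carrier G"
  shows "pw k (EE M H \<theta>) = EE M H (pw k \<theta>)"
  unfolding EE_def pw_smul pw_sum
  using assms by (intro arg_cong[of _ _ "smul _"] sum.cong) (auto simp: pw_cj pw_ee)

text \<open>The element \<open>d\<close> lies in both conjugated subgroups, so translation by
  \<open>d\<close> multiplies each idempotent by a scalar, and these scalars do not cancel. Read
  backwards, as \<open>ee_agree\<close>, this extracts an equality of characters from a nonvanishing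
  product.\<close>

lemma ee_orthogonal:
  assumes L': "lin_sub G H' \<phi>" and "g \<in> carrier G" "h \<in> carrier G" "d \<in> carrier G"
    "inv g \<otimes> d \<otimes> g \<in> H" "inv h \<otimes> d \<otimes> h \<in> H'" "\<theta> (inv g \<otimes> d \<otimes> g) \<noteq> \<phi> (inv h \<otimes> d \<otimes> h)"
  shows "cv (cj g (ee H \<theta>)) (cj h (ee H' \<phi>)) = 0"
proof -
  interpret L': lin_sub G H' \<phi> by fact
  let ?a = "inv g \<otimes> d \<otimes> g" and ?b = "inv h \<otimes> d \<otimes> h"
  show ?thesis
  proof (rule cv_orthogonal)
    show "d \<in> carrier G" by fact
    show "cj g (ee H \<theta>) (y \<otimes> d) = inverse (\<theta> ?a) * cj g (ee H \<theta>) y" if "y \<in> carrier G" for y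
      using that assms ee_mult_right[of ?a "inv g \<otimes> y \<otimes> g"] by (simp add: cj_def conj_mult)
    show "cj h (ee H' \<phi>) (inv d \<otimes> z) = \<phi> ?b * cj h (ee H' \<phi>) z" if "z \<in> carrier G" for z
      using that assms L'.ee_mult_left[of "inv ?b" "inv h \<otimes> z \<otimes> h"] L'.theta_inv[of ?b] L'.H_closed(3)[of ?b]
      by (simp add: cj_def conj_mult conj_inv)
    show "inverse (\<theta> ?a) * \<phi> ?b \<noteq> 1" using assms theta_nz by (simp add: field_simps)
  qed
qed

lemma ee_agree:
  assumes "lin_sub G H' \<phi>" "cv (cj g (ee H \<theta>)) (cj h (ee H' \<phi>)) \<noteq> 0" "g \<in> carrier G" "h \<in> carrier G"
     "d \<in> carrier G" "inv g \<otimes> d \<otimes> g \<in> H" "inv h \<otimes> d \<otimes> h \<in> H'"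
  shows "\<theta> (inv g \<otimes> d \<otimes> g) = \<phi> (inv h \<otimes> d \<otimes> h)"
  using assms ee_orthogonal by blast

end

locale shoda = lin_sub +
  fixes M
  assumes M: "subgroup M G" and HM: "H \<subseteq> M" and shoda: "shoda_on M H \<theta>"
begin

lemma M_carrier: "x \<in> M \<Longrightarrow> x \<in> carrier G"
  using M subgroup.mem_carrier by metis

lemma M_closed [simp]: "h \<in> M \<Longrightarrow> k \<in> M \<Longrightarrow> h \<otimes> k \<in> M" "\<one> \<in> M" "h \<in> M \<Longrightarrow> inv h \<in> M"
  using M by (auto simp: subgroup.m_closed subgroup.one_closed subgroup.m_inv_closed)

lemma conj_closed: "x \<in> M \<Longrightarrow> h \<in> M \<Longrightarrow> x \<otimes> h \<otimes> inv x \<in> M" "x \<in> M \<Longrightarrow> h \<in> M \<Longrightarrow> inv x \<otimes> h \<otimes> x \<in> M"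
  by auto

lemma ee_supp_M: "supp_on M (ee H \<theta>)"
  using ee_supp HM supp_on_mono by blast

lemma EE_supp: "supp_on M (EE M H \<theta>)"
proof -
  have "supp_on M (cj x (ee H \<theta>))" if x: "x \<in> M" for x
    unfolding supp_on_def
  proof (intro allI impI)
    fix y assume y: "y \<notin> M"
    show "cj x (ee H \<theta>) y = 0"
    proof (cases "y \<in> carrier G")
      case True
      then have "inv x \<otimes> y \<otimes> x \<notin> M"
        using y x conj_closed(1)[OF x] M_carrier by (metis conj_cancel(2))
      then show ?thesis using ee_supp_M by (simp add: cj_def supp_on_def)
    qed (simp add: cj_def)
  qed
  then show ?thesis unfolding EE_def by (intro supp_on_smul supp_on_sum)
qed

lemma EE_conj: "u \<in> M \<Longrightarrow> cj u (EE M H \<theta>) = EE M H \<theta>"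
proof -
  assume u: "u \<in> M"
  have "(\<Sum>x\<in>M. cj u (cj x (ee H \<theta>))) = (\<Sum>x\<in>M. cj (u \<otimes> x) (ee H \<theta>))"
    using u M_carrier by (intro sum.cong) auto
  also have "\<dots> = (\<Sum>x\<in>M. cj x (ee H \<theta>))"
    by (rule sum_reindex_subgroup_mult_left[OF M u])
  finally show ?thesis by (simp add: EE_def cj_sum)
qed

lemma EE_inv_on: "inv_on M (EE M H \<theta>)"
  using EE_supp EE_conj by (simp add: inv_on_def)

lemma cj_ee_orth: "x \<in> M - H \<Longrightarrow> cv (cj x (ee H \<theta>)) (ee H \<theta>) = 0"
proof -
  assume x: "x \<in> M - H"
  then obtain h where h: "h \<in> H" "x \<otimes> h \<otimes> inv x \<in> H" "\<theta> (x \<otimes> h \<otimes> inv x) \<noteq> \<theta> h"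
    using shoda by (auto simp: shoda_on_def)
  have "cv (cj x (ee H \<theta>)) (cj \<one> (ee H \<theta>)) = 0"
    using x h H_carrier M_carrier
    by (intro ee_orthogonal[OF lin_sub_axioms, of _ _ "x \<otimes> h \<otimes> inv x"]) auto
  then show ?thesis by (simp add: cj_one ee_supp_carrier)
qed

text \<open>Only the summands with \<open>x\<close> in \<open>H\<close> survive, and each of them is
  \<open>ee H \<theta>\<close>; this is the reason for the factor 1/|H| in
  \<open>EE\<close>.\<close>

lemma EE_ee: "cv (EE M H \<theta>) (ee H \<theta>) = ee H \<theta>"
proof -
  have "(\<Sum>x\<in>M. cv (cj x (ee H \<theta>)) (ee H \<theta>)) = (\<Sum>x\<in>H. cv (cj x (ee H \<theta>)) (ee H \<theta>))"
    using HM cj_ee_orth subgroup_finite[OF M] by (intro sum.mono_neutral_right) auto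
  also have "\<dots> = (\<Sum>x\<in>H. ee H \<theta>)"
    by (intro sum.cong) (auto simp: ee_conj ee_idem)
  finally show ?thesis
    using card_H by (simp add: EE_def cv_sum_left sum_const_fun del: sum_constant)
qed

lemma ee_EE: "cv (ee H \<theta>) (EE M H \<theta>) = ee H \<theta>"
  using EE_ee inv_on_commute[OF M EE_inv_on ee_supp_M] by simp

lemma EE_nz: "EE M H \<theta> \<noteq> 0"
  using EE_ee ee_nz by auto

lemma cv_EE_of_ee:
  assumes "inv_on M f" "cv f (ee H \<theta>) = smul c (ee H \<theta>)"
  shows "cv f (EE M H \<theta>) = smul c (EE M H \<theta>)"
proof -
  have "cv f (cj x (ee H \<theta>)) = smul c (cj x (ee H \<theta>))" if x: "x \<in> M" for x
  proof -
    have "cv f (cj x (ee H \<theta>)) = cj x (cv f (ee H \<theta>))"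
      using assms(1) x M_carrier by (simp add: cj_cv inv_on_def)
    then show ?thesis using assms(2) by simp
  qed
  then show ?thesis by (simp add: EE_def cv_sum_right smul_sum mult.commute)
qed

text \<open>The product is scaled by the same character under left and right translation by
  \<open>H\<close>, so on \<open>H\<close> it is determined by its value at the identity; outside
  \<open>H\<close> it vanishes by Shoda's condition. The explicit scalar matters later, as a
  rational combination of roots of unity when \<open>f\<close> is rational.\<close>

lemma central_cv_ee:
  assumes f: "inv_on M f"
  shows "cv f (ee H \<theta>) = smul (\<Sum>h\<in>H. f h * \<theta> h) (ee H \<theta>)"
proof -
  define b where "b = cv f (ee H \<theta>)"
  have b2: "b = cv (ee H \<theta>) f"
    unfolding b_def by (rule inv_on_commute[OF M f ee_supp_M])
  have right: "b (y \<otimes> d) = inverse (\<theta> d) * b y" if "d \<in> H" "y \<in> carrier G" for d y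
  proof -
    have "b (y \<otimes> d) = (\<Sum>z\<in>carrier G. f z * ee H \<theta> ((inv z \<otimes> y) \<otimes> d))"
      using that H_carrier by (simp add: b_def cv_def m_assoc)
    also have "\<dots> = (\<Sum>z\<in>carrier G. f z * (inverse (\<theta> d) * ee H \<theta> (inv z \<otimes> y)))"
      using that by (intro sum.cong refl) (simp add: ee_mult_right)
    finally show ?thesis using that by (simp add: b_def cv_def sum_distrib_left mult_ac)
  qed
  have left: "b (d \<otimes> y) = inverse (\<theta> d) * b y" if "d \<in> H" "y \<in> carrier G" for d y
  proof -
    have "b (d \<otimes> y) = (\<Sum>z\<in>carrier G. ee H \<theta> z * f (inv z \<otimes> (d \<otimes> y)))"
      using that H_carrier by (simp add: b2 cv_def)
    also have "\<dots> = (\<Sum>z\<in>carrier G. ee H \<theta> (d \<otimes> z) * f (inv (d \<otimes> z) \<otimes> (d \<otimes> y)))"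
      using that H_carrier by (intro sum_reindex_mult_left[symmetric]) auto
    also have "\<dots> = (\<Sum>z\<in>carrier G. inverse (\<theta> d) * (ee H \<theta> z * f (inv z \<otimes> y)))"
      using that H_carrier by (intro sum.cong refl) (simp add: ee_mult_left inv_mult_group m_assoc)
    finally show ?thesis using that by (simp add: b2 cv_def sum_distrib_left)
  qed
  have bsupp: "supp_on M b" unfolding b_def using cv_supp[OF M _ ee_supp_M] f by (simp add: inv_on_def)
  have "b y = b \<one> * of_nat (card H) * ee H \<theta> y" for y
  proof (cases "y \<in> H")
    case True
    then have "b y = inverse (\<theta> y) * b \<one>" using right[of y \<one>] H_carrier by simp
    then show ?thesis using True card_H by (simp add: ee_def theta_inv)
  next
    case False
    show ?thesis
    proof (cases "y \<in> M")
      case True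
      then obtain h where h: "h \<in> H" "y \<otimes> h \<otimes> inv y \<in> H" "\<theta> (y \<otimes> h \<otimes> inv y) \<noteq> \<theta> h"
        using shoda False by (auto simp: shoda_on_def)
      have yc: "y \<in> carrier G" using True M_carrier by simp
      \<comment> \<open>Two ways of evaluating at the same element: \<open>h\<close> pulled out on
        the right, its conjugate on the left. The scalars differ, so the value is 0.\<close>
      have "y \<otimes> h = (y \<otimes> h \<otimes> inv y) \<otimes> y" using yc H_carrier h(1) by (simp add: m_assoc)
      then have "inverse (\<theta> h) * b y = inverse (\<theta> (y \<otimes> h \<otimes> inv y)) * b y"
        using right[OF h(1) yc] left[OF h(2) yc] by simp
      then have "b y = 0" using h by simp
      then show ?thesis using False by (simp add: ee_def)
    qed (use bsupp False in \<open>simp add: supp_on_def ee_def\<close>)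
  qed
  then have "b = smul (b \<one> * of_nat (card H)) (ee H \<theta>)" unfolding fun_eq_iff smul_apply by blast
  moreover have "b \<one> * of_nat (card H) = (\<Sum>h\<in>H. f h * \<theta> h)"
  proof -
    have "b \<one> = (\<Sum>z\<in>carrier G. f z * ee H \<theta> (inv z))" by (simp add: b_def cv_def)
    also have "\<dots> = (\<Sum>z\<in>H. f z * ee H \<theta> (inv z))"
      using fin H_carrier H_inv_iff by (intro sum.mono_neutral_right) (auto simp: ee_def)
    also have "\<dots> = (\<Sum>z\<in>H. f z * \<theta> z / of_nat (card H))"
      using H_carrier by (intro sum.cong) (auto simp: ee_def)
    finally show ?thesis using card_H by (simp add: sum_divide_distrib[symmetric])
  qed
  ultimately show ?thesis by (simp add: b_def)
qed

lemma EE_idem: "cv (EE M H \<theta>) (EE M H \<theta>) = EE M H \<theta>"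
  using cv_EE_of_ee[OF EE_inv_on, of 1] EE_ee by simp

lemma EE_prim: "prim_on M (EE M H \<theta>)"
  using EE_inv_on EE_idem EE_nz central_cv_ee cv_EE_of_ee unfolding prim_on_def by blast

end

section \<open>Inertia groups and Galois conjugates\<close>

lemma sum_neq_0_obtain:
  assumes "(\<Sum>i\<in>I. f i) \<noteq> (0 :: 'c \<Rightarrow> complex)"
  obtains i where "i \<in> I" "f i \<noteq> 0"
  using assms sum.neutral by metis

section \<open>Sums over the Galois conjugates and their stabilizers\<close>

context fin_group begin

definition tsum :: "('a \<Rightarrow> complex) \<Rightarrow> 'a \<Rightarrow> complex" where
  "tsum a = (\<Sum>j\<in>units_mod. pw j a)"

definition stab :: "('a \<Rightarrow> complex) \<Rightarrow> nat set" where
  "stab a = {k \<in> units_mod. pw k a = a}"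

lemma stab_finite: "finite (stab a)"
  using units_mod_finite by (simp add: stab_def)

lemma card_stab_pos: "supp_on (carrier G) a \<Longrightarrow> card (stab a) > 0"
proof -
  assume "supp_on (carrier G) a"
  then have "1 mod order G \<in> stab a"
    using units_mod_one pw_1 pw_mod[of 1 a] by (simp add: stab_def)
  then show ?thesis using stab_finite card_gt_0_iff by blast
qed

lemma tsum_supp: "supp_on (carrier G) (tsum a)"
  unfolding tsum_def by (intro supp_on_sum pw_supp)

lemma tsum_cj: "g \<in> carrier G \<Longrightarrow> tsum (cj g a) = cj g (tsum a)"
  unfolding tsum_def cj_sum by (intro sum.cong refl pw_cj)

lemma cj_tsum:
  assumes "x \<in> carrier G" "k \<in> units_mod" "cj x a = pw k a"
  shows "cj x (tsum a) = tsum a"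
proof -
  have "cj x (tsum a) = tsum (pw k a)" using assms by (simp flip: tsum_cj)
  also have "\<dots> = tsum a" using sum_pw_reindex[OF assms(2)] by (simp add: tsum_def pw_pw mult.commute)
  finally show ?thesis .
qed

text \<open>Conjugating \<open>cv a (tsum a)\<close> by \<open>x\<close> gives the product of
  \<open>cj x a\<close> with the unchanged sum, which is therefore nonzero, so one of its terms
  is.\<close>

lemma fixed_tsum_obtain:
  assumes x: "x \<in> carrier G" "cj x (tsum a) = tsum a" and nz: "cv a (tsum a) \<noteq> 0"
  obtains j where "j \<in> units_mod" "cv (cj x a) (pw j a) \<noteq> 0"
proof -
  have "cj x (cv a (tsum a)) \<noteq> 0"
  proof
    assume 0: "cj x (cv a (tsum a)) = 0"
    have "supp_on (carrier G) (cv a (tsum a))" by (simp add: supp_on_def cv_def)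
    then have "cv a (tsum a) = 0" using 0 cj_inv_cancel(1)[OF x(1)] cj_0 by metis
    then show False using nz by simp
  qed
  then have "(\<Sum>j\<in>units_mod. cv (cj x a) (pw j a)) \<noteq> 0"
    using x by (simp add: cj_cv) (simp add: tsum_def cv_sum_right)
  then show ?thesis by (rule sum_neq_0_obtain) (rule that)
qed

lemma cv_sums_neq_0_obtain:
  assumes "cv (\<Sum>i\<in>I. f i) (\<Sum>j\<in>J. g j) \<noteq> 0"
  obtains i j where "i \<in> I" "j \<in> J" "cv (f i) (g j) \<noteq> 0"
proof -
  obtain i where i: "i \<in> I" "cv (f i) (\<Sum>j\<in>J. g j) \<noteq> 0"
    using assms unfolding cv_sum_left by (rule sum_neq_0_obtain)
  obtain j where "j \<in> J" "cv (f i) (g j) \<noteq> 0"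
    using i(2) unfolding cv_sum_right by (rule sum_neq_0_obtain)
  then show ?thesis using that i(1) by blast
qed

end

context lin_sub begin

lemma shoda_self: "shoda G H \<theta> H"
  by (intro shoda.intro shoda_axioms.intro lin_sub_axioms H) (auto simp: shoda_on_def)

lemma EE_self: "EE H H \<theta> = ee H \<theta>"
  using card_H by (simp add: EE_def ee_conj sum_const_fun del: sum_constant cong: sum.cong)

end

context shoda begin

lemma EE_supp_carrier: "supp_on (carrier G) (EE M H \<theta>)"
  using EE_supp M supp_on_mono subgroup.subset by metis

lemma shoda_pw_sub: "k \<in> units_mod \<Longrightarrow> shoda G H (pw k \<theta>) M"
  using shoda_pw[OF _ shoda] HM
  by (intro shoda.intro shoda_axioms.intro pw_lin_sub M) auto

lemma pw_EE_M: "k \<in> units_mod \<Longrightarrow> pw k (EE M H \<theta>) = EE M H (pw k \<theta>)"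
  using pw_EE M subgroup.subset by metis

lemma pw_EE_prim: "k \<in> units_mod \<Longrightarrow> prim_on M (pw k (EE M H \<theta>))"
  using shoda.EE_prim[OF shoda_pw_sub] pw_EE_M by metis

lemma EE_cv_pw:
  assumes "k \<in> units_mod"
  shows "cv (EE M H \<theta>) (pw k (EE M H \<theta>)) = (if pw k (EE M H \<theta>) = EE M H \<theta> then EE M H \<theta> else 0)"
  using prim_on_eq[OF M] pw_EE_prim EE_prim EE_idem assms by metis

text \<open>The Galois conjugates of \<open>EE M H \<theta>\<close> are primitive too, hence each is
  equal or orthogonal to it; the equal ones are counted by \<open>stab\<close>.\<close>

lemma EE_cv_tsum: "cv (EE M H \<theta>) (tsum (EE M H \<theta>)) = smul (of_nat (card (stab (EE M H \<theta>)))) (EE M H \<theta>)"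
proof -
  have "cv (EE M H \<theta>) (tsum (EE M H \<theta>)) =
      (\<Sum>k\<in>units_mod. if pw k (EE M H \<theta>) = EE M H \<theta> then EE M H \<theta> else 0)"
    unfolding tsum_def cv_sum_right by (intro sum.cong refl) (rule EE_cv_pw)
  also have "\<dots> = (\<Sum>k\<in>stab (EE M H \<theta>). EE M H \<theta>)"
    unfolding stab_def using units_mod_finite by (simp add: sum.If_cases Int_def)
  finally show ?thesis by (simp add: sum_const_fun del: sum_constant)
qed

lemma EE_cv_tsum_nz: "cv (EE M H \<theta>) (tsum (EE M H \<theta>)) \<noteq> 0"
  using card_stab_pos[OF EE_supp_carrier] EE_nz by (simp add: EE_cv_tsum smul_eq_0_iff)

end

text \<open>One edge of the path: \<open>M\<close>, \<open>M'\<close> and \<open>A\<close> stand for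
  \<open>H_{i-1}\<close>, \<open>H_i\<close> and \<open>A_i\<close>, and \<theta> is the leaf
  character, whose restriction to \<open>A\<close> has inertia group \<open>M'\<close> in
  \<open>M\<close>.\<close>

locale clifford_step = shoda +
  fixes M' A
  assumes M': "subgroup M' G" and HM': "H \<subseteq> M'" and AH: "A \<subseteq> H"
    and A_conj: "\<And>x a. x \<in> M \<Longrightarrow> a \<in> A \<Longrightarrow> x \<otimes> a \<otimes> inv x \<in> A"
    and M'_eq: "M' = {x \<in> M. \<forall>a\<in>A. \<theta> (x \<otimes> a \<otimes> inv x) = \<theta> a}"
begin

lemma M'M: "M' \<subseteq> M"
  using M'_eq by auto

sublocale small: shoda G H \<theta> M'
  using shoda M'M by (intro shoda.intro shoda_axioms.intro lin_sub_axioms M' HM') (auto simp: shoda_on_def)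

abbreviation E' where "E' \<equiv> EE M' H \<theta>"
abbreviation E where "E \<equiv> EE M H \<theta>"
abbreviation e where "e \<equiv> ee H \<theta>"

lemma A_carrier: "a \<in> A \<Longrightarrow> a \<in> carrier G"
  using AH H_carrier by blast

lemma A_conj': "x \<in> M \<Longrightarrow> a \<in> A \<Longrightarrow> inv x \<otimes> a \<otimes> x \<in> A"
  using A_conj[of "inv x" a] M_carrier by simp

lemma M'_inertia: "u \<in> M' \<Longrightarrow> a \<in> A \<Longrightarrow> \<theta> (u \<otimes> a \<otimes> inv u) = \<theta> a"
    "u \<in> M' \<Longrightarrow> a \<in> A \<Longrightarrow> \<theta> (inv u \<otimes> a \<otimes> u) = \<theta> a"
proof -
  show *: "\<theta> (u \<otimes> a \<otimes> inv u) = \<theta> a" if "u \<in> M'" "a \<in> A" for u a using that M'_eq by blast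
  show "u \<in> M' \<Longrightarrow> a \<in> A \<Longrightarrow> \<theta> (inv u \<otimes> a \<otimes> u) = \<theta> a"
    using *[of "inv u" a] small.M_carrier by simp
qed

text \<open>A nonzero product contains a nonzero product of two conjugates of \<open>e\<close> and
  \<open>pw j e\<close>, whose characters must agree on common elements. As \<open>M\<close>
  normalizes \<open>A\<close>, all arguments stay in \<open>A\<close>, where conjugation by the
  elements \<open>y\<close> and \<open>z\<close> of \<open>M'\<close> does not change
  \<theta>.\<close>

lemma conj_agree:
  assumes x: "x \<in> M" and j: "j \<in> units_mod" and nz: "cv (cj x E') (pw j E') \<noteq> 0" and a: "a \<in> A"
  shows "\<theta> (inv x \<otimes> a \<otimes> x) = \<theta> a ^ j"
proof -
  have xc: "x \<in> carrier G" using x M_carrier by simp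
  have "cv (cj x (\<Sum>y\<in>M'. cj y e)) (\<Sum>z\<in>M'. cj z (ee H (pw j \<theta>))) \<noteq> 0"
    using nz unfolding small.pw_EE_M[OF j] unfolding EE_def[of M'] by auto
  then obtain y z where y: "y \<in> M'" and z: "z \<in> M'" "cv (cj x (cj y e)) (cj z (ee H (pw j \<theta>))) \<noteq> 0"
    unfolding cj_sum by (rule cv_sums_neq_0_obtain)
  have yz: "y \<in> M" "z \<in> M" "y \<in> carrier G" "z \<in> carrier G"
    using y z M'M M_carrier by auto
  have xy: "inv (x \<otimes> y) \<otimes> a \<otimes> (x \<otimes> y) = inv y \<otimes> (inv x \<otimes> a \<otimes> x) \<otimes> y"
    using xc yz a A_carrier by (intro conj_comp) auto
  have "\<theta> (inv (x \<otimes> y) \<otimes> a \<otimes> (x \<otimes> y)) = pw j \<theta> (inv z \<otimes> a \<otimes> z)"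
  proof (rule ee_agree[OF pw_lin_sub[OF j]])
    show "cv (cj (x \<otimes> y) e) (cj z (ee H (pw j \<theta>))) \<noteq> 0" using z(2) xc yz by simp
    show "inv (x \<otimes> y) \<otimes> a \<otimes> (x \<otimes> y) \<in> H" using A_conj'[of "x \<otimes> y" a] x yz a AH by auto
    show "inv z \<otimes> a \<otimes> z \<in> H" using A_conj'[of z a] yz a AH by auto
  qed (use xc yz a A_carrier in auto)
  also have "\<dots> = \<theta> a ^ j"
    using M'_inertia(2)[OF z(1) a] A_conj'[OF yz(2) a] AH pw_theta by auto
  finally show ?thesis
    unfolding xy using M'_inertia(2)[OF y A_conj'[OF x a]] by simp
qed

text \<open>On \<open>A\<close>, conjugation by \<open>x\<close> turns \<theta> into its power, and
  an element fixing \<theta> fixes all its powers; so conjugation by \<open>x\<close> preserves the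
  inertia group.\<close>

lemma normalizes_M':
  assumes x: "x \<in> M" and ag: "\<And>a. a \<in> A \<Longrightarrow> \<theta> (inv x \<otimes> a \<otimes> x) = \<theta> a ^ j"
    and u: "u \<in> M'"
  shows "inv x \<otimes> u \<otimes> x \<in> M'" "x \<otimes> u \<otimes> inv x \<in> M'"
proof -
  have xc: "x \<in> carrier G" using x M_carrier by simp
  have *: "inv x \<otimes> u \<otimes> x \<in> M'" if u: "u \<in> M'" for u
  proof -
    have uc: "u \<in> carrier G" and uM: "u \<in> M" using u M'M M_carrier by auto
    have "\<theta> ((inv x \<otimes> u \<otimes> x) \<otimes> a \<otimes> inv (inv x \<otimes> u \<otimes> x)) = \<theta> a" if a: "a \<in> A" for a
    proof -
      define b where "b = x \<otimes> a \<otimes> inv x"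
      have b: "b \<in> A" using A_conj x a b_def by simp
      have ab: "a = inv x \<otimes> b \<otimes> x" using xc a A_carrier by (simp add: b_def)
      have "(inv x \<otimes> u \<otimes> x) \<otimes> a \<otimes> inv (inv x \<otimes> u \<otimes> x) = inv x \<otimes> (u \<otimes> b \<otimes> inv u) \<otimes> x"
        using xc uc b A_carrier unfolding ab by (simp add: inv_mult_group m_assoc)
      then have "\<theta> ((inv x \<otimes> u \<otimes> x) \<otimes> a \<otimes> inv (inv x \<otimes> u \<otimes> x)) = \<theta> (u \<otimes> b \<otimes> inv u) ^ j"
        using ag[OF A_conj[OF uM b]] by simp
      also have "\<dots> = \<theta> a" using M'_inertia(1)[OF u b] ag[OF b] by (simp add: ab)
      finally show ?thesis .
    qed
    then show ?thesis using x uM by (subst M'_eq) auto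
  qed
  show "inv x \<otimes> u \<otimes> x \<in> M'" by (rule *[OF u])
  \<comment> \<open>Injectivity on the finite set \<open>M'\<close> makes the conjugation
    surjective, which yields conjugation in the other direction.\<close>
  have "(\<lambda>v. inv x \<otimes> v \<otimes> x) ` M' = M'"
  proof (rule endo_inj_surj[OF subgroup_finite[OF M']])
    show "(\<lambda>v. inv x \<otimes> v \<otimes> x) ` M' \<subseteq> M'" using * by blast
    show "inj_on (\<lambda>v. inv x \<otimes> v \<otimes> x) M'" using xc small.M_carrier by (intro inj_onI) simp
  qed
  then obtain v where "v \<in> M'" "u = inv x \<otimes> v \<otimes> x" using u by blast
  then show "x \<otimes> u \<otimes> inv x \<in> M'" using xc small.M_carrier by simp
qed

lemma conj_eq_pw:
  assumes x: "x \<in> M" and j: "j \<in> units_mod" and nz: "cv (cj x E') (pw j E') \<noteq> 0"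
  shows "cj x E' = pw j E'"
proof (rule prim_on_eq[OF M' _ small.pw_EE_prim[OF j] nz])
  show "prim_on M' (cj x E')"
    using normalizes_M'[OF x conj_agree[OF x j nz]] x M_carrier
    by (intro prim_on_conj M' small.EE_prim) auto
qed

lemma pw_E'_nz: "j \<in> units_mod \<Longrightarrow> cv (pw j E') (pw j E') \<noteq> 0"
  using small.pw_EE_prim by (simp add: prim_on_def)

lemma conj_agree':
  assumes "x \<in> M" "j \<in> units_mod" "cj x E' = pw j E'" "a \<in> A"
  shows "\<theta> (inv x \<otimes> a \<otimes> x) = \<theta> a ^ j"
  using conj_agree assms pw_E'_nz by simp

text \<open>Induction in stages: inducing from \<open>H\<close> to \<open>M\<close> passes through
  \<open>M'\<close>.\<close>

lemma E_alt: "E = smul (1 / of_nat (card M')) (\<Sum>y\<in>M. cj y E')"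
proof -
  have "(\<Sum>y\<in>M. cj y E') = smul (1 / of_nat (card H)) (\<Sum>y\<in>M. \<Sum>z\<in>M'. cj y (cj z e))"
    by (simp add: EE_def[of M'] cj_sum smul_sum)
  also have "(\<Sum>y\<in>M. \<Sum>z\<in>M'. cj y (cj z e)) = (\<Sum>z\<in>M'. \<Sum>y\<in>M. cj y (cj z e))"
    by (rule sum.swap)
  also have "\<dots> = (\<Sum>z\<in>M'. \<Sum>y\<in>M. cj y e)"
  proof (rule sum.cong[OF refl])
    fix z assume z: "z \<in> M'"
    have "(\<Sum>y\<in>M. cj y (cj z e)) = (\<Sum>y\<in>M. cj (y \<otimes> z) e)"
      using z M'M M_carrier by (intro sum.cong) auto
    also have "\<dots> = (\<Sum>y\<in>M. cj y e)"
      using z M'M by (intro sum_reindex_subgroup_mult_right[OF M]) auto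
    finally show "(\<Sum>y\<in>M. cj y (cj z e)) = (\<Sum>y\<in>M. cj y e)" .
  qed
  also have "\<dots> = smul (of_nat (card M')) (\<Sum>y\<in>M. cj y e)" by (rule sum_const_fun)
  finally have "(\<Sum>y\<in>M. cj y E') = smul (1 / of_nat (card H)) (smul (of_nat (card M')) (\<Sum>y\<in>M. cj y e))" .
  moreover have "1 / of_nat (card M') * (1 / of_nat (card H) * of_nat (card M')) = (1 / of_nat (card H) :: complex)"
    using subgroup_card_pos[OF M'] by simp
  ultimately show ?thesis unfolding EE_def[of M] by (simp only: smul_smul)
qed

lemma pw_E_eq:
  assumes x: "x \<in> M" and k: "k \<in> units_mod" and eq: "cj x E' = pw k E'"
  shows "pw k E = E"
proof -
  have "(\<Sum>y\<in>M. pw k (cj y E')) = (\<Sum>y\<in>M. cj (y \<otimes> x) E')"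
    using x M_carrier by (intro sum.cong) (auto simp: pw_cj eq[symmetric])
  also have "\<dots> = (\<Sum>y\<in>M. cj y E')"
    by (rule sum_reindex_subgroup_mult_right[OF M x])
  finally show ?thesis by (simp add: E_alt pw_sum)
qed

text \<open>This is the centralizer in \<open>M\<close> of e(M', H, K), which is a nonzero multiple
  of \<open>tsum E'\<close>.\<close>

definition Cset where "Cset = {x \<in> M. cj x (tsum E') = tsum E'}"

lemma Cset_obtain:
  assumes "x \<in> Cset"
  obtains k where "k \<in> units_mod" "cj x E' = pw k E'"
proof -
  have x: "x \<in> M" "x \<in> carrier G" "cj x (tsum E') = tsum E'" using assms M_carrier by (auto simp: Cset_def)
  obtain j where "j \<in> units_mod" "cv (cj x E') (pw j E') \<noteq> 0"
    using x(2,3) small.EE_cv_tsum_nz by (rule fixed_tsum_obtain)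
  then show ?thesis using conj_eq_pw[OF x(1)] that by blast
qed

lemma Cset_iff: "x \<in> Cset \<longleftrightarrow> x \<in> M \<and> (\<exists>k\<in>units_mod. cj x E' = pw k E')"
proof
  show "x \<in> Cset" if x: "x \<in> M \<and> (\<exists>k\<in>units_mod. cj x E' = pw k E')"
    using x cj_tsum M_carrier unfolding Cset_def by blast
  show "x \<in> M \<and> (\<exists>k\<in>units_mod. cj x E' = pw k E')" if x: "x \<in> Cset"
    using Cset_obtain[OF x] x unfolding Cset_def by blast
qed

text \<open>If \<open>k\<close> fixes \<open>E\<close> then \<open>cv E (pw k E)\<close> is nonzero.
  Expanding both factors into conjugates of \<open>E'\<close> and \<open>pw k E'\<close> gives a
  nonzero product of two of them, and dividing one conjugating element by the other gives
  \<open>x\<close>.\<close>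

lemma stab_obtain:
  assumes k: "k \<in> stab E"
  obtains x where "x \<in> M" "cj x E' = pw k E'"
proof -
  have kU: "k \<in> units_mod" and kE: "pw k E = E" using k by (auto simp: stab_def)
  have "cv E (pw k E) \<noteq> 0" using kE EE_idem EE_nz by simp
  moreover have "pw k E = smul (1 / of_nat (card M')) (\<Sum>z\<in>M. cj z (pw k E'))"
    unfolding E_alt pw_smul pw_sum by (intro arg_cong[of _ _ "smul _"] sum.cong refl pw_cj M_carrier)
  ultimately have "cv E (smul (1 / of_nat (card M')) (\<Sum>z\<in>M. cj z (pw k E'))) \<noteq> 0"
    by simp
  then have "cv (\<Sum>y\<in>M. cj y E') (\<Sum>z\<in>M. cj z (pw k E')) \<noteq> 0"
    unfolding E_alt by auto
  then obtain y z where y: "y \<in> M" and z: "z \<in> M" "cv (cj y E') (cj z (pw k E')) \<noteq> 0"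
    by (rule cv_sums_neq_0_obtain)
  have yz: "y \<in> carrier G" "z \<in> carrier G" using y z M_carrier by auto
  have "cj z (cv (cj (inv z \<otimes> y) E') (pw k E')) = cv (cj y E') (cj z (pw k E'))"
    using yz by (simp add: cj_cv)
  then have "cv (cj (inv z \<otimes> y) E') (pw k E') \<noteq> 0" using z by auto
  then have "cj (inv z \<otimes> y) E' = pw k E'" using y z kU by (intro conj_eq_pw) auto
  then show ?thesis using that[of "inv z \<otimes> y"] y z(1) by simp
qed

text \<open>An element fixing \<open>E'\<close> fixes \<theta> on \<open>A\<close>, by
  \<open>conj_agree'\<close> with the neutral unit, and so lies in the inertia group.\<close>

lemma fix_E'_iff: "u \<in> M \<Longrightarrow> cj u E' = E' \<longleftrightarrow> u \<in> M'"
proof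
  assume u: "u \<in> M" "cj u E' = E'"
  have one: "pw (1 mod order G) E' = E'"
    using pw_mod[of 1 E'] pw_1[OF small.EE_supp_carrier] by simp
  have "\<theta> (inv u \<otimes> a \<otimes> u) = \<theta> a" if a: "a \<in> A" for a
  proof -
    have "\<theta> (inv u \<otimes> a \<otimes> u) = \<theta> a ^ (1 mod order G)"
      using u one a units_mod_one by (intro conj_agree') auto
    also have "\<dots> = \<theta> (a [^] (1 mod order G))" using a AH by (intro theta_pow[symmetric]) auto
    also have "\<dots> = \<theta> a" using pow_mod_order[of a 1] a A_carrier by simp
    finally show ?thesis .
  qed
  then have "inv u \<in> M'" using u M_carrier by (subst M'_eq) auto
  then show "u \<in> M'" using small.M_closed(3) u M_carrier by (metis inv_inv)
qed (rule small.EE_conj)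

text \<open>Double counting of the pairs \<open>(x, k)\<close> with \<open>cj x E' = pw k E'\<close>.\<close>

lemma card_Cset: "card Cset * card (stab E') = card (stab E) * card M'"
proof -
  have finM: "finite M" using subgroup_finite[OF M] .
  then have finC: "finite Cset" by (simp add: Cset_def)
  let ?F = "\<lambda>x. {k \<in> units_mod. cj x E' = pw k E'}" and ?F' = "\<lambda>k. {x \<in> M. cj x E' = pw k E'}"
  \<comment> \<open>For fixed \<open>x\<close> the admissible \<open>k\<close> form a coset of the
    stabilizer of \<open>E'\<close>.\<close>
  have 1: "card (?F x) = card (stab E')" if "x \<in> Cset" for x
  proof -
    obtain k0 where k0: "k0 \<in> units_mod" "cj x E' = pw k0 E'" using Cset_obtain \<open>x \<in> Cset\<close> by blast
    have "?F x = {k \<in> units_mod. pw k E' = pw k0 E'}" using k0 by auto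
    then show ?thesis using card_pw_fibre[OF k0(1) small.EE_supp_carrier] by (simp add: stab_def)
  qed
  \<comment> \<open>For fixed \<open>k\<close> the admissible \<open>x\<close> form a coset of
    \<open>M'\<close>, nonempty by \<open>stab_obtain\<close>.\<close>
  have 2: "card (?F' k) = card M'" if k: "k \<in> stab E" for k
  proof -
    obtain x0 where x0: "x0 \<in> M" "cj x0 E' = pw k E'" using stab_obtain[OF k] .
    have "{g \<in> M. cj g E' = E'} = M'" using fix_E'_iff M'M by blast
    then show ?thesis using card_cj_fibre[OF M small.EE_supp_carrier x0(1)] x0(2) by simp
  qed
  have "card (Sigma Cset ?F) = card Cset * card (stab E')"
    using finC units_mod_finite 1 by (subst card_SigmaI) auto
  moreover have "card (Sigma (stab E) ?F') = card (stab E) * card M'"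
    using stab_finite finM 2 by (subst card_SigmaI) auto
  moreover have "card (Sigma Cset ?F) = card (Sigma (stab E) ?F')"
  proof -
    have iff: "x \<in> Cset \<and> k \<in> ?F x \<longleftrightarrow> k \<in> stab E \<and> x \<in> ?F' k" for x k
      using pw_E_eq unfolding Cset_iff stab_def mem_Collect_eq by blast
    have "Sigma (stab E) ?F' = prod.swap ` Sigma Cset ?F"
      unfolding set_eq_iff split_paired_All pair_in_swap_image mem_Sigma_iff using iff by blast
    then show ?thesis by (simp add: card_image)
  qed
  ultimately show ?thesis by simp
qed

definition Dset where "Dset = {x \<in> M. cj x (tsum e) = tsum e}"

text \<open>\<open>e\<close> absorbs \<open>E'\<close>, and \<open>pw j e\<close> absorbs
  \<open>pw j E'\<close>. A nonzero product of \<open>cj x e\<close> and \<open>pw j e\<close>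
  therefore forces \<open>cj x E'\<close> and \<open>pw j E'\<close> to have nonzero product, hence
  to be equal.\<close>

lemma Dset_subset_Cset: "Dset \<subseteq> Cset"
proof
  fix x assume "x \<in> Dset"
  then have x: "x \<in> M" "x \<in> carrier G" "cj x (tsum e) = tsum e" using M_carrier by (auto simp: Dset_def)
  interpret self: shoda G H \<theta> H by (rule shoda_self)
  have "cv e (tsum e) \<noteq> 0" using self.EE_cv_tsum_nz unfolding EE_self .
  with x(2,3) obtain j where j: "j \<in> units_mod" "cv (cj x e) (pw j e) \<noteq> 0"
    by (rule fixed_tsum_obtain)
  have 1: "cj x e = cv (cj x e) (cj x E')" using small.ee_EE x(2) by (simp flip: cj_cv)
  have 2: "pw j e = cv (pw j E') (pw j e)"
    using shoda.EE_ee[OF small.shoda_pw_sub[OF j(1)]] small.pw_EE_M[OF j(1)] pw_ee[OF j(1)] by simp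
  have "cv (cj x e) (pw j e) = cv (cv (cj x e) (cj x E')) (cv (pw j E') (pw j e))"
    using 1 2 by simp
  also have "\<dots> = cv (cj x e) (cv (cv (cj x E') (pw j E')) (pw j e))"
    by (simp add: cv_assoc)
  finally have "cv (cj x E') (pw j E') \<noteq> 0" using j by auto
  then have "cj x E' = pw j E'" using conj_eq_pw x j by blast
  then show "x \<in> Cset" using x j Cset_iff by blast
qed

lemma M'_subset_Cset: "M' \<subseteq> Cset"
proof
  fix u assume u: "u \<in> M'"
  have "pw (1 mod order G) E' = E'"
    using pw_mod[of 1 E'] pw_1[OF small.EE_supp_carrier] by simp
  then have "cj u E' = pw (1 mod order G) E'" using small.EE_conj[OF u] by simp
  then show "u \<in> Cset" unfolding Cset_iff using u M'M units_mod_one by blast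
qed

lemma subgroup_fix:
  assumes a: "supp_on (carrier G) a"
  shows "subgroup {x \<in> M. cj x a = a} G"
proof (rule subgroupI)
  show "{x \<in> M. cj x a = a} \<noteq> {}" using cj_one[OF a] M_closed(2) by blast
  show "inv x \<in> {x \<in> M. cj x a = a}" if "x \<in> {x \<in> M. cj x a = a}" for x
    using that cj_inv_cancel(1)[of x a] a M_carrier by auto
  show "x \<otimes> y \<in> {x \<in> M. cj x a = a}" if "x \<in> {x \<in> M. cj x a = a}" "y \<in> {x \<in> M. cj x a = a}" for x y
    using that M_carrier by (auto simp flip: cj_cj)
qed (use M_carrier in auto)

lemma Cset_subgroup: "subgroup Cset G" and Dset_subgroup: "subgroup Dset G"
  unfolding Cset_def Dset_def by (intro subgroup_fix tsum_supp)+

text \<open>On \<open>A\<close> such an \<open>x\<close> relates \<theta> to a power with unit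
  exponent, and unit powers have the same kernel.\<close>

lemma Cset_normalizes_ker:
  assumes "x \<in> Cset" "a \<in> A"
  shows "\<theta> (x \<otimes> a \<otimes> inv x) = 1 \<longleftrightarrow> \<theta> a = 1"
proof -
  obtain k where k: "k \<in> units_mod" "cj x E' = pw k E'" using Cset_obtain[OF assms(1)] .
  have x: "x \<in> M" "x \<in> carrier G" using assms M_carrier by (auto simp: Cset_def)
  define b where "b = x \<otimes> a \<otimes> inv x"
  have b: "b \<in> A" using A_conj x assms b_def by simp
  have "\<theta> a = \<theta> b ^ k"
    using conj_agree'[OF x(1) k b] x assms A_carrier by (simp add: b_def)
  moreover have "\<theta> b = 1" if "\<theta> b ^ k = 1"
    using theta_pow_inj[OF k(1), of b \<one>] b AH that by auto
  ultimately show ?thesis unfolding b_def[symmetric] by (metis power_one)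
qed

end

section \<open>The idempotent \<open>\<epsilon>(H, K)\<close>\<close>

definition emb :: "('a \<Rightarrow> rat) \<Rightarrow> 'a \<Rightarrow> complex" where
  "emb a = (\<lambda>x. of_rat (a x))"

lemma emb_inj: "emb a = emb b \<longleftrightarrow> a = b"
  by (simp add: emb_def fun_eq_iff)

lemma emb_diff: "emb (a - b) = emb a - emb b"
  by (simp add: emb_def fun_eq_iff of_rat_diff)

lemma emb_add: "emb (a + b) = emb a + emb b"
  by (simp add: emb_def fun_eq_iff of_rat_add)

lemma emb_0 [simp]: "emb 0 = 0" and emb_eq_0_iff [simp]: "emb a = 0 \<longleftrightarrow> a = 0"
  by (simp_all add: emb_def fun_eq_iff)

lemma emb_sum: "emb (\<Sum>i\<in>I. f i) = (\<Sum>i\<in>I. emb (f i))"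
  by (simp add: emb_def fun_eq_iff sum_fun_apply of_rat_sum)

lemma emb_smul: "emb (\<lambda>x. c * a x) = smul (of_rat c) (emb a)"
  by (simp add: emb_def fun_eq_iff of_rat_mult)

context fin_group begin

lemma emb_conv: "emb (conv G a b) = cv (emb a) (emb b)"
  by (auto simp: fun_eq_iff emb_def conv_def cv_def of_rat_sum of_rat_mult)

lemma emb_qg_conj: "emb (qg_conj G g a) = cj g (emb a)"
  by (auto simp: fun_eq_iff emb_def qg_conj_def cj_def)

lemma emb_qg_one: "emb (qg_one G) = (\<lambda>x. if x = \<one> then 1 else 0)"
  by (auto simp: fun_eq_iff emb_def qg_one_def)

lemma cv_one_right: 
  assumes "supp_on (carrier G) a"
  shows "cv a (emb (qg_one G)) = a"
proof
  fix x
  show "cv a (emb (qg_one G)) x = a x"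
  proof (cases "x \<in> carrier G")
    case True
    have "a y * emb (qg_one G) (inv y \<otimes> x) = (if y = x then a y else 0)" if y: "y \<in> carrier G" for y
    proof -
      have "inv y \<otimes> x = \<one> \<longleftrightarrow> x = y"
        using y True inv_solve_left'[of \<one> y x] by simp
      then show ?thesis unfolding emb_qg_one by (cases "x = y") simp_all
    qed
    then have "cv a (emb (qg_one G)) x = (\<Sum>y\<in>carrier G. if y = x then a y else 0)"
      unfolding cv_def using True by (simp cong: sum.cong)
    then show ?thesis using True fin by simp
  qed (use assms in \<open>simp add: supp_on_def cv_def\<close>)
qed

lemma lin_sub_one:
  assumes "subgroup L G"
  shows "lin_sub G L (\<lambda>x. if x \<in> L then 1 else 0)"
  using assms by (intro lin_sub.intro lin_sub_axioms.intro fin_group_axioms)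
    (auto simp: lin_char_def subgroup.m_closed)

lemma emb_hat:
  assumes "subgroup L G"
  shows "emb (hat L) = ee L (\<lambda>x. if x \<in> L then 1 else 0)"
  using assms by (auto simp: fun_eq_iff emb_def hat_def ee_def of_rat_divide subgroup.m_inv_closed)

lemma cv_hat_right:
  assumes L: "subgroup L G" and a: "supp_on (carrier G) a"
    and inv: "\<And>x l. x \<in> carrier G \<Longrightarrow> l \<in> L \<Longrightarrow> a (x \<otimes> l) = a x"
  shows "cv a (emb (hat L)) = a"
proof
  fix x
  show "cv a (emb (hat L)) x = a x"
  proof (cases "x \<in> carrier G")
    case True
    have LG: "l \<in> carrier G" if "l \<in> L" for l using that L subgroup.mem_carrier by metis
    have "cv a (emb (hat L)) x = (\<Sum>y\<in>carrier G. a (x \<otimes> y) * emb (hat L) (inv (x \<otimes> y) \<otimes> x))"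
      using sum_reindex_mult_left[OF True, of "\<lambda>y. a y * emb (hat L) (inv y \<otimes> x)"] True by (simp add: cv_def)
    also have "\<dots> = (\<Sum>y\<in>carrier G. a (x \<otimes> y) * emb (hat L) (inv y))"
      using True by (intro sum.cong refl) (simp add: inv_mult_group m_assoc)
    also have "\<dots> = (\<Sum>y\<in>L. a (x \<otimes> y) * emb (hat L) (inv y))"
    proof (rule sum.mono_neutral_right)
      show "\<forall>y\<in>carrier G - L. a (x \<otimes> y) * emb (hat L) (inv y) = 0"
        using subgroup.m_inv_closed[OF L] inv_inv by (fastforce simp: emb_def hat_def)
    qed (use fin LG in auto)
    also have "\<dots> = (\<Sum>y\<in>L. a x / of_nat (card L))"
      using inv[OF True] subgroup.m_inv_closed[OF L] by (intro sum.cong refl) (auto simp: emb_def hat_def of_rat_divide)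
    also have "\<dots> = a x" using subgroup_card_pos[OF L] by simp
    finally show ?thesis .
  qed (use a in \<open>simp add: supp_on_def cv_def\<close>)
qed

lemma cv_hat_left:
  assumes L: "subgroup L G" and a: "supp_on (carrier G) a"
    and inv: "\<And>x l. x \<in> carrier G \<Longrightarrow> l \<in> L \<Longrightarrow> a (l \<otimes> x) = a x"
  shows "cv (emb (hat L)) a = a"
proof
  fix x
  show "cv (emb (hat L)) a x = a x"
  proof (cases "x \<in> carrier G")
    case True
    have LG: "l \<in> carrier G" if "l \<in> L" for l using that L subgroup.mem_carrier by metis
    have "cv (emb (hat L)) a x = (\<Sum>y\<in>L. emb (hat L) y * a (inv y \<otimes> x))"
      unfolding cv_def using True fin LG
      by (simp, intro sum.mono_neutral_right) (auto simp: emb_def hat_def)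
    also have "\<dots> = (\<Sum>y\<in>L. a x / of_nat (card L))"
      using inv[OF True] subgroup.m_inv_closed[OF L] by (intro sum.cong refl) (auto simp: emb_def hat_def of_rat_divide)
    also have "\<dots> = a x" using subgroup_card_pos[OF L] by simp
    finally show ?thesis .
  qed (use a in \<open>simp add: supp_on_def cv_def\<close>)
qed

lemma hat_supp: "subgroup L G \<Longrightarrow> supp_on L (emb (hat L))"
  by (simp add: supp_on_def emb_def hat_def)

lemma hat_supp_carrier: "subgroup L G \<Longrightarrow> supp_on (carrier G) (emb (hat L))"
  using hat_supp supp_on_mono subgroup.subset by metis

lemma hat_mult:
  assumes "subgroup K G" "subgroup L G" "K \<subseteq> L"
  shows "cv (emb (hat K)) (emb (hat L)) = emb (hat L)"
proof (rule cv_hat_left[OF assms(1) hat_supp_carrier[OF assms(2)]])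
  fix x l assume "x \<in> carrier G" "l \<in> K"
  then have "l \<otimes> x \<in> L \<longleftrightarrow> x \<in> L"
    using lin_sub.H_mult_iff(2)[OF lin_sub_one[OF assms(2)]] assms(3) by blast
  then show "emb (hat L) (l \<otimes> x) = emb (hat L) x" by (simp add: emb_def hat_def)
qed

end

lemma (in normal) comm_group_Mod_iff:
  "comm_group (G Mod H) \<longleftrightarrow> (\<forall>x\<in>carrier G. \<forall>y\<in>carrier G. H #> (x \<otimes> y) = H #> (y \<otimes> x))"
proof
  assume c: "comm_group (G Mod H)"
  interpret Q: comm_group "G Mod H" by (rule c)
  show "\<forall>x\<in>carrier G. \<forall>y\<in>carrier G. H #> (x \<otimes> y) = H #> (y \<otimes> x)"
  proof (intro ballI)
    fix x y assume xy: "x \<in> carrier G" "y \<in> carrier G"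
    then have "(H #> x) <#> (H #> y) = (H #> y) <#> (H #> x)"
      using Q.m_comm[of "H #> x" "H #> y"] by (auto simp: carrier_FactGroup)
    then show "H #> (x \<otimes> y) = H #> (y \<otimes> x)" using xy by (simp add: rcos_sum)
  qed
next
  assume c: "\<forall>x\<in>carrier G. \<forall>y\<in>carrier G. H #> (x \<otimes> y) = H #> (y \<otimes> x)"
  show "comm_group (G Mod H)"
  proof (rule group.group_comm_groupI[OF factorgroup_is_group])
    fix X1 X2 assume "X1 \<in> carrier (G Mod H)" "X2 \<in> carrier (G Mod H)"
    then obtain x y where xy: "x \<in> carrier G" "X1 = H #> x" "y \<in> carrier G" "X2 = H #> y"
      by (auto simp: carrier_FactGroup)
    then show "X1 \<otimes>\<^bsub>G Mod H\<^esub> X2 = X2 \<otimes>\<^bsub>G Mod H\<^esub> X1"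
      using c by (simp add: rcos_sum)
  qed
qed

section \<open>Powers of \<theta> and their idempotents\<close>

context lin_sub begin

definition K where "K = char_ker G H \<theta>"

lemma K_eq: "K = {h \<in> H. \<theta> h = 1}"
  by (simp add: K_def char_ker_def)

lemma K_subgroup: "subgroup K G"
proof (rule subgroupI)
  have "\<one> \<in> K" by (simp add: K_eq)
  then show "K \<noteq> {}" by blast
qed (auto simp: K_eq H_carrier theta_inv theta_mult)

lemma theta_conj: "x \<in> H \<Longrightarrow> y \<in> H \<Longrightarrow> \<theta> (x \<otimes> y \<otimes> inv x) = \<theta> y"
  using theta_nz[of x] by (simp add: theta_mult theta_inv)

text \<open>For \<open>j\<close> not coprime to \<open>|G|\<close> the function \<open>pw j \<theta>\<close> need not vanish outside \<open>H\<close>,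
  hence a separate definition of the powers of \<open>\<theta>\<close>.\<close>

definition th :: "nat \<Rightarrow> 'a \<Rightarrow> complex" where
  "th j = (\<lambda>x. if x \<in> H then \<theta> x ^ j else 0)"

abbreviation (input) P where "P j \<equiv> ee H (th j)"

lemma th_lin_sub: "lin_sub G H (th j)"
  by (intro lin_sub.intro lin_sub_axioms.intro fin_group_axioms H)
    (auto simp: lin_char_def th_def theta_mult power_mult_distrib theta_nz)

lemma th_unit:
  assumes "k \<in> units_mod"
  shows "th k = pw k \<theta>"
  using pow_units_in_H[OF assms] theta_out H_carrier by (auto simp: fun_eq_iff th_def pw_def theta_pow)

lemma P_unit: "k \<in> units_mod \<Longrightarrow> P k = pw k (ee H \<theta>)"
  by (simp add: th_unit pw_ee)

lemma P_eq_iff: "P i = P j \<longleftrightarrow> (\<forall>h\<in>H. \<theta> h ^ i = \<theta> h ^ j)"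
proof
  assume eq: "P i = P j"
  show "\<forall>h\<in>H. \<theta> h ^ i = \<theta> h ^ j"
  proof
    fix h assume h: "h \<in> H"
    have "P i (inv h) = P j (inv h)" using eq by simp
    then show "\<theta> h ^ i = \<theta> h ^ j" using h H_carrier card_H by (simp add: ee_def th_def)
  qed
qed (auto simp: fun_eq_iff ee_def th_def)

lemma theta_pow_mod: "h \<in> H \<Longrightarrow> \<theta> h ^ (j mod order G) = \<theta> h ^ j"
proof -
  assume h: "h \<in> H"
  have "\<theta> h ^ j = \<theta> h ^ (order G * (j div order G) + j mod order G)" by simp
  also have "\<dots> = \<theta> h ^ (j mod order G)" unfolding power_add power_mult theta_root[OF h] by simp
  finally show ?thesis by simp
qed

lemma P_mod: "P (j mod order G) = P j"
  by (simp add: P_eq_iff theta_pow_mod)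

text \<open>Adding \<open>j\<close> modulo |G| carries the exponents of the trivial power to those
  of the \<open>j\<close>-th power.\<close>

lemma P_fibre:
  assumes j: "j < order G"
  shows "card {i \<in> {..<order G}. P i = P j} = card {i \<in> {..<order G}. P i = P 0}"
proof -
  have "bij_betw (\<lambda>i. (i + j) mod order G) {i \<in> {..<order G}. P i = P 0} {i \<in> {..<order G}. P i = P j}"
  proof (rule bij_betw_byWitness[where f' = "\<lambda>i. (i + (order G - j)) mod order G"])
    have "((i + j) mod order G + (order G - j)) mod order G = i"
      "((i + (order G - j)) mod order G + j) mod order G = i" if "i < order G" for i
    proof -
      have "i + j + (order G - j) = i + order G" "i + (order G - j) + j = i + order G" using j by auto
      then show "((i + j) mod order G + (order G - j)) mod order G = i"
        "((i + (order G - j)) mod order G + j) mod order G = i"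
        unfolding mod_add_left_eq using that by simp_all
    qed
    then show "\<forall>i\<in>{i \<in> {..<order G}. P i = P 0}. ((i + j) mod order G + (order G - j)) mod order G = i"
      "\<forall>i\<in>{i \<in> {..<order G}. P i = P j}. ((i + (order G - j)) mod order G + j) mod order G = i"
      by blast+
    show "(\<lambda>i. (i + j) mod order G) ` {i \<in> {..<order G}. P i = P 0} \<subseteq> {i \<in> {..<order G}. P i = P j}"
    proof (rule image_subsetI)
      fix i assume "i \<in> {i \<in> {..<order G}. P i = P 0}"
      then have i: "i < order G" "P i = P 0" by auto
      have "\<theta> h ^ (i + j) = \<theta> h ^ j" if h: "h \<in> H" for h
      proof -
        have "\<theta> h ^ i = \<theta> h ^ 0" using i(2) h unfolding P_eq_iff by blast
        then show ?thesis by (simp only: power_add power_0 mult_1)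
      qed
      then have "P ((i + j) mod order G) = P j" unfolding P_mod P_eq_iff by blast
      then show "(i + j) mod order G \<in> {i \<in> {..<order G}. P i = P j}" using order_pos by simp
    qed
    show "(\<lambda>i. (i + (order G - j)) mod order G) ` {i \<in> {..<order G}. P i = P j} \<subseteq> {i \<in> {..<order G}. P i = P 0}"
    proof (rule image_subsetI)
      fix i assume "i \<in> {i \<in> {..<order G}. P i = P j}"
      then have i: "i < order G" "P i = P j" by auto
      have "\<theta> h ^ (i + (order G - j)) = \<theta> h ^ 0" if h: "h \<in> H" for h
      proof -
        have "\<theta> h ^ (i + (order G - j)) = \<theta> h ^ (j + (order G - j))"
        proof -
          have "\<theta> h ^ i = \<theta> h ^ j" using i(2) h unfolding P_eq_iff by blast
          then show ?thesis by (simp only: power_add)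
        qed
        also have "j + (order G - j) = order G" using j by simp
        finally show ?thesis using theta_root[OF h] by simp
      qed
      then have "P ((i + (order G - j)) mod order G) = P 0" unfolding P_mod P_eq_iff by blast
      then show "(i + (order G - j)) mod order G \<in> {i \<in> {..<order G}. P i = P 0}" using order_pos by simp
    qed
  qed
  then show ?thesis by (rule bij_betw_same_card[symmetric])
qed

text \<open>A geometric sum of roots of unity. The scalar reflects that \<theta> has |H/K| distinct
  powers, so that each occurs |G||K|/|H| times among the exponents below |G|.\<close>

lemma sum_P: "(\<Sum>j\<in>{..<order G}. P j) = smul (of_nat (order G) * of_nat (card K) / of_nat (card H)) (emb (hat K))"
proof
  fix x
  have cK: "card K \<noteq> 0" using subgroup_card_pos[OF K_subgroup] by simp
  show "(\<Sum>j\<in>{..<order G}. P j) x = smul (of_nat (order G) * of_nat (card K) / of_nat (card H)) (emb (hat K)) x"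
  proof (cases "x \<in> H")
    case True
    have iff: "\<theta> (inv x) = 1 \<longleftrightarrow> x \<in> K"
      using True theta_nz[OF True] by (auto simp: K_eq theta_inv)
    have s: "(\<Sum>j\<in>{..<order G}. P j) x = (\<Sum>j\<in>{..<order G}. \<theta> (inv x) ^ j) / of_nat (card H)"
      using True by (simp add: sum_fun_apply ee_def th_def sum_divide_distrib)
    show ?thesis
    proof (cases "x \<in> K")
      case T: True
      then show ?thesis using s iff cK by (simp add: emb_def hat_def of_rat_divide)
    next
      case False
      then have "(\<Sum>j\<in>{..<order G}. \<theta> (inv x) ^ j) = 0"
        using geometric_sum[of "\<theta> (inv x)" "order G"] iff theta_root[of "inv x"] True by simp
      then show ?thesis using s False by (simp add: emb_def hat_def)
    qed
  next
    case False
    then show ?thesis by (simp add: sum_fun_apply ee_def emb_def hat_def K_eq)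
  qed
qed

text \<open>\<open>hat L\<close> is the idempotent of the trivial character of \<open>L\<close>, so
  it fixes \<open>P j\<close> or is orthogonal to it according to whether the \<open>j\<close>-th
  power of \<theta> is trivial on \<open>L\<close>.\<close>

lemma P_hat:
  assumes L: "subgroup L G" "L \<subseteq> H"
  shows "cv (P j) (emb (hat L)) = (if \<forall>l\<in>L. \<theta> l ^ j = 1 then P j else 0)"
proof -
  interpret T: lin_sub G H "th j" by (rule th_lin_sub)
  show ?thesis
  proof (cases "\<forall>l\<in>L. \<theta> l ^ j = 1")
    case True
    then have "th j l = 1" if "l \<in> L" for l using that L by (auto simp: th_def)
    then have "cv (P j) (emb (hat L)) = P j"
      using L by (intro cv_hat_right T.ee_supp_carrier) (auto simp: T.ee_mult_right)
    then show ?thesis using True by simp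
  next
    case False
    then obtain l where l: "l \<in> L" "\<theta> l ^ j \<noteq> 1" by blast
    have lH: "l \<in> H" "l \<in> carrier G" using l L H_carrier by auto
    have "cv (cj \<one> (P j)) (cj \<one> (ee L (\<lambda>x. if x \<in> L then 1 else 0))) = 0"
      using l lH by (intro T.ee_orthogonal[OF lin_sub_one[OF L(1)], of _ _ l]) (auto simp: th_def)
    then show ?thesis
      using False by (auto simp: cj_one T.ee_supp_carrier emb_hat[OF L(1), symmetric] hat_supp_carrier[OF L(1)])
  qed
qed

lemma factor_subgroup:
  assumes "L \<in> eps_factors G H K"
  shows "subgroup L G" "L \<subseteq> H" "K \<subseteq> L" "\<exists>l\<in>L. \<theta> l \<noteq> 1"
proof -
  have n: "L \<lhd> G\<lparr>carrier := H\<rparr>" and KL: "K \<subseteq> L"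
    and mn: "min_normal (G\<lparr>carrier := H\<rparr> Mod K) ((\<lambda>l. K #> l) ` L)"
    using assms by (auto simp: eps_factors_def)
  have s: "subgroup L (G\<lparr>carrier := H\<rparr>)" using n normal_imp_subgroup by blast
  show LH: "L \<subseteq> H" using subgroup.subset[OF s] by simp
  show LG: "subgroup L G" using s H incl_subgroup by blast
  show "K \<subseteq> L" by (rule KL)
  have "(\<lambda>l. K #> l) ` L \<noteq> {K}" using mn by (simp add: min_normal_def)
  show "\<exists>l\<in>L. \<theta> l \<noteq> 1"
  proof (rule ccontr)
    assume "\<not> (\<exists>l\<in>L. \<theta> l \<noteq> 1)"
    then have "L \<subseteq> K" using LH by (auto simp: K_eq)
    then have "K #> l = K" if "l \<in> L" for l
      using that coset_join2[OF _ K_subgroup] H_carrier LH by blast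
    moreover have "L \<noteq> {}" using subgroup.one_closed[OF LG] by blast
    ultimately have "(\<lambda>l. K #> l) ` L = {K}" by auto
    then show False using \<open>(\<lambda>l. K #> l) ` L \<noteq> {K}\<close> by simp
  qed
qed

text \<open>\<theta> is linear, so commutators of elements of \<open>H\<close> lie in its
  kernel.\<close>

lemma subgroup_over_K_normal:
  assumes "subgroup L G" "K \<subseteq> L" "L \<subseteq> H"
  shows "L \<lhd> G\<lparr>carrier := H\<rparr>"
proof -
  interpret HG: group "G\<lparr>carrier := H\<rparr>" using H subgroup.subgroup_is_group is_group by blast
  have sub: "subgroup L (G\<lparr>carrier := H\<rparr>)" using assms H subgroup_incl by blast
  have "x \<otimes> l \<otimes> inv x \<in> L" if "x \<in> H" "l \<in> L" for x l
  proof -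
    have lH: "l \<in> H" "l \<in> carrier G" "x \<in> carrier G" using that assms H_carrier by auto
    have "x \<otimes> l \<otimes> inv x \<otimes> inv l \<in> K"
      using that lH theta_conj[OF that(1) lH(1)] theta_nz[OF lH(1)]
      by (simp add: K_eq theta_mult[of "x \<otimes> l \<otimes> inv x"] theta_inv)
    then have "x \<otimes> l \<otimes> inv x \<otimes> inv l \<otimes> l \<in> L" using assms that subgroup.m_closed by (metis subsetD)
    then show ?thesis using lH by (simp add: m_assoc)
  qed
  then show ?thesis
    using sub H m_inv_consistent by (auto simp: HG.normal_inv_iff)
qed

lemma K_normal: "K \<lhd> G\<lparr>carrier := H\<rparr>"
  by (intro subgroup_over_K_normal K_subgroup) (auto simp: K_eq)

end

section \<open>Minimal subgroups over the kernel and the product defining \<open>eps\<close>\<close>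

context lin_sub begin

lemma rcos_H_eq_K:
  assumes "h \<in> H" shows "K #> h = K \<longleftrightarrow> h \<in> K"
  using coset_join1[of K h] coset_join2[of h K] K_subgroup H_carrier assms subgroup.subset by metis

lemma Mod_K_comm: "comm_group (G\<lparr>carrier := H\<rparr> Mod K)"
proof -
  have "K #> (x \<otimes> y) = K #> (y \<otimes> x)" if "x \<in> H" "y \<in> H" for x y
  proof -
    have "(x \<otimes> y) \<otimes> inv (y \<otimes> x) \<in> K"
      using that theta_nz[of x] theta_nz[of y] by (simp add: K_eq theta_mult theta_inv field_simps)
    then have "(x \<otimes> y) \<in> K #> (y \<otimes> x)"
      using subgroup.rcos_module[OF K_subgroup is_group] that H_carrier by simp
    then show ?thesis
      using that H_carrier K_subgroup by (intro repr_independence[symmetric]) auto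
  qed
  moreover have "r_coset (G\<lparr>carrier := H\<rparr>) = r_coset G" by (simp add: fun_eq_iff r_coset_def)
  ultimately show ?thesis using normal.comm_group_Mod_iff[OF K_normal] by simp
qed

text \<open>A power of \<theta> with a kernel larger than \<open>K\<close> is trivial on some
  minimal subgroup over \<open>K\<close>: take a subgroup of least order strictly above
  \<open>K\<close> inside that kernel. Normality is automatic, the quotient by \<open>K\<close>
  being abelian.\<close>

lemma exists_factor:
  assumes h0: "h0 \<in> H" "\<theta> h0 ^ j = 1" "\<theta> h0 \<noteq> 1"
  obtains L where "L \<in> eps_factors G H K" "\<forall>l\<in>L. \<theta> l ^ j = 1"
proof -
  let ?HG = "G\<lparr>carrier := H\<rparr>"
  interpret N: normal K ?HG by (rule K_normal)
  interpret Q: comm_group "?HG Mod K" by (rule Mod_K_comm)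
  have rc: "r_coset ?HG = r_coset G" by (simp add: fun_eq_iff r_coset_def)
  interpret q: group_hom ?HG "?HG Mod K" "\<lambda>a. K #> a"
    using N.r_coset_hom_Mod N.factorgroup_is_group N.is_group
    by (intro group_hom.intro group_hom_axioms.intro) (simp_all add: rc)
  define S where "S = {L. subgroup L G \<and> K \<subseteq> L \<and> L \<subseteq> H \<and> (\<exists>l\<in>L. \<theta> l \<noteq> 1) \<and> (\<forall>l\<in>L. \<theta> l ^ j = 1)}"
  define W where "W = {h \<in> H. \<theta> h ^ j = 1}"
  have "subgroup W G"
  proof (rule subgroupI)
    have "\<one> \<in> W" by (simp add: W_def)
    then show "W \<noteq> {}" by blast
  qed (auto simp: W_def H_carrier theta_inv theta_mult power_mult_distrib power_inverse)
  then have "W \<in> S" using h0 by (auto simp: S_def W_def K_eq)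
  then obtain L where L: "L \<in> S" "\<And>L'. L' \<in> S \<Longrightarrow> card L \<le> card L'"
    using ex_has_least_nat[of "\<lambda>L. L \<in> S" W card] by blast
  have Ls: "subgroup L G" "K \<subseteq> L" "L \<subseteq> H" "\<exists>l\<in>L. \<theta> l \<noteq> 1" "\<forall>l\<in>L. \<theta> l ^ j = 1"
    using L(1) by (auto simp: S_def)
  let ?Y = "(\<lambda>l. K #> l) ` L"
  have min: "min_normal (?HG Mod K) ?Y"
    unfolding min_normal_def
  proof (intro conjI allI impI)
    have "subgroup L ?HG" using Ls H subgroup_incl by blast
    then show "?Y \<lhd> ?HG Mod K" using q.subgroup_img_is_subgroup Q.subgroup_imp_normal by blast
    obtain l where l: "l \<in> L" "\<theta> l \<noteq> 1" using Ls by blast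
    then have "K #> l \<noteq> K" using rcos_H_eq_K[of l] Ls by (auto simp: K_eq)
    then show "?Y \<noteq> {\<one>\<^bsub>?HG Mod K\<^esub>}" using l by (simp add: one_FactGroup) blast
    fix Z assume Z: "Z \<lhd> ?HG Mod K \<and> Z \<noteq> {\<one>\<^bsub>?HG Mod K\<^esub>} \<and> Z \<subseteq> ?Y"
    then have Zs: "subgroup Z (?HG Mod K)" using normal_imp_subgroup by blast
    \<comment> \<open>A subgroup of the quotient is pulled back to the union of its cosets, to which
      the minimality of \<open>L\<close> applies.\<close>
    have U: "\<Union>Z = {x \<in> H. K #> x \<in> Z}"
      using N.factgroup_subgroup_union_char[OF Zs] by (simp add: rc)
    have Us: "subgroup (\<Union>Z) G"
      using N.factgroup_subgroup_union_subgroup[OF Zs] H incl_subgroup by blast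
    have KZ: "K \<in> Z" using subgroup.one_closed[OF Zs] by simp
    have UL: "\<Union>Z \<subseteq> L"
    proof
      fix x assume "x \<in> \<Union>Z"
      then have x: "x \<in> H" "K #> x \<in> ?Y" using U Z by auto
      then obtain l where l: "l \<in> L" "K #> x = K #> l" by auto
      have "x \<in> K #> x" using subgroup.one_closed[OF K_subgroup] x H_carrier by (force simp: r_coset_def)
      then obtain k where "k \<in> K" "x = k \<otimes> l" using l by (auto simp: r_coset_def)
      then show "x \<in> L" using l Ls subgroup.m_closed by (metis subsetD)
    qed
    obtain z where z: "z \<in> Z" "z \<noteq> K" using Z KZ by auto
    then obtain l where l: "l \<in> L" "z = K #> l" using Z by auto
    have "\<theta> l \<noteq> 1" using z l rcos_H_eq_K[of l] Ls by (auto simp: K_eq)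
    moreover have "l \<in> \<Union>Z" using U l z Ls by auto
    ultimately have "\<Union>Z \<in> S" using Us UL Ls KZ by (auto simp: S_def)
    then have "card L \<le> card (\<Union>Z)" by (rule L(2))
    then have "\<Union>Z = L"
      using UL Ls subgroup_finite card_subset_eq card_mono by (metis le_antisym)
    then have "?Y \<subseteq> Z" using U by auto
    then show "Z = ?Y" using Z by blast
  qed
  have "L \<lhd> ?HG" using subgroup_over_K_normal Ls by blast
  then have "L \<in> eps_factors G H K" using Ls min by (simp add: eps_factors_def)
  then show ?thesis using that Ls by blast
qed

lemma eps_factors_finite: "finite (eps_factors G H K)"
proof (rule finite_subset)
  show "eps_factors G H K \<subseteq> Pow H" using factor_subgroup(2) by blast
qed (simp add: finite_H)

lemma hat_inv_on:
  assumes L: "subgroup L G" "K \<subseteq> L" "L \<subseteq> H"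
  shows "inv_on H (emb (hat L))"
  unfolding inv_on_def
proof
  show "supp_on H (emb (hat L))" using hat_supp[OF L(1)] supp_on_mono L(3) by blast
  interpret N: normal L "G\<lparr>carrier := H\<rparr>" by (rule subgroup_over_K_normal[OF L])
  have cl: "inv u \<otimes> x \<otimes> u \<in> L \<longleftrightarrow> x \<in> L" if "u \<in> H" "x \<in> carrier G" for u x
  proof
    have u: "inv\<^bsub>G\<lparr>carrier := H\<rparr>\<^esub> u = inv u" using that H m_inv_consistent by simp
    show "inv u \<otimes> x \<otimes> u \<in> L" if "x \<in> L"
      using N.inv_op_closed1[of u x] that u \<open>u \<in> H\<close> by simp
    assume "inv u \<otimes> x \<otimes> u \<in> L"
    then have "u \<otimes> (inv u \<otimes> x \<otimes> u) \<otimes> inv u \<in> L"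
      using N.inv_op_closed2[of u "inv u \<otimes> x \<otimes> u"] u that by simp
    then show "x \<in> L" using that H_carrier by simp
  qed
  show "\<forall>u\<in>H. cj u (emb (hat L)) = emb (hat L)"
    using cl subgroup.subset[OF L(1)] by (auto simp: fun_eq_iff cj_def emb_def hat_def)
qed

definition fac :: "'a set \<Rightarrow> 'a \<Rightarrow> rat" where "fac L = hat K - hat L"

lemma fac_commute:
  assumes "L \<in> eps_factors G H K" "L' \<in> eps_factors G H K"
  shows "conv G (fac L) (conv G (fac L') acc) = conv G (fac L') (conv G (fac L) acc)"
proof -
  have KH: "inv_on H (emb (hat K))" by (intro hat_inv_on K_subgroup) (auto simp: K_eq)
  have "cv (emb (hat A)) (emb (hat B)) = cv (emb (hat B)) (emb (hat A))"
    if "inv_on H (emb (hat A))" "inv_on H (emb (hat B))" for A B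
    using inv_on_commute[OF H] that unfolding inv_on_def by blast
  moreover have "inv_on H (emb (hat L))" "inv_on H (emb (hat L'))"
    using hat_inv_on factor_subgroup assms by auto
  ultimately have "cv (emb (fac L)) (emb (fac L')) = cv (emb (fac L')) (emb (fac L))"
    using KH by (simp add: fac_def emb_diff cv_diff_left cv_diff_right algebra_simps)
  then have "emb (conv G (fac L) (conv G (fac L') acc)) = emb (conv G (fac L') (conv G (fac L) acc))"
    unfolding emb_conv by (simp flip: cv_assoc)
  then show ?thesis by (simp add: emb_inj)
qed

lemma P_fac:
  assumes "L \<in> eps_factors G H K"
  shows "cv (P j) (emb (fac L)) = (if \<forall>l\<in>L. \<theta> l ^ j = 1 then 0 else P j)"
proof -
  have "cv (P j) (emb (hat K)) = P j"
    using P_hat[OF K_subgroup, of j] by (auto simp: K_eq)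
  then show ?thesis
    using P_hat[OF factor_subgroup(1,2)[OF assms], of j] by (simp add: fac_def emb_diff cv_diff_right)
qed

lemma P_prod:
  assumes "F \<subseteq> eps_factors G H K"
  shows "cv (P j) (emb (Finite_Set.fold (\<lambda>L acc. conv G (fac L) acc) (qg_one G) F)) =
    (if \<exists>L\<in>F. \<forall>l\<in>L. \<theta> l ^ j = 1 then 0 else P j)"
proof -
  interpret fo: folding_on "eps_factors G H K" "\<lambda>L acc. conv G (fac L) acc" "qg_one G"
    by unfold_locales (simp add: fun_eq_iff fac_commute)
  have "finite F" using assms eps_factors_finite finite_subset by blast
  then have "cv (P j) (emb (fo.F F)) = (if \<exists>L\<in>F. \<forall>l\<in>L. \<theta> l ^ j = 1 then 0 else P j)"
    using assms
  proof (induction F rule: finite_induct)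
    case empty
    interpret T: lin_sub G H "th j" by (rule th_lin_sub)
    show ?case by (simp add: cv_one_right T.ee_supp_carrier)
  next
    case (insert L F)
    then have "cv (P j) (emb (fo.F (insert L F))) = cv (cv (P j) (emb (fac L))) (emb (fo.F F))"
      by (simp add: emb_conv cv_assoc)
    then show ?case using insert P_fac[of L j] by auto
  qed
  then show ?thesis by (simp add: fo.eq_fold)
qed

text \<open>The exponents for which the power of \<theta> has no larger kernel than \<theta>. They
  need not be coprime to |G|.\<close>

definition faithful_powers :: "nat set" where
  "faithful_powers = {j. j < order G \<and> (\<forall>h\<in>H. \<theta> h ^ j = 1 \<longrightarrow> \<theta> h = 1)}"

text \<open>Each factor of \<open>eps\<close> keeps \<open>P j\<close> or kills it, and it kills it
  exactly when the \<open>j\<close>-th power of \<theta> is trivial on the corresponding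
  \<open>L\<close>. No factor kills it precisely when the kernel of the power is
  \<open>K\<close>.\<close>

lemma P_eps:
  assumes "H \<noteq> K" "j < order G"
  shows "cv (P j) (emb (eps G H K)) = (if j \<in> faithful_powers then P j else 0)"
proof -
  have e: "eps G H K = Finite_Set.fold (\<lambda>L acc. conv G (fac L) acc) (qg_one G) (eps_factors G H K)"
    using assms(1) by (simp add: eps_def fac_def)
  have "(\<exists>L\<in>eps_factors G H K. \<forall>l\<in>L. \<theta> l ^ j = 1) \<longleftrightarrow> j \<notin> faithful_powers"
  proof
    assume "\<exists>L\<in>eps_factors G H K. \<forall>l\<in>L. \<theta> l ^ j = 1"
    then obtain L where "L \<in> eps_factors G H K" "\<forall>l\<in>L. \<theta> l ^ j = 1" by blast
    then show "j \<notin> faithful_powers" using factor_subgroup(2,4) by (force simp: faithful_powers_def)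
  next
    assume "j \<notin> faithful_powers"
    then obtain h where "h \<in> H" "\<theta> h ^ j = 1" "\<theta> h \<noteq> 1" using assms(2) by (auto simp: faithful_powers_def)
    then show "\<exists>L\<in>eps_factors G H K. \<forall>l\<in>L. \<theta> l ^ j = 1" using exists_factor by metis
  qed
  then show ?thesis unfolding e using P_prod[of "eps_factors G H K" j] by simp
qed

text \<open>A single factor \<open>hat K - hat L\<close> already absorbs \<open>hat K\<close>; for
  \<open>H \<noteq> K\<close> the product is not empty.\<close>

lemma hat_K_eps:
  assumes "H \<noteq> K"
  shows "cv (emb (hat K)) (emb (eps G H K)) = emb (eps G H K)"
proof -
  interpret fo: folding_on "eps_factors G H K" "\<lambda>L acc. conv G (fac L) acc" "qg_one G"
    by unfold_locales (simp add: fun_eq_iff fac_commute)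
  have "eps G H K = Finite_Set.fold (\<lambda>L acc. conv G (fac L) acc) (qg_one G) (eps_factors G H K)"
    using assms by (simp add: eps_def fac_def)
  then have e: "eps G H K = fo.F (eps_factors G H K)" by (simp add: fo.eq_fold)
  obtain h where h: "h \<in> H" "\<theta> h \<noteq> 1" using assms by (auto simp: K_eq)
  \<comment> \<open>With exponent 0 the condition on \<open>L\<close> in
    \<open>exists_factor\<close> is vacuous.\<close>
  then obtain L where L: "L \<in> eps_factors G H K" using exists_factor[of h 0] by auto
  have "eps G H K = conv G (fac L) (fo.F (eps_factors G H K - {L}))"
    unfolding e using L eps_factors_finite by (intro fo.remove) auto
  moreover have "cv (emb (hat K)) (emb (fac L)) = emb (fac L)"
    using factor_subgroup[OF L] hat_mult[OF K_subgroup] K_subgroup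
    by (simp add: fac_def emb_diff cv_diff_right)
  ultimately show ?thesis by (simp add: emb_conv flip: cv_assoc)
qed

text \<open>A faithful exponent is coprime to the order \<open>r\<close> of \<theta>, though perhaps
  not to |G|. It is replaced by a number congruent to it modulo \<open>r\<close> all of whose prime
  factors exceed |G|.\<close>

lemma faithful_power_unit:
  assumes j: "j \<in> faithful_powers"
  obtains k where "k \<in> units_mod" "P k = P j"
proof -
  have ex: "order G > 0 \<and> (\<forall>h\<in>H. \<theta> h ^ order G = 1)" using order_pos theta_root by blast
  define r where "r = (LEAST r. r > 0 \<and> (\<forall>h\<in>H. \<theta> h ^ r = 1))"
  have r: "r > 0" "\<And>h. h \<in> H \<Longrightarrow> \<theta> h ^ r = 1"
    using LeastI[of "\<lambda>r. r > 0 \<and> (\<forall>h\<in>H. \<theta> h ^ r = 1)", OF ex] unfolding r_def[symmetric] by auto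
  have least: "r \<le> s" if "s > 0" "\<forall>h\<in>H. \<theta> h ^ s = 1" for s
    unfolding r_def using that by (intro Least_le) auto
  have "coprime j r"
  proof (rule ccontr)
    assume "\<not> coprime j r"
    then obtain p where "Factorial_Ring.prime p" "p dvd gcd j r"
      using prime_factor_nat[of "gcd j r"] unfolding coprime_iff_gcd_eq_1 by blast
    then have p: "Factorial_Ring.prime p" "p dvd j" "p dvd r" by simp_all
    obtain s where s: "r = p * s" using p by (elim dvdE)
    have "s > 0" "s < r" using s r(1) prime_gt_1_nat[OF p(1)] by auto
    then obtain h where h: "h \<in> H" "\<theta> h ^ s \<noteq> 1" using least[of s] by (meson not_less)
    obtain t where t: "j = p * t" using p by (elim dvdE)
    \<comment> \<open>The element \<open>h [^] s\<close> contradicts faithfulness: \<theta> is not 1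
      on it, but its \<open>j\<close>-th power is, because a common prime \<open>p\<close> makes
      \<open>r\<close> divide \<open>s * j\<close>.\<close>
    have "\<theta> (h [^] s) ^ j = (\<theta> h ^ r) ^ t"
    proof -
      have "s * (p * t) = (p * s) * t" by (simp add: mult_ac)
      then show ?thesis unfolding theta_pow[OF h(1)] s t power_mult[symmetric] by (simp only:)
    qed
    then have "\<theta> (h [^] s) ^ j = 1" using r h by simp
    then have "\<theta> (h [^] s) = 1" using j pow_closed[OF h(1)] by (simp add: faithful_powers_def)
    then show False using h theta_pow by simp
  qed
  then obtain k where k: "k > 0" "k mod r = j mod r" "\<And>p. Factorial_Ring.prime p \<Longrightarrow> p dvd k \<Longrightarrow> p > order G"
  proof (rule coprime_as_product_of_large_primes[where B = "order G", OF _ r(1)])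
    fix k' assume k': "k' > 0" "k' mod r = j mod r" "\<And>p. Factorial_Ring.prime p \<Longrightarrow> p dvd k' \<Longrightarrow> p > order G"
    show thesis by (rule that[OF k'])
  qed
  have "coprime k (order G)"
  proof (rule ccontr)
    assume "\<not> coprime k (order G)"
    then obtain p where "Factorial_Ring.prime p" "p dvd gcd k (order G)"
      using prime_factor_nat[of "gcd k (order G)"] unfolding coprime_iff_gcd_eq_1 by blast
    then have p: "Factorial_Ring.prime p" "p dvd k" "p dvd order G" by simp_all
    then show False using k(3)[of p] dvd_imp_le[OF p(3)] order_pos by simp
  qed
  then have "k mod order G \<in> units_mod" using order_pos by (simp add: units_mod_def)
  moreover have "P (k mod order G) = P j"
  proof -
    have red: "\<theta> h ^ i = \<theta> h ^ (i mod r)" if "h \<in> H" for h i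
    proof -
      have "\<theta> h ^ i = \<theta> h ^ (r * (i div r) + i mod r)" by simp
      also have "\<dots> = \<theta> h ^ (i mod r)" unfolding power_add power_mult using r(2)[OF that] by simp
      finally show ?thesis .
    qed
    have "\<theta> h ^ k = \<theta> h ^ j" if "h \<in> H" for h using red[OF that, of k] red[OF that, of j] k(2) by simp
    then have "P k = P j" by (simp add: P_eq_iff)
    then show ?thesis by (simp add: P_mod)
  qed
  ultimately show ?thesis using that by blast
qed

lemma units_faithful: "units_mod \<subseteq> faithful_powers"
proof
  fix k assume k: "k \<in> units_mod"
  have "\<theta> h = 1" if "h \<in> H" "\<theta> h ^ k = 1" for h
    using theta_pow_inj[OF k that(1), of \<one>] that(2) by simp
  then show "k \<in> faithful_powers" using k by (simp add: faithful_powers_def units_mod_def)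
qed

text \<open>\<open>eps\<close> is the sum of the distinct Galois conjugates of
  \<open>ee H \<theta>\<close>. Writing \<open>hat K\<close> as a multiple of the sum of all
  \<open>P j\<close> and multiplying by \<open>eps\<close> retains the faithful powers, and these
  are the unit powers.\<close>

lemma eps_tsum: "smul (of_nat (card (stab (ee H \<theta>)))) (emb (eps G H K)) = tsum (ee H \<theta>)"
proof (cases "H = K")
  case True
  have t: "\<theta> = (\<lambda>x. if x \<in> H then 1 else 0)"
  proof
    fix x
    show "\<theta> x = (if x \<in> H then 1 else 0)" 
    proof (cases "x \<in> H")
      case xH: True
      then have "x \<in> K" using True by blast
      then show ?thesis using xH by (simp add: K_eq)
    qed (simp add: theta_out)
  qed
  have "eps G H K = hat H" unfolding eps_def True[symmetric] by simp
  then have e: "emb (eps G H K) = ee H \<theta>" using emb_hat[OF H] by (simp only: t[symmetric])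
  have "pw k (ee H \<theta>) = ee H \<theta>" if "k \<in> units_mod" for k
  proof -
    have "\<theta> x = 1" if "x \<in> H" for x using fun_cong[OF t, of x] that by simp
    then have "P k = P 1" unfolding P_eq_iff by simp
    moreover have "th 1 = \<theta>" using theta_out by (auto simp: th_def fun_eq_iff)
    ultimately show ?thesis using P_unit[OF that] by simp
  qed
  then have st: "stab (ee H \<theta>) = units_mod" "tsum (ee H \<theta>) = (\<Sum>k\<in>units_mod. ee H \<theta>)"
    unfolding stab_def tsum_def by (blast, intro sum.cong refl)
  show ?thesis unfolding e st by (rule sum_const_fun[symmetric])
next
  case False
  let ?e = "ee H \<theta>"
  define c where "c = card {i \<in> {..<order G}. P i = P 0}"
  define S where "S = P ` faithful_powers"
  have S: "S = (\<lambda>k. pw k ?e) ` units_mod"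
  proof -
    have "S = P ` units_mod"
    proof
      show "S \<subseteq> P ` units_mod"
      proof
        fix y assume "y \<in> S"
        then obtain j where j: "j \<in> faithful_powers" "y = P j" unfolding S_def by blast
        obtain k where "k \<in> units_mod" "P k = P j" using faithful_power_unit[OF j(1)] .
        then show "y \<in> P ` units_mod" using j(2) by (intro image_eqI[of _ _ k]) auto
      qed
      show "P ` units_mod \<subseteq> S" unfolding S_def using units_faithful by blast
    qed
    then show ?thesis using P_unit by (simp cong: image_cong)
  qed
  have 1: "(\<Sum>j\<in>faithful_powers. P j) = smul (of_nat c) (\<Sum>S)"
    unfolding S_def
  proof (rule sum_over_fibres)
    show "finite faithful_powers" by (simp add: faithful_powers_def)
    fix y assume "y \<in> P ` faithful_powers"
    then obtain j where j: "j \<in> faithful_powers" "y = P j" by blast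
    have "{i \<in> faithful_powers. P i = y} = {i \<in> {..<order G}. P i = P j}"
      using j by (auto simp: faithful_powers_def P_eq_iff)
    then show "card {i \<in> faithful_powers. P i = y} = c"
      using P_fibre[of j] j by (simp add: c_def faithful_powers_def)
  qed
  have 2: "tsum ?e = smul (of_nat (card (stab ?e))) (\<Sum>S)"
    unfolding tsum_def S
  proof (rule sum_over_fibres[OF units_mod_finite])
    fix y assume "y \<in> (\<lambda>k. pw k ?e) ` units_mod"
    then show "card {k \<in> units_mod. pw k ?e = y} = card (stab ?e)"
      using card_pw_fibre[OF _ ee_supp_carrier] by (auto simp: stab_def)
  qed
  \<comment> \<open>The reciprocal of the scalar in \<open>sum_P\<close>.\<close>
  define d where "d = of_nat (card H) / (of_nat (order G) * of_nat (card K) :: complex)"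
  have cK: "card K \<noteq> 0" using subgroup_card_pos[OF K_subgroup] by simp
  have hatK: "emb (hat K) = smul d (\<Sum>j\<in>{..<order G}. P j)"
    unfolding sum_P using cK card_H order_pos by (simp add: d_def)
  have "emb (eps G H K) = smul d (\<Sum>j\<in>{..<order G}. cv (P j) (emb (eps G H K)))"
    using hat_K_eps[OF False] unfolding hatK by (simp add: cv_sum_left)
  also have "(\<Sum>j\<in>{..<order G}. cv (P j) (emb (eps G H K))) = (\<Sum>j\<in>{..<order G}. if j \<in> faithful_powers then P j else 0)"
    using P_eps[OF False] by (intro sum.cong) auto
  also have "\<dots> = (\<Sum>j\<in>faithful_powers. P j)"
    by (intro sum.mono_neutral_cong_right) (auto simp: faithful_powers_def)
  finally have eps: "emb (eps G H K) = smul (d * of_nat c) (\<Sum>S)" unfolding 1 smul_smul .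
  interpret self: shoda G H \<theta> H by (rule shoda_self)
  have cs: "card (stab ?e) \<noteq> 0" using card_stab_pos[OF ee_supp_carrier] by simp
  have "smul (of_nat (card (stab ?e))) (cv ?e (\<Sum>S)) = smul (of_nat (card (stab ?e))) ?e"
    using self.EE_cv_tsum by (simp add: EE_self 2)
  then have eS: "cv ?e (\<Sum>S) = ?e" using cs by (auto simp: fun_eq_iff)
  have "cv ?e (emb (eps G H K)) = ?e"
  proof -
    have one: "1 mod order G \<in> units_mod" by (rule units_mod_one)
    have "P (1 mod order G) = ?e"
      unfolding P_unit[OF one] pw_mod using pw_1[OF ee_supp_carrier] by simp
    then show ?thesis
      using P_eps[OF False, of "1 mod order G"] one units_faithful order_pos by auto
  qed
  then have "smul (d * of_nat c) ?e = smul 1 ?e" unfolding eps by (simp add: eS)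
  \<comment> \<open>The constant is not counted but read off: both \<open>eps\<close> and the sum
    over \<open>S\<close> fix \<open>?e\<close>.\<close>
  then have "d * of_nat c = 1" using ee_nz by (simp only: smul_cancel_iff) simp
  then show ?thesis by (simp add: eps 2)
qed

end

section \<open>Primitive central idempotents of the rational group algebra\<close>

lemma smul_left_cancel: "c \<noteq> 0 \<Longrightarrow> smul c a = smul c b \<longleftrightarrow> a = b"
  by (auto simp: fun_eq_iff)

context fin_group begin

lemma orbit_sum:
  assumes M: "subgroup M G" and a: "supp_on (carrier G) a"
  shows "(\<Sum>g\<in>M. cj g a) = smul (of_nat (card {g \<in> M. cj g a = a})) (\<Sum>((\<lambda>g. cj g a) ` M))"
  using card_cj_fibre[OF M a] by (intro sum_over_fibres subgroup_finite M) auto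

lemma tsum_smul: "tsum (smul c a) = smul c (tsum a)"
  unfolding tsum_def pw_smul smul_sum ..

lemma tsum_sum: "tsum (\<Sum>i\<in>I. f i) = (\<Sum>i\<in>I. tsum (f i))"
  unfolding tsum_def pw_sum by (rule sum.swap)

text \<open>Commuting with the basis element \<open>u\<close>, written \<open>d\<close> below,
  amounts to invariance under conjugation by \<open>u\<close>, by comparing coefficients at
  \<open>x \<otimes> u\<close>.\<close>

lemma central_idem_inv_on:
  assumes "central_idem G f"
  shows "inv_on (carrier G) (emb f)"
  unfolding inv_on_def
proof
  show s: "supp_on (carrier G) (emb f)"
    using assms by (simp add: central_idem_def qg_elem_def supp_on_def emb_def)
  show "\<forall>u\<in>carrier G. cj u (emb f) = emb f"
  proof
    fix u assume u: "u \<in> carrier G"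
    define d :: "'a \<Rightarrow> rat" where "d = (\<lambda>x. if x = u then 1 else 0)"
    have "qg_elem G d" using u by (auto simp: qg_elem_def d_def)
    then have comm: "conv G f d = conv G d f" using assms unfolding central_idem_def by blast
    have "f (inv u \<otimes> x \<otimes> u) = f x" if x: "x \<in> carrier G" for x
    proof -
      have "conv G f d (x \<otimes> u) = (\<Sum>y\<in>carrier G. if y = x then f y else 0)"
      proof -
        have "f y * d (inv y \<otimes> (x \<otimes> u)) = (if y = x then f y else 0)" if y: "y \<in> carrier G" for y
        proof -
          have "inv y \<otimes> (x \<otimes> u) = u \<longleftrightarrow> x \<otimes> u = y \<otimes> u"
            using inv_solve_left'[of u y "x \<otimes> u"] x y u by auto
          also have "\<dots> \<longleftrightarrow> y = x" using x y u by auto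
          finally have *: "inv y \<otimes> (x \<otimes> u) = u \<longleftrightarrow> y = x" .
          show ?thesis unfolding d_def * by simp
        qed
        then show ?thesis unfolding conv_def using x u by simp
      qed
      also have "\<dots> = f x" using x fin by simp
      finally have 1: "conv G f d (x \<otimes> u) = f x" .
      have "conv G d f (x \<otimes> u) = (\<Sum>y\<in>carrier G. if y = u then f (inv u \<otimes> (x \<otimes> u)) else 0)"
      proof -
        have "d y * f (inv y \<otimes> (x \<otimes> u)) = (if y = u then f (inv u \<otimes> (x \<otimes> u)) else 0)" for y
          by (simp add: d_def)
        then show ?thesis unfolding conv_def using x u by simp
      qed
      also have "\<dots> = f (inv u \<otimes> x \<otimes> u)" using u x fin by (simp add: m_assoc)
      finally show ?thesis using 1 comm by simp
    qed
    then show "cj u (emb f) = emb f"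
      using s by (auto simp: fun_eq_iff cj_def emb_def supp_on_def)
  qed
qed

end

context lin_sub begin

lemma card_stab_ee: "card (stab (ee H \<theta>)) > 0"
  by (rule card_stab_pos[OF ee_supp_carrier])

lemma Cen_eps: "Cen G S (eps G H K) = {x \<in> S. cj x (tsum (ee H \<theta>)) = tsum (ee H \<theta>)}"
proof -
  have "qg_conj G g (eps G H K) = eps G H K \<longleftrightarrow> cj g (tsum (ee H \<theta>)) = tsum (ee H \<theta>)" for g
    unfolding emb_inj[symmetric] emb_qg_conj eps_tsum[symmetric] cj_smul
    using card_stab_ee by (intro smul_left_cancel[symmetric]) simp
  then show ?thesis by (simp add: Cen_def)
qed

lemma eps_supp: "supp_on (carrier G) (emb (eps G H K))"
proof -
  have "emb (eps G H K) = smul (1 / of_nat (card (stab (ee H \<theta>)))) (tsum (ee H \<theta>))"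
    unfolding eps_tsum[symmetric] smul_smul using card_stab_ee by simp
  then show ?thesis using supp_on_smul[OF tsum_supp] by simp
qed

end

section \<open>The sum of conjugates e(M, H, K) and its centralizer\<close>

context shoda begin

abbreviation (input) F where "F \<equiv> EE M H \<theta>"

text \<open>Three normalizations meet: the centralizer order turns the sum of distinct conjugates
  into a sum over \<open>M\<close>, the stabilizer order turns \<open>eps\<close> into
  \<open>tsum\<close>, and |H| is the denominator in \<open>EE\<close>.\<close>

lemma emb_e_sum:
  "smul (of_nat (card (Cen G M (eps G H K)) * card (stab (ee H \<theta>)))) (emb (e_sum G M H K)) =
    smul (of_nat (card H)) (tsum (EE M H \<theta>))"
proof -
  let ?a = "emb (eps G H K)" and ?s = "of_nat (card (stab (ee H \<theta>))) :: complex"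
  let ?S = "(\<lambda>g. qg_conj G g (eps G H K)) ` M"
  have "emb (e_sum G M H K) = (\<Sum>y\<in>?S. emb y)" unfolding e_sum_def by (rule emb_sum)
  also have "\<dots> = \<Sum>(emb ` ?S)"
    by (subst sum.reindex) (auto simp: inj_on_def emb_inj)
  also have "emb ` ?S = (\<lambda>g. cj g ?a) ` M" by (simp add: image_image emb_qg_conj)
  finally have e: "emb (e_sum G M H K) = \<Sum>((\<lambda>g. cj g ?a) ` M)" .
  have C: "Cen G M (eps G H K) = {g \<in> M. cj g ?a = ?a}"
    by (simp add: Cen_def emb_qg_conj flip: emb_inj)
  have "smul (of_nat (card (Cen G M (eps G H K)))) (emb (e_sum G M H K)) = (\<Sum>g\<in>M. cj g ?a)"
    unfolding e C by (rule orbit_sum[OF M eps_supp, symmetric])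
  then have "smul ?s (smul (of_nat (card (Cen G M (eps G H K)))) (emb (e_sum G M H K))) = 
     (\<Sum>g\<in>M. cj g (smul ?s ?a))"
    by (simp only: smul_sum cj_smul)
  also have "\<dots> = (\<Sum>g\<in>M. tsum (cj g (ee H \<theta>)))"
    unfolding eps_tsum using M_carrier by (intro sum.cong refl) (simp add: tsum_cj)
  also have "\<dots> = tsum (\<Sum>g\<in>M. cj g (ee H \<theta>))" by (rule tsum_sum[symmetric])
  also have "(\<Sum>g\<in>M. cj g (ee H \<theta>)) = smul (of_nat (card H)) (EE M H \<theta>)"
    unfolding EE_def smul_smul using card_H by simp
  finally show ?thesis unfolding tsum_smul smul_smul by (simp only: of_nat_mult mult.commute)
qed

lemma Cen_eps_pos: "card (Cen G M (eps G H K)) > 0"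
proof -
  have "\<one> \<in> Cen G M (eps G H K)" unfolding Cen_eps using cj_one[OF tsum_supp] by simp
  moreover have "finite (Cen G M (eps G H K))" using subgroup_finite[OF M] by (simp add: Cen_def)
  ultimately show ?thesis using card_gt_0_iff by blast
qed

lemma Cen_e_sum: "Cen G S (e_sum G M H K) = {x \<in> S. cj x (tsum F) = tsum F}"
proof -
  let ?c = "of_nat (card (Cen G M (eps G H K)) * card (stab (ee H \<theta>))) :: complex"
    and ?h = "of_nat (card H) :: complex"
  have c: "?c \<noteq> 0" using Cen_eps_pos card_stab_ee by simp
  have h: "?h \<noteq> 0" using card_H by simp
  have "qg_conj G g (e_sum G M H K) = e_sum G M H K \<longleftrightarrow> cj g (tsum F) = tsum F" for g
  proof -
    have "qg_conj G g (e_sum G M H K) = e_sum G M H K \<longleftrightarrow> cj g (emb (e_sum G M H K)) = emb (e_sum G M H K)"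
      unfolding emb_inj[symmetric] emb_qg_conj ..
    also have "\<dots> \<longleftrightarrow> smul ?c (cj g (emb (e_sum G M H K))) = smul ?c (emb (e_sum G M H K))"
      by (rule smul_left_cancel[OF c, symmetric])
    also have "\<dots> \<longleftrightarrow> smul ?h (cj g (tsum F)) = smul ?h (tsum F)"
      unfolding cj_smul[symmetric] emb_e_sum ..
    also have "\<dots> \<longleftrightarrow> cj g (tsum F) = tsum F" by (rule smul_left_cancel[OF h])
    finally show ?thesis .
  qed
  then show ?thesis by (simp add: Cen_def)
qed

lemma pw_F_tsum:
  assumes "k \<in> units_mod"
  shows "cv (pw k F) (tsum F) = smul (of_nat (card (stab F))) (pw k F)"
proof -
  have "cv (pw k F) (pw j F) = (if pw j F = pw k F then pw k F else 0)" if j: "j \<in> units_mod" for j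
  proof (cases "pw j F = pw k F")
    case True
    then show ?thesis using pw_EE_prim[OF assms] by (simp add: prim_on_def)
  next
    case False
    then have "cv (pw k F) (pw j F) = 0"
      using prim_on_eq[OF M pw_EE_prim[OF assms] pw_EE_prim[OF j]] by metis
    then show ?thesis using False by simp
  qed
  then have "cv (pw k F) (tsum F) = (\<Sum>j\<in>units_mod. if pw j F = pw k F then pw k F else 0)"
    unfolding tsum_def cv_sum_right by (intro sum.cong refl)
  also have "\<dots> = (\<Sum>j\<in>{j \<in> units_mod. pw j F = pw k F}. pw k F)"
    using units_mod_finite by (intro sum.mono_neutral_cong_right) auto
  also have "\<dots> = smul (of_nat (card {j \<in> units_mod. pw j F = pw k F})) (pw k F)" by (rule sum_const_fun)
  also have "card {j \<in> units_mod. pw j F = pw k F} = card (stab F)"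
    unfolding stab_def by (rule card_pw_fibre[OF assms EE_supp_carrier])
  finally show ?thesis .
qed

end

section \<open>Primitivity over the rationals and the value of alpha\<close>

locale shoda_full = shoda G H \<theta> "carrier G" for G (structure) and H \<theta>
begin

text \<open>The sum of the distinct Galois conjugates of \<open>F\<close>, each of which occurs
  \<open>card (stab F)\<close> times in \<open>tsum F\<close>. The factor \<open>alpha0\<close>
  below is what \<open>emb_e_sum\<close> puts between it and e(G, H, K).\<close>

definition QQ where "QQ = smul (1 / of_nat (card (stab F))) (tsum F)"

lemma card_stab_F: "card (stab F) > 0"
  by (rule card_stab_pos[OF EE_supp_carrier])

lemma QQ_inv_on: "inv_on (carrier G) QQ"
proof -
  have "cj u (tsum F) = tsum F" if u: "u \<in> carrier G" for u
    unfolding tsum_cj[OF u, symmetric] using EE_conj[OF u] by simp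
  then show ?thesis using supp_on_smul[OF tsum_supp] by (simp add: inv_on_def QQ_def)
qed

lemma pw_F_QQ: "k \<in> units_mod \<Longrightarrow> cv (pw k F) QQ = pw k F"
  unfolding QQ_def cv_smul_right using pw_F_tsum card_stab_F by simp

lemma F_QQ: "cv F QQ = F"
  using pw_F_QQ[OF units_mod_one] unfolding pw_mod pw_1[OF EE_supp_carrier] .

lemma QQ_nz: "QQ \<noteq> 0"
  using F_QQ EE_nz by auto

lemma QQ_idem: "cv QQ QQ = QQ"
proof -
  have "cv (tsum F) QQ = (\<Sum>k\<in>units_mod. pw k F)"
    unfolding tsum_def cv_sum_left by (intro sum.cong refl pw_F_QQ)
  then show ?thesis by (simp add: QQ_def tsum_def)
qed

definition alpha0 :: rat where
  "alpha0 = of_nat (card (Cen G (carrier G) (eps G H K)) * card (stab (ee H \<theta>))) / of_nat (card H * card (stab F))"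

lemma alpha0_nz: "alpha0 \<noteq> 0"
  using Cen_eps_pos card_stab_ee card_H card_stab_F by (simp add: alpha0_def)

lemma emb_alpha0: "emb (\<lambda>x. alpha0 * e_sum G (carrier G) H K x) = QQ"
proof -
  have nz: "of_nat (card H) \<noteq> (0::complex)" "of_nat (card (stab F)) \<noteq> (0::complex)"
    using card_H card_stab_F by auto
  have "of_rat alpha0 = (1 / (of_nat (card H) * of_nat (card (stab F)))) *
     (of_nat (card (Cen G (carrier G) (eps G H K)) * card (stab (ee H \<theta>))) :: complex)"
    by (simp add: alpha0_def of_rat_divide of_rat_mult)
  then have "emb (\<lambda>x. alpha0 * e_sum G (carrier G) H K x) =
     smul (1 / (of_nat (card H) * of_nat (card (stab F)))) (smul (of_nat (card H)) (tsum F))"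
    unfolding emb_smul emb_e_sum[symmetric] smul_smul by (simp only:)
  also have "\<dots> = QQ" unfolding QQ_def smul_smul using nz by simp
  finally show ?thesis .
qed

lemma central_idem_iff: "central_idem G f \<longleftrightarrow> inv_on (carrier G) (emb f) \<and> cv (emb f) (emb f) = emb f"
proof
  assume f: "central_idem G f"
  then have "emb (conv G f f) = emb f" by (simp add: central_idem_def)
  then show "inv_on (carrier G) (emb f) \<and> cv (emb f) (emb f) = emb f"
    using central_idem_inv_on[OF f] by (simp add: emb_conv)
next
  assume f: "inv_on (carrier G) (emb f) \<and> cv (emb f) (emb f) = emb f"
  have "qg_elem G f" using f by (simp add: inv_on_def supp_on_def qg_elem_def emb_def)
  moreover have "conv G f f = f" using f unfolding emb_conv[symmetric] emb_inj by blast
  moreover have "conv G f a = conv G a f" if a: "qg_elem G a" for a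
  proof -
    have "supp_on (carrier G) (emb a)" using a by (simp add: supp_on_def qg_elem_def emb_def)
    then have "cv (emb f) (emb a) = cv (emb a) (emb f)" using inv_on_commute[OF M] f by blast
    then show ?thesis unfolding emb_conv[symmetric] emb_inj .
  qed
  ultimately show "central_idem G f" unfolding central_idem_def by blast
qed

text \<open>A rational central idempotent acts by the same scalar on all Galois conjugates of \<open>F\<close>.\<close>

lemma central_idem_QQ:
  assumes f: "central_idem G f"
  shows "cv (emb f) QQ = 0 \<or> cv (emb f) QQ = QQ"
proof -
  have fi: "inv_on (carrier G) (emb f)" "cv (emb f) (emb f) = emb f" using f by (auto simp: central_idem_iff)
  define s where "s = (\<lambda>k. \<Sum>h\<in>H. emb f h * \<theta> h ^ k)"
  have act: "cv (emb f) (pw k F) = smul (s k) (pw k F)" if k: "k \<in> units_mod" for k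
  proof -
    interpret T: shoda G H "pw k \<theta>" "carrier G" by (rule shoda_pw_sub[OF k])
    have "(\<Sum>h\<in>H. emb f h * pw k \<theta> h) = s k" unfolding s_def by (intro sum.cong refl) (simp add: pw_theta)
    then show ?thesis
      using T.cv_EE_of_ee[OF fi(1) T.central_cv_ee[OF fi(1)]] pw_EE_M[OF k] by simp
  qed
  define k1 where "k1 = 1 mod order G"
  have k1: "k1 \<in> units_mod" "pw k1 F = F"
    unfolding k1_def pw_mod by (rule units_mod_one, rule pw_1[OF EE_supp_carrier])
  have s1: "s k1 = s 1" unfolding s_def k1_def by (intro sum.cong refl) (simp only: theta_pow_mod)
  have "smul (s k1 * s k1) F = cv (emb f) (cv (emb f) F)"
    using act[OF k1(1)] k1(2) by simp
  also have "\<dots> = cv (emb f) F" using fi(2) by (simp flip: cv_assoc)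
  also have "\<dots> = smul (s k1) F" using act[OF k1(1)] k1(2) by simp
  finally have "s 1 * s 1 = s 1" using EE_nz by (simp add: smul_cancel_iff s1)
  then have "s 1 = 0 \<or> s 1 = 1" by auto
  then obtain c :: rat where c: "c = 0 \<or> c = 1" "s 1 = of_rat c" by (metis of_rat_0 of_rat_1)
  have sk: "s k = of_rat c" if k: "k \<in> units_mod" for k
  proof -
    \<comment> \<open>Subtracting \<open>c\<close> from the coefficient at the identity turns
      \<open>s 1 = of_rat c\<close> into a rational relation with right-hand side zero.\<close>
    define g where "g = (\<lambda>h. f h - (if h = \<one> then c else 0))"
    have sum: "(\<Sum>h\<in>H. of_rat (g h) * \<theta> h ^ j) = s j - of_rat c" for j
    proof -
      have "(\<Sum>h\<in>H. of_rat (g h) * \<theta> h ^ j) = (\<Sum>h\<in>H. emb f h * \<theta> h ^ j - (if h = \<one> then of_rat c else 0))"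
        by (intro sum.cong refl) (auto simp: g_def emb_def of_rat_diff algebra_simps)
      then show ?thesis by (simp add: sum_subtractf s_def finite_H)
    qed
    have "(\<Sum>h\<in>H. of_rat (g h) * \<theta> h ^ k) = 0"
    proof (rule rational_relation_power[OF finite_H order_pos])
      show "coprime k (order G)" using k by (simp add: units_mod_def)
      show "(\<Sum>h\<in>H. of_rat (g h) * \<theta> h) = 0" using sum[of 1] c(2) by simp
    qed (rule theta_root)
    then show ?thesis using sum[of k] by simp
  qed
  have "cv (emb f) (tsum F) = smul (of_rat c) (tsum F)"
    unfolding tsum_def cv_sum_right smul_sum using act sk by (intro sum.cong refl) simp
  then have "cv (emb f) QQ = smul (of_rat c) QQ" unfolding QQ_def cv_smul_right by (simp add: mult.commute)
  then show ?thesis using c(1) by auto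
qed

lemma prim_alpha0: "prim_central_idem G (\<lambda>x. alpha0 * e_sum G (carrier G) H K x)"
proof -
  define e where "e = (\<lambda>x. alpha0 * e_sum G (carrier G) H K x)"
  have emb_e: "emb e = QQ" unfolding e_def by (rule emb_alpha0)
  have "central_idem G e" using QQ_inv_on QQ_idem by (simp add: central_idem_iff emb_e)
  moreover have "e \<noteq> 0" using emb_e QQ_nz emb_0 by metis
  moreover have False if f: "central_idem G f1" "central_idem G f2" "f1 \<noteq> 0" "f2 \<noteq> 0" "conv G f1 f2 = 0" "e = f1 + f2" for f1 f2
  proof -
    have Q: "QQ = emb f1 + emb f2" using f(6) emb_e by (simp add: emb_add)
    have "cv (emb f1) (emb f2) = 0" using f(5) by (simp flip: emb_conv)
    moreover have "cv (emb f1) QQ = cv (emb f1) (emb f1) + cv (emb f1) (emb f2)"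
      unfolding Q by (auto simp: fun_eq_iff cv_def algebra_simps sum.distrib)
    ultimately have "cv (emb f1) QQ = emb f1" using f(1) by (simp add: central_idem_iff)
    then have "emb f1 = 0 \<or> emb f1 = QQ" using central_idem_QQ[OF f(1)] by simp
    then show False
    proof
      assume "emb f1 = 0"
      then show False using f(3) by simp
    next
      assume "emb f1 = QQ"
      then have "emb f2 = 0" using Q by simp
      then show False using f(4) by simp
    qed
  qed
  ultimately show ?thesis unfolding prim_central_idem_def e_def[symmetric] by blast
qed

text \<open>Any other admissible coefficient is \<open>t * alpha0\<close>; idempotence leaves 0 and
  1 for \<open>t\<close>, and 0 is excluded because the idempotent is nonzero.\<close>

lemma alpha_eq: "alpha G H K = alpha0"
  unfolding alpha_def
proof (rule the_equality, rule prim_alpha0)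
  fix a assume a: "prim_central_idem G (\<lambda>x. a * e_sum G (carrier G) H K x)"
  define t where "t = a / alpha0"
  have "(\<lambda>x. a * e_sum G (carrier G) H K x) = (\<lambda>x. t * (alpha0 * e_sum G (carrier G) H K x))"
    using alpha0_nz by (simp add: t_def)
  then have emb: "emb (\<lambda>x. a * e_sum G (carrier G) H K x) = smul (of_rat t) QQ"
    unfolding emb_alpha0[symmetric] emb_smul[symmetric] by simp
  have ci: "central_idem G (\<lambda>x. a * e_sum G (carrier G) H K x)" and
    nz: "(\<lambda>x. a * e_sum G (carrier G) H K x) \<noteq> 0"
    using a by (auto simp: prim_central_idem_def)
  have "cv (smul (of_rat t) QQ) (smul (of_rat t) QQ) = smul (of_rat t) QQ"
    using ci unfolding central_idem_iff emb by blast
  then have "smul (of_rat t * of_rat t) QQ = smul (of_rat t) QQ" by (simp add: QQ_idem)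
  then have "of_rat t * of_rat t = (of_rat t :: complex)" using QQ_nz by (simp add: smul_cancel_iff)
  then have "(of_rat t :: complex) = 0 \<or> (of_rat t :: complex) = 1" by auto
  moreover have "t \<noteq> 0"
  proof
    assume "t = 0"
    then have "emb (\<lambda>x. a * e_sum G (carrier G) H K x) = 0" unfolding emb by simp
    then show False using nz emb_eq_0_iff by blast
  qed
  ultimately have "t = 1" by simp
  then show "a = alpha0" using alpha0_nz by (simp add: t_def)
qed

end

section \<open>Good leaves\<close>

text \<open>On roots of unity the automorphism is determined by the image \<open>w ^ k\<close> of a
  primitive root \<open>w\<close>. If \<open>d = gcd k m\<close> exceeded 1, then
  \<open>w ^ (m div d)\<close> would be a root other than 1 sent to 1, against injectivity.\<close>

lemma fld_aut_root_power:
  assumes \<sigma>: "fld_aut \<sigma>" and m: "m > 0"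
  obtains k where "k < m" "coprime k m" "\<And>z. z ^ m = 1 \<Longrightarrow> \<sigma> z = z ^ k"
proof -
  have inj: "inj \<sigma>" and mult: "\<And>x y. \<sigma> (x * y) = \<sigma> x * \<sigma> y" and one: "\<sigma> 1 = 1"
    using \<sigma> by (auto simp: fld_aut_def bij_def)
  have pow: "\<sigma> (z ^ j) = \<sigma> z ^ j" for z j by (induction j) (simp_all add: mult one)
  define w where "w = cis (2 * pi / m)"
  have wpow: "w ^ a = cis (2 * pi * real a / real m)" for a
    by (simp add: w_def Complex.DeMoivre mult_ac)
  have wm: "w ^ m = 1" using m by (simp add: wpow)
  have roots: "\<exists>a<m. z = w ^ a" if z: "z ^ m = 1" for z
  proof -
    have "z \<in> (\<lambda>k. cis (2 * pi * real k / real m)) ` {..<m}"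
      using bij_betw_imp_surj_on[OF bij_betw_roots_unity[OF m]] z by blast
    then show ?thesis unfolding wpow by blast
  qed
  have inj_w: "inj_on (\<lambda>a. w ^ a) {..<m}"
    unfolding wpow using bij_betw_roots_unity[OF m] by (simp add: bij_betw_def)
  have "\<sigma> w ^ m = 1" unfolding pow[symmetric] wm one ..
  then obtain k where k: "k < m" "\<sigma> w = w ^ k" using roots by blast
  have all: "\<sigma> z = z ^ k" if z: "z ^ m = 1" for z
  proof -
    obtain a where a: "z = w ^ a" using roots[OF z] by blast
    show ?thesis unfolding a pow k(2) power_mult[symmetric] by (simp add: mult.commute)
  qed
  have "coprime k m"
  proof (rule ccontr)
    assume "\<not> coprime k m"
    define d where "d = gcd k m"
    have "d \<noteq> 1" using \<open>\<not> coprime k m\<close> unfolding d_def coprime_iff_gcd_eq_1 .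
    moreover have "d \<noteq> 0" using m by (simp add: d_def)
    ultimately have g: "d > 1" by simp
    obtain s where s: "m = d * s" using gcd_dvd2[of k m] unfolding d_def[symmetric] by (rule dvdE)
    obtain t where t: "k = d * t" using gcd_dvd1[of k m] unfolding d_def[symmetric] by (rule dvdE)
    have "s > 0" using s m by (cases s) auto
    then have s_less: "s < m" "s > 0" using g s by auto
    have "s * k = m * t" unfolding s t by (simp only: mult_ac)
    have "(w ^ s) ^ m = 1" unfolding power_mult[symmetric] by (simp add: mult.commute[of s] power_mult wm)
    then have "\<sigma> (w ^ s) = (w ^ s) ^ k" by (rule all)
    also have "\<dots> = w ^ (m * t)" unfolding power_mult[symmetric] \<open>s * k = m * t\<close> ..
    also have "\<dots> = \<sigma> 1" by (simp add: power_mult wm one)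
    finally have "w ^ s = 1" using inj by (simp add: inj_def)
    then have "w ^ s = w ^ 0" by simp
    then show False using inj_onD[OF inj_w, of s 0] s_less m by simp
  qed
  then show ?thesis using that k(1) all by blast
qed

context fin_group begin

text \<open>The fibres of multiplication on \<open>D \<times> M\<close> are in bijection with
  \<open>D \<inter> M\<close>. The product set need not be a subgroup; it is compared with a
  centralizer by inclusion and order only.\<close>

lemma card_setmult:
  assumes D: "subgroup D G" and M: "subgroup M G"
  shows "card (D <#> M) * card (D \<inter> M) = card D * card M"
proof -
  have DG: "x \<in> carrier G" if "x \<in> D" for x using that D subgroup.mem_carrier by metis
  have MG: "x \<in> carrier G" if "x \<in> M" for x using that M subgroup.mem_carrier by metis
  have fins: "finite D" "finite M" using subgroup_finite D M by auto
  define f where "f = (\<lambda>(d, m). d \<otimes> m)"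
  have img: "f ` (D \<times> M) = D <#> M" by (auto simp: f_def set_mult_def)
  have fib: "card {p \<in> D \<times> M. f p = y} = card (D \<inter> M)" if y: "y \<in> f ` (D \<times> M)" for y
  proof -
    obtain d0 m0 where dm: "d0 \<in> D" "m0 \<in> M" "y = d0 \<otimes> m0" using y by (auto simp: f_def)
    have "{p \<in> D \<times> M. f p = y} = (\<lambda>u. (d0 \<otimes> u, inv u \<otimes> m0)) ` (D \<inter> M)"
    proof (intro equalityI subsetI)
      fix p assume "p \<in> {p \<in> D \<times> M. f p = y}"
      then obtain d m where p: "p = (d, m)" "d \<in> D" "m \<in> M" "d \<otimes> m = d0 \<otimes> m0"
        using dm(3) by (auto simp: f_def)
      define u where "u = inv d0 \<otimes> d"
      have uD: "u \<in> D" using D dm p by (simp add: u_def subgroup.m_closed subgroup.m_inv_closed)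
      have "u \<otimes> m = inv d0 \<otimes> (d \<otimes> m)" using DG MG dm p by (simp add: u_def m_assoc)
      then have um: "u \<otimes> m = m0" unfolding p(4) using DG MG dm by simp
      then have "u = m0 \<otimes> inv m" using DG[OF uD] MG p dm inv_solve_right by metis
      then have uM: "u \<in> M" using M dm p by (simp add: subgroup.m_closed subgroup.m_inv_closed)
      have "d = d0 \<otimes> u" using DG dm p by (simp add: u_def)
      moreover have "m = inv u \<otimes> m0" unfolding um[symmetric] using DG[OF uD] MG[OF p(3)] by simp
      ultimately show "p \<in> (\<lambda>u. (d0 \<otimes> u, inv u \<otimes> m0)) ` (D \<inter> M)" using p(1) uD uM by blast
    next
      fix p assume "p \<in> (\<lambda>u. (d0 \<otimes> u, inv u \<otimes> m0)) ` (D \<inter> M)"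
      then obtain u where u: "u \<in> D" "u \<in> M" "p = (d0 \<otimes> u, inv u \<otimes> m0)" by blast
      have "(d0 \<otimes> u) \<otimes> (inv u \<otimes> m0) = d0 \<otimes> m0" using DG MG dm u by (simp add: m_assoc)
      then show "p \<in> {p \<in> D \<times> M. f p = y}"
        using u dm D M by (simp add: f_def subgroup.m_closed subgroup.m_inv_closed)
    qed
    moreover have "inj_on (\<lambda>u. (d0 \<otimes> u, inv u \<otimes> m0)) (D \<inter> M)"
      using DG dm(1) by (intro inj_onI) auto
    ultimately show ?thesis by (simp add: card_image)
  qed
  have "card (D \<times> M) = (\<Sum>p\<in>D \<times> M. 1)" by simp
  also have "\<dots> = (\<Sum>y\<in>f ` (D \<times> M). \<Sum>p\<in>{p \<in> D \<times> M. f p = y}. 1)"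
    using fins by (intro sum.image_gen) simp
  also have "\<dots> = (\<Sum>y\<in>f ` (D \<times> M). card (D \<inter> M))"
    using fib by (intro sum.cong refl) simp
  finally show ?thesis by (simp add: img card_cartesian_product)
qed

end

section \<open>Induced characters and normalizers of kernels\<close>

context clifford_step begin

lemma setmult_subset: "Dset <#> M' \<subseteq> Cset"
  using Dset_subset_Cset M'_subset_Cset subgroup.m_closed[OF Cset_subgroup]
  unfolding set_mult_def by blast

lemma card_Dset_M': "card (Dset <#> M') * card {x \<in> M'. cj x (tsum e) = tsum e} = card Dset * card M'"
proof -
  have "Dset \<inter> M' = {x \<in> M'. cj x (tsum e) = tsum e}" using M'M by (auto simp: Dset_def)
  then show ?thesis using card_setmult[OF Dset_subgroup M'] by simp
qed

lemma induced_eq: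
  assumes "g \<in> carrier G"
  shows "induced G H M' \<theta> g = (if g \<in> M' then (\<Sum>x\<in>M'. \<theta> (x \<otimes> g \<otimes> inv x)) / of_nat (card H) else 0)"
proof -
  have "(\<Sum>x\<in>M'. if x \<otimes> g \<otimes> inv x \<in> H then \<theta> (x \<otimes> g \<otimes> inv x) else 0) = (\<Sum>x\<in>M'. \<theta> (x \<otimes> g \<otimes> inv x))"
    by (intro sum.cong refl) (simp add: theta_out)
  then show ?thesis by (simp add: induced_def)
qed

lemma sum_conj_out:
  assumes "g \<in> carrier G" "g \<notin> M'" "x \<in> M'"
  shows "\<theta> (x \<otimes> g \<otimes> inv x) = 0"
proof (rule theta_out)
  show "x \<otimes> g \<otimes> inv x \<notin> H"
  proof
    assume "x \<otimes> g \<otimes> inv x \<in> H"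
    then have "inv x \<otimes> (x \<otimes> g \<otimes> inv x) \<otimes> x \<in> M'" using HM' small.conj_closed(2)[OF assms(3)] by blast
    then show False using assms small.M_carrier by simp
  qed
qed

lemma induced_alt:
  assumes "g \<in> carrier G"
  shows "induced G H M' \<theta> g = (\<Sum>x\<in>M'. \<theta> (x \<otimes> g \<otimes> inv x)) / of_nat (card H)"
  using induced_eq[OF assms] sum_conj_out[OF assms] by (cases "g \<in> M'") simp_all

text \<open>The usual formula for the idempotent of an irreducible character: its degree is
  |M'|/|H|, and dividing the degree by |M'| leaves 1/|H|.\<close>

lemma E'_induced:
  assumes g: "g \<in> carrier G"
  shows "E' g = induced G H M' \<theta> (inv g) / of_nat (card H)"
proof -
  have "(\<Sum>x\<in>M'. cj x e g) = (\<Sum>x\<in>M'. \<theta> (inv x \<otimes> inv g \<otimes> x) / of_nat (card H))"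
  proof (rule sum.cong[OF refl])
    fix x assume "x \<in> M'"
    then have x: "x \<in> carrier G" by (rule small.M_carrier)
    then show "cj x e g = \<theta> (inv x \<otimes> inv g \<otimes> x) / of_nat (card H)"
      using g ee_alt[of "inv x \<otimes> g \<otimes> x"] by (simp add: cj_def conj_inv)
  qed
  also have "\<dots> = (\<Sum>x\<in>M'. \<theta> (x \<otimes> inv g \<otimes> inv x) / of_nat (card H))"
    by (rule sum.reindex_bij_witness[of _ "\<lambda>x. inv x" "\<lambda>x. inv x"])
      (use small.M_carrier in auto)
  also have "\<dots> = induced G H M' \<theta> (inv g)"
    using g by (simp add: induced_alt sum_divide_distrib)
  finally show ?thesis by (simp add: EE_def sum_fun_apply)
qed

text \<open>A field automorphism raises |G|-th roots of unity to some unit power \<open>k\<close>.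
  The values of the induced character are sums of such roots divided by |H|, so on them it acts as g
  to g^k, and the hypothesis makes a conjugate of \<open>E'\<close> equal to a Galois
  conjugate.\<close>

lemma good_in_Cset:
  assumes x: "x \<in> M" and \<sigma>: "fld_aut \<sigma>"
    and eq: "char_conj G x (induced G H M' \<theta>) = \<sigma> \<circ> induced G H M' \<theta>"
  shows "x \<in> Cset"
proof -
  have xc: "x \<in> carrier G" using x M_carrier by simp
  have add: "\<And>a b. \<sigma> (a + b) = \<sigma> a + \<sigma> b" and mult: "\<And>a b. \<sigma> (a * b) = \<sigma> a * \<sigma> b" and one: "\<sigma> 1 = 1"
    using \<sigma> by (auto simp: fld_aut_def)
  have zero: "\<sigma> 0 = 0" using add[of 0 0] by simp
  have sum: "\<sigma> (\<Sum>i\<in>S. f i) = (\<Sum>i\<in>S. \<sigma> (f i))" for f and S :: "'a set"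
    by (induction S rule: infinite_finite_induct) (simp_all add: zero add)
  have nat: "\<sigma> (of_nat n) = of_nat n" for n by (induction n) (simp_all add: zero add one)
  have div: "\<sigma> (a / of_nat (card H)) = \<sigma> a / of_nat (card H)" for a
  proof -
    have "\<sigma> (a / of_nat (card H)) * \<sigma> (of_nat (card H)) = \<sigma> a"
      unfolding mult[symmetric] using card_H by simp
    then show ?thesis unfolding nat using card_H by (simp add: field_simps)
  qed
  obtain k where k: "k < order G" "coprime k (order G)" "\<And>z. z ^ order G = 1 \<Longrightarrow> \<sigma> z = z ^ k"
    using fld_aut_root_power[OF \<sigma> order_pos] by blast
  have kU: "k \<in> units_mod" using k by (simp add: units_mod_def)
  have \<sigma>\<theta>: "\<sigma> (\<theta> h) = \<theta> (h [^] k)" if h: "h \<in> carrier G" for h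
  proof (cases "h \<in> H")
    case True
    show ?thesis unfolding theta_pow[OF True] by (rule k(3)[OF theta_root[OF True]])
  next
    case False
    then have "h [^] k \<notin> H" using pow_units_in_H[OF kU h] by simp
    then show ?thesis using False theta_out zero by simp
  qed
  have \<sigma>\<psi>: "\<sigma> (induced G H M' \<theta> g) = induced G H M' \<theta> (g [^] k)" if g: "g \<in> carrier G" for g
  proof -
    have "\<theta> ((y \<otimes> g \<otimes> inv y) [^] k) = \<theta> (y \<otimes> g [^] k \<otimes> inv y)" if "y \<in> M'" for y
      using conj_pow[of "inv y" g k] small.M_carrier[OF that] g by simp
    then show ?thesis
      unfolding induced_alt[OF g] induced_alt[OF nat_pow_closed[OF g]] div sum
      using \<sigma>\<theta> small.M_carrier g by (intro arg_cong[of _ _ "\<lambda>a. a / _"] sum.cong refl) simp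
  qed
  \<comment> \<open>\<open>char_conj G x\<close> substitutes x g x^-1 and is thus conjugation by
    \<open>inv x\<close> in the convention of \<open>cj\<close>; \<open>x\<close> itself follows
    because \<open>Cset\<close> is a subgroup.\<close>
  have "cj (inv x) E' = pw k E'"
  proof
    fix g
    show "cj (inv x) E' g = pw k E' g"
    proof (cases "g \<in> carrier G")
      case True
      have "cj (inv x) E' g = E' (x \<otimes> g \<otimes> inv x)" using True xc by (simp add: cj_def)
      also have "\<dots> = induced G H M' \<theta> (inv (x \<otimes> g \<otimes> inv x)) / of_nat (card H)"
        using True xc by (intro E'_induced) simp
      also have "inv (x \<otimes> g \<otimes> inv x) = x \<otimes> inv g \<otimes> inv x" using conj_inv[of "inv x" g] True xc by simp
      also have "induced G H M' \<theta> (x \<otimes> inv g \<otimes> inv x) = \<sigma> (induced G H M' \<theta> (inv g))"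
        using fun_cong[OF eq, of "inv g"] True by (simp add: char_conj_def)
      also have "\<dots> = induced G H M' \<theta> (inv (g [^] k))"
        using True by (simp add: \<sigma>\<psi> nat_pow_inv)
      also have "\<dots> / of_nat (card H) = E' (g [^] k)" using True by (intro E'_induced[symmetric]) simp
      finally show ?thesis using True by (simp add: pw_def)
    qed (simp add: cj_def pw_def)
  qed
  then have "inv x \<in> Cset" unfolding Cset_iff using x kU by auto
  then have "inv (inv x) \<in> Cset" using subgroup.m_inv_closed[OF Cset_subgroup] by blast
  then show ?thesis using xc by simp
qed

lemma Cset_subset_nrm: "Cset \<subseteq> nrm G M {a \<in> A. \<theta> a = 1}"
proof
  fix x assume x: "x \<in> Cset"
  then have xM: "x \<in> M" "x \<in> carrier G" using M_carrier by (auto simp: Cset_def)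
  have xi: "inv x \<in> Cset" using x subgroup.m_inv_closed[OF Cset_subgroup] by blast
  let ?K = "{a \<in> A. \<theta> a = 1}"
  have "x <# ?K #> inv x = (\<lambda>a. x \<otimes> a \<otimes> inv x) ` ?K"
    by (auto simp: l_coset_def r_coset_def)
  also have "\<dots> = ?K"
  proof (intro equalityI subsetI)
    fix b assume "b \<in> (\<lambda>a. x \<otimes> a \<otimes> inv x) ` ?K"
    then show "b \<in> ?K" using Cset_normalizes_ker[OF x] A_conj[OF xM(1)] by auto
  next
    fix a assume a: "a \<in> ?K"
    then have "inv x \<otimes> a \<otimes> x \<in> ?K"
      using Cset_normalizes_ker[OF xi, of a] A_conj'[OF xM(1), of a] xM by simp
    moreover have "a = x \<otimes> (inv x \<otimes> a \<otimes> x) \<otimes> inv x" using a A_carrier xM by simp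
    ultimately show "a \<in> (\<lambda>a. x \<otimes> a \<otimes> inv x) ` ?K" by blast
  qed
  finally show "x \<in> nrm G M ?K" using xM by (simp add: nrm_def)
qed

end

section \<open>Nodes of a path\<close>

context fin_group begin

lemma N_lin_triple_D:
  assumes "N_lin_triple G N (H, A, \<theta>)"
  shows "subgroup H G" "A \<lhd> G\<lparr>carrier := H\<rparr>" "lin_char G A \<theta>" "subgroup A G" "A \<subseteq> H"
    "\<And>h a. h \<in> H \<Longrightarrow> a \<in> A \<Longrightarrow> \<theta> (h \<otimes> a \<otimes> inv h) = \<theta> a"
    "\<And>h a. h \<in> H \<Longrightarrow> a \<in> A \<Longrightarrow> h \<otimes> a \<otimes> inv h \<in> A"
    "lin_sub G A \<theta>"
proof -
  show H: "subgroup H G" and n: "A \<lhd> G\<lparr>carrier := H\<rparr>" and l: "lin_char G A \<theta>"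
    and "\<And>h a. h \<in> H \<Longrightarrow> a \<in> A \<Longrightarrow> \<theta> (h \<otimes> a \<otimes> inv h) = \<theta> a"
    using assms by (auto simp: N_lin_triple_def)
  interpret N: normal A "G\<lparr>carrier := H\<rparr>" by (rule n)
  have s: "subgroup A (G\<lparr>carrier := H\<rparr>)" by (rule N.subgroup_axioms)
  show AG: "subgroup A G" using incl_subgroup[OF H s] .
  show "A \<subseteq> H" using subgroup.subset[OF s] by simp
  show "h \<otimes> a \<otimes> inv h \<in> A" if "h \<in> H" "a \<in> A" for h a
    using N.inv_op_closed2[of h a] that m_inv_consistent[OF H that(1)] by simp
  show "lin_sub G A \<theta>" by (intro lin_sub.intro lin_sub_axioms.intro fin_group_axioms AG l)
qed

lemma abel_over_normal_eq:
  assumes "subgroup S G" "K \<lhd> G\<lparr>carrier := S\<rparr>"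
  shows "comm_group (G\<lparr>carrier := S\<rparr> Mod K) \<longleftrightarrow> (\<forall>x\<in>S. \<forall>y\<in>S. K #> (x \<otimes> y) = K #> (y \<otimes> x))"
proof -
  have "r_coset (G\<lparr>carrier := S\<rparr>) K = r_coset G K" by (simp add: fun_eq_iff r_coset_def)
  then show ?thesis using normal.comm_group_Mod_iff[OF assms(2)] by simp
qed

text \<open>Since \<open>A\<close> is central modulo \<open>ker \<theta>\<close>, the product of \<open>A\<close> with an abelian-by-\<open>ker \<theta>\<close>
  normal subgroup is of the same kind, so the maximal one contains \<open>A\<close>.\<close>

lemma max_abel_over_contains:
  assumes t: "N_lin_triple G N (H, A, \<theta>)"
    and B: "abel_over G H (char_ker G A \<theta>) B"
    and max: "\<And>S. abel_over G H (char_ker G A \<theta>) S \<Longrightarrow> card S \<le> card B"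
  shows "A \<subseteq> B"
proof -
  note T = N_lin_triple_D[OF t]
  interpret lin_sub G A \<theta> by (rule T(8))
  let ?HG = "G\<lparr>carrier := H\<rparr>"
  have Hc: "h \<in> carrier G" if "h \<in> H" for h using that T(1) subgroup.mem_carrier by metis
  have Bd: "B \<lhd> ?HG" "K \<subseteq> B" "K \<lhd> G\<lparr>carrier := B\<rparr>" "comm_group (G\<lparr>carrier := B\<rparr> Mod K)"
    using B by (auto simp: abel_over_def K_def)
  interpret HG: group ?HG using T(1) subgroup.subgroup_is_group is_group by blast
  interpret NA: normal A ?HG by (rule T(2))
  interpret NB: normal B ?HG by (rule Bd(1))
  have BG: "subgroup B G" using incl_subgroup[OF T(1) NB.subgroup_axioms] .
  have BH: "B \<subseteq> H" using NB.subset by simp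
  have invH: "inv\<^bsub>?HG\<^esub> h = inv h" if "h \<in> H" for h using m_inv_consistent[OF T(1) that] .
  have KA: "K \<subseteq> A" by (auto simp: K_eq)
  have KH: "K \<lhd> ?HG"
  proof (subst HG.normal_inv_iff, intro conjI ballI)
    show "subgroup K ?HG" using K_subgroup KA T(1,5) subgroup_incl by blast
    fix h k assume "h \<in> carrier ?HG" "k \<in> K"
    then show "h \<otimes>\<^bsub>?HG\<^esub> k \<otimes>\<^bsub>?HG\<^esub> inv\<^bsub>?HG\<^esub> h \<in> K"
      using T(6,7) invH by (auto simp: K_eq)
  qed
  interpret NK: normal K ?HG by (rule KH)
  have rc: "r_coset ?HG = r_coset G" and sm: "set_mult ?HG = set_mult G"
    by (simp_all add: fun_eq_iff r_coset_def set_mult_def)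
  have sum: "(K #> x) <#> (K #> y) = K #> (x \<otimes> y)" if "x \<in> H" "y \<in> H" for x y
    using NK.rcos_sum[of x y] that by (simp add: rc sm)
  \<comment> \<open>\<theta> is invariant under \<open>H\<close>, so commutators of \<open>A\<close>
    with \<open>H\<close> lie in its kernel.\<close>
  have central: "K #> (a \<otimes> h) = K #> (h \<otimes> a)" if "a \<in> A" "h \<in> H" for a h
  proof -
    have ac: "a \<in> carrier G" "h \<in> carrier G" "a \<in> H" using that T(5) Hc by auto
    have c: "h \<otimes> a \<otimes> inv h \<in> A" "\<theta> (h \<otimes> a \<otimes> inv h) = \<theta> a" using T(6,7) that by auto
    have "h \<otimes> a \<otimes> inv h \<otimes> inv a \<in> K"
      using c that theta_nz[OF that(1)] by (simp add: K_eq theta_mult[OF c(1)] theta_inv)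
    moreover have "h \<otimes> a \<otimes> inv h \<otimes> inv a = (h \<otimes> a) \<otimes> inv (a \<otimes> h)"
      using ac by (simp add: inv_mult_group m_assoc)
    ultimately have "h \<otimes> a \<in> K #> (a \<otimes> h)"
      using subgroup.rcos_module[OF K_subgroup is_group] ac by simp
    then show ?thesis using ac K_subgroup by (intro repr_independence) auto
  qed
  have Bcomm: "K #> (s \<otimes> s') = K #> (s' \<otimes> s)" if "s \<in> B" "s' \<in> B" for s s'
    using abel_over_normal_eq[OF BG Bd(3)] Bd(4) that by blast
  define S where "S = A <#> B"
  have SN: "S \<lhd> ?HG"
  proof -
    have "A <#>\<^bsub>?HG\<^esub> B \<lhd> ?HG"
      using HG.normal_subgroup_set_mult_closed[OF T(2) Bd(1)] .
    then show ?thesis by (simp add: S_def sm)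
  qed
  have SH: "S \<subseteq> H" using normal_imp_subgroup[OF SN] subgroup.subset by fastforce
  have SG: "subgroup S G" using incl_subgroup[OF T(1) normal_imp_subgroup[OF SN]] .
  have AS: "A \<subseteq> S" and BS: "B \<subseteq> S"
  proof -
    show "A \<subseteq> S"
    proof
      fix a assume "a \<in> A"
      then have "a = a \<otimes> \<one>" using H_carrier by simp
      then show "a \<in> S" using \<open>a \<in> A\<close> subgroup.one_closed[OF BG] unfolding S_def set_mult_def by blast
    qed
    show "B \<subseteq> S"
    proof
      fix b assume "b \<in> B"
      then have "b = \<one> \<otimes> b" using BH Hc by auto
      then show "b \<in> S" using \<open>b \<in> B\<close> H_closed(2) unfolding S_def set_mult_def by blast
    qed
  qed
  have KS: "K \<lhd> G\<lparr>carrier := S\<rparr>"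
    using HG.normal_restrict_supergroup[OF normal_imp_subgroup[OF SN] KH] KA AS by simp
  have "K #> (x \<otimes> y) = K #> (y \<otimes> x)" if xy: "x \<in> S" "y \<in> S" for x y
  proof -
    obtain a s where x: "a \<in> A" "s \<in> B" "x = a \<otimes> s" using xy(1) by (auto simp: S_def set_mult_def)
    obtain b t where y: "b \<in> A" "t \<in> B" "y = b \<otimes> t" using xy(2) by (auto simp: S_def set_mult_def)
    have inH: "a \<in> H" "b \<in> H" "s \<in> H" "t \<in> H" using x y T(5) BH by auto
    have HH: "u \<otimes> v \<in> H" if "u \<in> H" "v \<in> H" for u v using that T(1) subgroup.m_closed by metis
    note c = inH inH[THEN Hc]
    have cong: "K #> (u \<otimes> v) = K #> (u' \<otimes> v')"
      if "u \<in> H" "v \<in> H" "u' \<in> H" "v' \<in> H" "K #> u = K #> u'" "K #> v = K #> v'" for u v u' v'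
      using sum that by metis
    have "K #> (x \<otimes> y) = K #> (a \<otimes> (s \<otimes> (b \<otimes> t)))" using c by (simp add: x y m_assoc)
    also have "\<dots> = K #> ((s \<otimes> (b \<otimes> t)) \<otimes> a)" using central[OF x(1)] c HH by simp
    also have "\<dots> = K #> ((s \<otimes> b) \<otimes> (t \<otimes> a))" using c by (simp add: m_assoc)
    also have "\<dots> = K #> ((b \<otimes> s) \<otimes> (t \<otimes> a))"
      by (rule cong) (use central[OF y(1), of s] c HH in auto)
    also have "\<dots> = K #> (b \<otimes> ((s \<otimes> t) \<otimes> a))" using c by (simp add: m_assoc)
    also have "\<dots> = K #> (b \<otimes> ((t \<otimes> s) \<otimes> a))"
    proof -
      have "K #> ((s \<otimes> t) \<otimes> a) = K #> ((t \<otimes> s) \<otimes> a)"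
        by (rule cong) (use Bcomm[OF x(2) y(2)] c HH in auto)
      then show ?thesis by (intro cong[of b _ b]) (use c HH in auto)
    qed
    also have "\<dots> = K #> ((b \<otimes> t) \<otimes> (s \<otimes> a))" using c by (simp add: m_assoc)
    also have "\<dots> = K #> ((b \<otimes> t) \<otimes> (a \<otimes> s))"
      by (rule cong) (use central[OF x(1), of s] c HH in auto)
    finally show ?thesis by (simp add: x y)
  qed
  then have "abel_over G H (char_ker G A \<theta>) S"
    unfolding abel_over_def K_def[symmetric] abel_over_normal_eq[OF SG KS] using SN KS AS KA by blast
  then have "card S \<le> card B" by (rule max)
  then have "B = S" using card_seteq[OF subgroup_finite[OF SG] BS] by blast
  then show ?thesis using AS by blast
qed

text \<open>Characters are extended by zero, and \<open>A\<close> is normal in \<open>H\<close>, so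
  outside \<open>A\<close> both functions vanish and equality need only be tested on
  \<open>A\<close>.\<close>

lemma inertia_eq:
  assumes sub: "subgroup H G" and A: "A \<lhd> G\<lparr>carrier := H\<rparr>" and l: "lin_char G A \<phi>"
  shows "inertia G H \<phi> = {h \<in> H. \<forall>a\<in>A. \<phi> (h \<otimes> a \<otimes> inv h) = \<phi> a}"
proof -
  interpret N: normal A "G\<lparr>carrier := H\<rparr>" by (rule A)
  have AG: "subgroup A G" using incl_subgroup[OF sub N.subgroup_axioms] .
  interpret lin_sub G A \<phi> by (intro lin_sub.intro lin_sub_axioms.intro fin_group_axioms AG l)
  have "char_conj G h \<phi> = \<phi> \<longleftrightarrow> (\<forall>a\<in>A. \<phi> (h \<otimes> a \<otimes> inv h) = \<phi> a)" if h: "h \<in> H" for h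
  proof
    assume c: "char_conj G h \<phi> = \<phi>"
    show "\<forall>a\<in>A. \<phi> (h \<otimes> a \<otimes> inv h) = \<phi> a"
    proof
      fix a assume "a \<in> A"
      then show "\<phi> (h \<otimes> a \<otimes> inv h) = \<phi> a" using fun_cong[OF c, of a] H_carrier by (simp add: char_conj_def)
    qed
  next
    assume c: "\<forall>a\<in>A. \<phi> (h \<otimes> a \<otimes> inv h) = \<phi> a"
    show "char_conj G h \<phi> = \<phi>"
    proof
      fix g
      show "char_conj G h \<phi> g = \<phi> g"
      proof (cases "g \<in> A")
        case True
        then show ?thesis using c H_carrier by (simp add: char_conj_def)
      next
        case False
        have "h \<otimes> g \<otimes> inv h \<notin> A" if g: "g \<in> carrier G"
        proof
          assume a: "h \<otimes> g \<otimes> inv h \<in> A"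
          have hc: "h \<in> carrier G" by (rule subgroup.mem_carrier[OF sub h])
          have "inv h \<otimes> (h \<otimes> g \<otimes> inv h) \<otimes> h \<in> A"
            using N.inv_op_closed1[of h "h \<otimes> g \<otimes> inv h"] a h m_inv_consistent[OF sub h] by simp
          then show False using False g hc by simp
        qed
        then show ?thesis using False theta_out by (simp add: char_conj_def)
      qed
    qed
  qed
  then show ?thesis by (auto simp: inertia_def)
qed

lemma Cl_step:
  assumes t: "N_lin_triple G N (H, A, \<theta>)" and v: "(H', A', \<theta>') \<in> Cl G Ac R (H, A, \<theta>)"
    and Ac: "valid_Acal G N Ac" and R: "valid_reps G N Ac R"
  shows "A' \<lhd> G\<lparr>carrier := H\<rparr>" "A \<subseteq> A'" "\<And>a. a \<in> A \<Longrightarrow> \<theta>' a = \<theta> a"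
    "H' = {h \<in> H. \<forall>a\<in>A'. \<theta>' (h \<otimes> a \<otimes> inv h) = \<theta>' a}"
proof -
  have v': "\<theta>' \<in> R (H, A, \<theta>)" "A' = Ac (H, A, \<theta>)" "H' = inertia G H \<theta>'"
    using v by (auto simp: Cl_def split: if_splits)
  have ab: "abel_over G H (char_ker G A \<theta>) A'"
    and max: "\<And>S. abel_over G H (char_ker G A \<theta>) S \<Longrightarrow> card S \<le> card A'"
    using Ac t unfolding valid_Acal_def v'(2) by blast+
  show n: "A' \<lhd> G\<lparr>carrier := H\<rparr>" using ab by (simp add: abel_over_def)
  show "A \<subseteq> A'" by (rule max_abel_over_contains[OF t ab max])
  have lt: "\<theta>' \<in> Lin_tilde G N A A' \<theta>"
    using R t v'(1) unfolding valid_reps_def v'(2) by blast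
  show "\<theta>' a = \<theta> a" if "a \<in> A" for a using lt that by (simp add: Lin_tilde_def)
  have "lin_char G A' \<theta>'" using lt by (simp add: Lin_tilde_def)
  then show "H' = {h \<in> H. \<forall>a\<in>A'. \<theta>' (h \<otimes> a \<otimes> inv h) = \<theta>' a}"
    unfolding v'(3) by (rule inertia_eq[OF N_lin_triple_D(1)[OF t] n])
qed

end

section \<open>The formula for a leaf\<close>

lemma prod_eq_iff_dominated:
  fixes a b :: "'i \<Rightarrow> rat"
  assumes "finite I" "\<And>i. i \<in> I \<Longrightarrow> 0 < b i" "\<And>i. i \<in> I \<Longrightarrow> b i \<le> a i"
  shows "(\<Prod>i\<in>I. a i) = (\<Prod>i\<in>I. b i) \<longleftrightarrow> (\<forall>i\<in>I. a i = b i)"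
proof
  assume eq: "(\<Prod>i\<in>I. a i) = (\<Prod>i\<in>I. b i)"
  show "\<forall>i\<in>I. a i = b i"
  proof (rule ccontr)
    assume "\<not> (\<forall>i\<in>I. a i = b i)"
    then obtain j where j: "j \<in> I" "a j \<noteq> b j" by blast
    then have less: "b j < a j" using assms(3)[of j] by simp
    have pos: "0 < (\<Prod>i\<in>I - {j}. b i)" using assms(2) by (intro prod_pos) auto
    have le: "(\<Prod>i\<in>I - {j}. b i) \<le> (\<Prod>i\<in>I - {j}. a i)"
      using assms(2,3) by (intro prod_mono) (auto simp: less_imp_le)
    have "(\<Prod>i\<in>I. b i) = b j * (\<Prod>i\<in>I - {j}. b i)" using assms(1) j by (simp add: prod.remove)
    also have "\<dots> < a j * (\<Prod>i\<in>I - {j}. b i)" using less pos by simp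
    also have "\<dots> \<le> a j * (\<Prod>i\<in>I - {j}. a i)"
      using le less assms(2)[OF j(1)] by (intro mult_left_mono) auto
    also have "\<dots> = (\<Prod>i\<in>I. a i)" using assms(1) j by (simp add: prod.remove)
    finally show False using eq by simp
  qed
qed (simp cong: prod.cong)

lemma divide_eq_1_flip: "a \<noteq> 0 \<Longrightarrow> b / a = 1 \<longleftrightarrow> a = (b :: rat)"
  by (metis divide_eq_1_iff)

locale leaf_path = fin_group G for G (structure) +
  fixes N Ac R vs H \<theta>
  assumes Ac: "valid_Acal G N Ac" and R: "valid_reps G N Ac R"
    and path: "is_path G N Ac R vs" and last: "last vs = (H, H, \<theta>)"
begin

abbreviation (input) n where "n \<equiv> length vs"
abbreviation (input) HH where "HH \<equiv> nodeH vs"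
abbreviation (input) AA where "AA \<equiv> nodeA vs"
abbreviation (input) TT where "TT \<equiv> nodeT vs"

lemma n_pos: "1 \<le> n"
  using path by (cases vs) (auto simp: is_path_def)

lemma node: "vs ! (i - 1) = (HH i, AA i, TT i)"
  by (simp add: nodeH_def nodeA_def nodeT_def)

lemma triple: "1 \<le> i \<Longrightarrow> i \<le> n \<Longrightarrow> N_lin_triple G N (HH i, AA i, TT i)"
  using path unfolding node[symmetric] is_path_def by (metis One_nat_def Suc_le_lessD Suc_pred nth_mem not_less_eq_eq less_Suc_eq_le le_trans)

lemma node_last: "HH n = H" "AA n = H" "TT n = \<theta>"
proof -
  have "vs \<noteq> []" using path by (simp add: is_path_def)
  then have "vs ! (n - 1) = (H, H, \<theta>)" using last by (simp add: last_conv_nth)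
  then show "HH n = H" "AA n = H" "TT n = \<theta>" by (simp_all add: nodeH_def nodeA_def nodeT_def)
qed

lemma node_first: "HH 1 = carrier G"
  using path by (simp add: is_path_def nodeH_def)

lemma node_Cl:
  assumes i: "1 \<le> i" "i < n"
  shows "(HH (Suc i), AA (Suc i), TT (Suc i)) \<in> Cl G Ac R (HH i, AA i, TT i)"
proof -
  have "Suc (i - 1) < length vs" using i by simp
  then have "vs ! Suc (i - 1) \<in> Cl G Ac R (vs ! (i - 1))" using path unfolding is_path_def by blast
  then show ?thesis using i node[of "Suc i"] node[of i] by simp
qed

lemma step:
  assumes i: "1 \<le> i" "i < n"
  shows "AA (Suc i) \<lhd> G\<lparr>carrier := HH i\<rparr>" "AA i \<subseteq> AA (Suc i)" "\<And>a. a \<in> AA i \<Longrightarrow> TT (Suc i) a = TT i a"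
    "HH (Suc i) = {h \<in> HH i. \<forall>a\<in>AA (Suc i). TT (Suc i) (h \<otimes> a \<otimes> inv h) = TT (Suc i) a}"
  by (fact Cl_step[OF triple[OF i(1) less_imp_le[OF i(2)]] node_Cl[OF i] Ac R])+

lemma HH_mono: "i \<le> j \<Longrightarrow> 1 \<le> i \<Longrightarrow> j \<le> n \<Longrightarrow> HH j \<subseteq> HH i"
proof (induction j rule: dec_induct)
  case (step k)
  then have "HH (Suc k) \<subseteq> HH k" using leaf_path.step(4)[OF leaf_path_axioms, of k] by auto
  then show ?case using step by auto
qed simp

lemma AA_mono: "i \<le> j \<Longrightarrow> 1 \<le> i \<Longrightarrow> j \<le> n \<Longrightarrow> AA i \<subseteq> AA j \<and> (\<forall>a\<in>AA i. TT j a = TT i a)"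
proof (induction j rule: dec_induct)
  case (step k)
  then have "AA k \<subseteq> AA (Suc k)" "\<forall>a\<in>AA k. TT (Suc k) a = TT k a"
    using leaf_path.step(2,3)[OF leaf_path_axioms, of k] by auto
  then show ?case using step by auto
qed simp

lemma AA_H: "1 \<le> i \<Longrightarrow> i \<le> n \<Longrightarrow> AA i \<subseteq> H" and TT_theta: "1 \<le> i \<Longrightarrow> i \<le> n \<Longrightarrow> a \<in> AA i \<Longrightarrow> TT i a = \<theta> a"
  using AA_mono[of i n] node_last by auto

lemma H_HH: "1 \<le> i \<Longrightarrow> i \<le> n \<Longrightarrow> H \<subseteq> HH i"
  using HH_mono[of i n] node_last by auto

lemma HH_subgroup: "1 \<le> i \<Longrightarrow> i \<le> n \<Longrightarrow> subgroup (HH i) G"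
  using triple N_lin_triple_D(1) by blast

sublocale lin_sub G H \<theta>
proof -
  have "lin_sub G (AA n) (TT n)" using N_lin_triple_D(8)[OF triple[OF n_pos order_refl]] .
  then show "lin_sub G H \<theta>" unfolding node_last .
qed

lemma AA_conj:
  assumes i: "1 \<le> i" "i < n" and h: "h \<in> HH i" and a: "a \<in> AA (Suc i)"
  shows "h \<otimes> a \<otimes> inv h \<in> AA (Suc i)"
proof -
  interpret N: normal "AA (Suc i)" "G\<lparr>carrier := HH i\<rparr>" by (rule step(1)[OF i])
  show ?thesis
    using N.inv_op_closed2[of h a] h a m_inv_consistent[OF HH_subgroup h] i by simp
qed

lemma HH_Suc:
  assumes i: "1 \<le> i" "i < n"
  shows "HH (Suc i) = {h \<in> HH i. \<forall>a\<in>AA (Suc i). \<theta> (h \<otimes> a \<otimes> inv h) = \<theta> a}"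
proof -
  have "TT (Suc i) a = \<theta> a" if "a \<in> AA (Suc i)" for a using TT_theta[of "Suc i" a] i that by simp
  then show ?thesis using step(4)[OF i] AA_conj[OF i] by auto
qed

text \<open>Downward induction from the leaf: an element of \<open>HH k\<close> outside
  \<open>HH (Suc k)\<close> moves \<theta> on \<open>AA (Suc k)\<close>, a subset of
  \<open>H\<close> that it normalizes, and so supplies the required witness.\<close>

lemma shoda_HH: "i \<le> n \<Longrightarrow> 1 \<le> i \<Longrightarrow> shoda_on (HH i) H \<theta>"
proof (induction i rule: inc_induct)
  case base
  then show ?case by (simp add: shoda_on_def node_last)
next
  case (step k)
  show ?case
    unfolding shoda_on_def
  proof
    fix x assume x: "x \<in> HH k - H"
    show "\<exists>h\<in>H. x \<otimes> h \<otimes> inv x \<in> H \<and> \<theta> (x \<otimes> h \<otimes> inv x) \<noteq> \<theta> h"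
    proof (cases "x \<in> HH (Suc k)")
      case True
      then show ?thesis using step x by (auto simp: shoda_on_def)
    next
      case False
      then obtain a where a: "a \<in> AA (Suc k)" "\<theta> (x \<otimes> a \<otimes> inv x) \<noteq> \<theta> a"
        using HH_Suc[of k] step x by auto
      have "x \<otimes> a \<otimes> inv x \<in> AA (Suc k)" using AA_conj[of k x a] step x a by auto
      moreover have "AA (Suc k) \<subseteq> H" using AA_H[of "Suc k"] step by simp
      ultimately show ?thesis using a by blast
    qed
  qed
qed

lemma shoda_loc: "1 \<le> i \<Longrightarrow> i \<le> n \<Longrightarrow> shoda G H \<theta> (HH i)"
  by (intro shoda.intro shoda_axioms.intro lin_sub_axioms HH_subgroup H_HH shoda_HH)

lemma clifford_loc:
  assumes i: "2 \<le> i" "i \<le> n"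
  shows "clifford_step G H \<theta> (HH (i - 1)) (HH i) (AA i)"
proof -
  obtain j where j: "i = Suc j" "1 \<le> j" "j < n" using i by (cases i) auto
  have "clifford_step G H \<theta> (HH j) (HH (Suc j)) (AA (Suc j))"
  proof (intro clifford_step.intro clifford_step_axioms.intro)
    show "shoda G H \<theta> (HH j)" using shoda_loc j by simp
    show "subgroup (HH (Suc j)) G" using HH_subgroup j by simp
    show "H \<subseteq> HH (Suc j)" using H_HH j by simp
    show "AA (Suc j) \<subseteq> H" using AA_H j by simp
    show "\<And>x a. x \<in> HH j \<Longrightarrow> a \<in> AA (Suc j) \<Longrightarrow> x \<otimes> a \<otimes> inv x \<in> AA (Suc j)" using AA_conj j by simp
    show "HH (Suc j) = {x \<in> HH j. \<forall>a\<in>AA (Suc j). \<theta> (x \<otimes> a \<otimes> inv x) = \<theta> a}" using HH_Suc j by simp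
  qed
  then show ?thesis using j(1) by simp
qed

text \<open>\<open>s\<close> and \<open>d\<close> are the quantities whose quotients telescope:
  dividing the orders of \<open>C i\<close> and \<open>CH i\<close> by that of \<open>HH i\<close>
  gives \<open>s (i - 1) / s i\<close> and \<open>d (i - 1) / d i\<close>.\<close>

definition s where "s i = card (stab (EE (HH i) H \<theta>))"
definition d where "d i = card (Cen G (HH i) (eps G H K))"
definition C where "C i = Cen G (HH (i - 1)) (e_sum G (HH i) H K)"
definition NK where "NK i = nrm G (HH (i - 1)) (char_ker G (AA i) (TT i))"
definition CH where "CH i = Cen G (HH (i - 1)) (eps G H K) <#> HH i"

lemma Cset_eq:
  assumes i: "2 \<le> i" "i \<le> n"
  shows "clifford_step.Cset G H \<theta> (HH (i - 1)) (HH i) = C i"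
    "clifford_step.Dset G H \<theta> (HH (i - 1)) = Cen G (HH (i - 1)) (eps G H K)"
proof -
  interpret c: clifford_step G H \<theta> "HH (i - 1)" "HH i" "AA i" by (rule clifford_loc[OF i])
  show "c.Cset = C i" unfolding c.Cset_def C_def c.small.Cen_e_sum ..
  show "c.Dset = Cen G (HH (i - 1)) (eps G H K)" unfolding c.Dset_def Cen_eps ..
qed

lemma card_C: "2 \<le> i \<Longrightarrow> i \<le> n \<Longrightarrow> card (C i) * s i = s (i - 1) * card (HH i)"
  using clifford_step.card_Cset[OF clifford_loc] Cset_eq unfolding s_def by simp

lemma CH_subset: "2 \<le> i \<Longrightarrow> i \<le> n \<Longrightarrow> CH i \<subseteq> C i"
  using clifford_step.setmult_subset[OF clifford_loc] Cset_eq unfolding CH_def by simp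

lemma card_CH:
  assumes i: "2 \<le> i" "i \<le> n"
  shows "card (CH i) * d i = d (i - 1) * card (HH i)"
proof -
  interpret c: clifford_step G H \<theta> "HH (i - 1)" "HH i" "AA i" by (rule clifford_loc[OF i])
  have "card (c.Dset <#> HH i) * card (Cen G (HH i) (eps G H K)) = card c.Dset * card (HH i)"
    using c.card_Dset_M' unfolding Cen_eps .
  then show ?thesis unfolding Cset_eq[OF i] CH_def d_def .
qed

lemma pos: "1 \<le> i \<Longrightarrow> i \<le> n \<Longrightarrow> s i > 0" "1 \<le> i \<Longrightarrow> i \<le> n \<Longrightarrow> d i > 0" "1 \<le> i \<Longrightarrow> i \<le> n \<Longrightarrow> card (HH i) > 0"
  unfolding s_def d_def
  by (rule card_stab_pos[OF shoda.EE_supp_carrier[OF shoda_loc]] shoda.Cen_eps_pos[OF shoda_loc]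
      subgroup_card_pos[OF HH_subgroup]; assumption)+

text \<open>At the leaf \<open>EE H H \<theta>\<close> is \<open>ee H \<theta>\<close> itself, so
  both centralizers are described by the same \<open>tsum\<close>.\<close>

lemma C_last: "2 \<le> n \<Longrightarrow> card (C n) = d (n - 1)"
proof -
  interpret self: shoda G H \<theta> H by (rule shoda_self)
  have "C n = Cen G (HH (n - 1)) (eps G H K)"
    unfolding C_def node_last self.Cen_e_sum Cen_eps EE_self ..
  then show ?thesis by (simp add: d_def)
qed

lemma alpha_leaf: "alpha G H K = of_nat (d 1 * s n) / of_nat (card (HH n) * s 1)"
proof -
  have "shoda_full G H \<theta>"
    using shoda_loc[OF order_refl n_pos] unfolding node_first by (rule shoda_full.intro)
  then interpret f: shoda_full G H \<theta> .
  show ?thesis unfolding f.alpha_eq f.alpha0_def d_def s_def node_first node_last EE_self ..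
qed

lemma prod_telescope:
  assumes rel: "\<And>i. 2 \<le> i \<Longrightarrow> i \<le> n \<Longrightarrow> c i * f i = f (i - 1) * card (HH i)"
    and f: "\<And>i. 1 \<le> i \<Longrightarrow> i \<le> n \<Longrightarrow> f i > 0" and m: "1 \<le> m" "m \<le> n"
  shows "(\<Prod>i\<in>{2..m}. of_nat (c i) / of_nat (card (HH i)) :: rat) = of_nat (f 1) / of_nat (f m)"
  using m
proof (induction m rule: dec_induct)
  case base
  then show ?case using f[of 1] n_pos by simp
next
  case (step m)
  have e: "of_nat (c (Suc m)) * of_nat (f (Suc m)) = (of_nat (f m) * of_nat (card (HH (Suc m))) :: rat)"
    using rel[of "Suc m"] step by (simp flip: of_nat_mult)
  have p: "of_nat (f m) \<noteq> (0::rat)" "of_nat (f (Suc m)) \<noteq> (0::rat)" "of_nat (card (HH (Suc m))) \<noteq> (0::rat)"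
    using f[of m] f[of "Suc m"] pos(3)[of "Suc m"] step by auto
  have "{2..Suc m} = insert (Suc m) {2..m}" using step by auto
  then have "(\<Prod>i\<in>{2..Suc m}. of_nat (c i) / of_nat (card (HH i)) :: rat) =
     of_nat (c (Suc m)) / of_nat (card (HH (Suc m))) * (of_nat (f 1) / of_nat (f m))"
    using step by simp
  also have "of_nat (c (Suc m)) / of_nat (card (HH (Suc m))) = (of_nat (f m) / of_nat (f (Suc m)) :: rat)"
    using e p by (simp add: field_simps)
  finally show ?case using p by simp
qed

lemmas prod_C = prod_telescope[of "\<lambda>i. card (C i)" s, OF card_C pos(1)]
lemmas prod_CH = prod_telescope[of "\<lambda>i. card (CH i)" d, OF card_CH pos(2)]

text \<open>For a path of length 1 the formula refers to node \<open>n - 1 = 0\<close>; truncated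
  subtraction makes this the first node.\<close>

lemma node_0: "HH 0 = HH 1"
  by (simp add: nodeH_def)

text \<open>\<open>alpha_leaf\<close> contains \<open>s\<close> at both ends of the path. The
  relation \<open>card_C\<close> at \<open>i = n\<close>, where \<open>C n\<close> has order
  \<open>d (n - 1)\<close>, replaces \<open>card (HH n) / s n\<close> by
  \<open>d (n - 1) / s (n - 1)\<close>; hence the product stops at \<open>n - 1\<close>.\<close>

lemma alpha_formula:
  "alpha G H K = (of_nat (d 1) / of_nat (d (n - 1))) / (\<Prod>i\<in>{2..n-1}. of_nat (card (C i)) / of_nat (card (HH i)))"
proof (cases "n = 1")
  case True
  have "d 0 = d 1" by (simp add: d_def node_0)
  moreover have "d 1 = card H"
  proof -
    interpret self: shoda G H \<theta> H by (rule shoda_self)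
    have "HH 1 = H" using node_last(1) True by simp
    moreover have "Cen G H (eps G H K) = H"
      unfolding Cen_eps using tsum_cj[symmetric] ee_conj H_carrier by auto
    ultimately show ?thesis by (simp add: d_def)
  qed
  moreover have "HH n = H" "s n = s 1" using node_last(1) True by auto
  ultimately show ?thesis
    using alpha_leaf pos(1)[of 1] card_H True by simp
next
  case False
  then have n2: "2 \<le> n" using n_pos by simp
  have p: "of_nat (s n) \<noteq> (0::rat)" "of_nat (s (n - 1)) \<noteq> (0::rat)" "of_nat (s 1) \<noteq> (0::rat)"
    "of_nat (d (n - 1)) \<noteq> (0::rat)" "of_nat (card (HH n)) \<noteq> (0::rat)"
    using pos(1)[of n] pos(1)[of "n - 1"] pos(1)[of 1] pos(2)[of "n - 1"] pos(3)[of n] n2 by auto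
  have e: "of_nat (d (n - 1)) * of_nat (s n) = (of_nat (s (n - 1)) * of_nat (card (HH n)) :: rat)"
    using card_C[OF n2 order_refl] C_last[OF n2] by (simp flip: of_nat_mult)
  have "alpha G H K = of_nat (d 1) * of_nat (s n) / (of_nat (card (HH n)) * of_nat (s 1))"
    unfolding alpha_leaf by simp
  also have "\<dots> = (of_nat (d 1) / of_nat (d (n - 1))) / (of_nat (s 1) / of_nat (s (n - 1)))"
    using e p by (simp add: field_simps)
  also have "of_nat (s 1) / of_nat (s (n - 1)) = (\<Prod>i\<in>{2..n-1}. of_nat (card (C i)) / of_nat (card (HH i)) :: rat)"
    using prod_C[of "n - 1"] n2 by simp
  finally show ?thesis .
qed

text \<open>The index in the numerator is itself a telescoping product, with factors
  \<open>card (CH i) / card (HH i)\<close>. As \<open>CH i\<close> is contained in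
  \<open>C i\<close>, the two products are compared factor by factor, and equality of products
  forces equality of all factors.\<close>

lemma alpha_eq_1_iff: "alpha G H K = 1 \<longleftrightarrow> (\<forall>i\<in>{2..n-1}. C i = CH i)"
proof -
  have d: "(of_nat (d 1) / of_nat (d (n - 1)) :: rat) = (\<Prod>i\<in>{2..n-1}. of_nat (card (CH i)) / of_nat (card (HH i)))"
  proof (cases "n = 1")
    case True
    then show ?thesis using pos(2)[of 1] by (simp add: d_def node_0)
  next
    case False
    then show ?thesis using prod_CH[of "n - 1"] n_pos by simp
  qed
  have ran: "2 \<le> i" "i \<le> n" "1 \<le> i" "i - 1 \<le> n" "1 \<le> i - 1" if "i \<in> {2..n-1}" for i using that by auto
  have CHpos: "0 < card (CH i)" if "i \<in> {2..n-1}" for i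
    using card_CH[OF ran(1,2)[OF that]] pos(2)[of "i - 1"] pos(3)[of i] ran[OF that]
    by (metis mult_0 mult_is_0 not_gr0)
  have fin: "finite (C i)" if "i \<in> {2..n-1}" for i
    using subgroup_finite[OF HH_subgroup[of "i - 1"]] ran[OF that] by (simp add: C_def Cen_def)
  have Cpos: "0 < card (C i)" if "i \<in> {2..n-1}" for i
    using CHpos[OF that] card_mono[OF fin[OF that] CH_subset] ran[OF that] by fastforce
  define PC :: rat where "PC = (\<Prod>i\<in>{2..n-1}. of_nat (card (C i)) / of_nat (card (HH i)))"
  define PCH :: rat where "PCH = (\<Prod>i\<in>{2..n-1}. of_nat (card (CH i)) / of_nat (card (HH i)))"
  have "of_nat (card (C i)) / of_nat (card (HH i)) \<noteq> (0 :: rat)" if "i \<in> {2..n-1}" for i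
    using Cpos[OF that] pos(3)[of i] ran[OF that] by simp
  then have PC: "PC \<noteq> 0" by (simp add: PC_def prod_zero_iff)
  have "alpha G H K = (of_nat (d 1) / of_nat (d (n - 1))) / PC" unfolding PC_def by (rule alpha_formula)
  also have "of_nat (d 1) / of_nat (d (n - 1)) = PCH" unfolding PCH_def by (rule d)
  finally have alpha: "alpha G H K = PCH / PC" .
  have "alpha G H K = 1 \<longleftrightarrow> PC = PCH"
    unfolding alpha by (rule divide_eq_1_flip[OF PC])
  also have "\<dots> \<longleftrightarrow> (\<forall>i\<in>{2..n-1}. of_nat (card (C i)) / of_nat (card (HH i)) = (of_nat (card (CH i)) / of_nat (card (HH i)) :: rat))"
  unfolding PC_def PCH_def
  proof (rule prod_eq_iff_dominated)
    fix i assume i: "i \<in> {2..n-1}"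
    show "0 < (of_nat (card (CH i)) / of_nat (card (HH i)) :: rat)"
      using CHpos[OF i] pos(3)[of i] ran[OF i] by simp
    show "(of_nat (card (CH i)) / of_nat (card (HH i)) :: rat) \<le> of_nat (card (C i)) / of_nat (card (HH i))"
      using card_mono[OF fin[OF i] CH_subset] ran[OF i] by (intro divide_right_mono) auto
  qed simp
  also have "\<dots> \<longleftrightarrow> (\<forall>i\<in>{2..n-1}. C i = CH i)"
  proof (rule ball_cong[OF refl])
    fix i assume i: "i \<in> {2..n-1}"
    have "card (HH i) > 0" using pos(3)[of i] ran[OF i] by simp
    then have "of_nat (card (C i)) / of_nat (card (HH i)) = (of_nat (card (CH i)) / of_nat (card (HH i)) :: rat) \<longleftrightarrow> card (C i) = card (CH i)"
      by simp
    also have "\<dots> \<longleftrightarrow> C i = CH i"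
      using card_subset_eq[OF fin[OF i] CH_subset] ran[OF i] by auto
    finally show "of_nat (card (C i)) / of_nat (card (HH i)) = (of_nat (card (CH i)) / of_nat (card (HH i)) :: rat) \<longleftrightarrow> C i = CH i" .
  qed
  finally show ?thesis .
qed

text \<open>Centralizing elements normalize the kernel by \<open>Cset_subset_nrm\<close>; goodness
  supplies the field automorphism that \<open>good_in_Cset\<close> requires for the other
  inclusion.\<close>

lemma good_NK:
  assumes good: "good_leaf G vs" and i: "i \<in> {2..n-1}"
  shows "NK i = C i"
proof -
  have i': "2 \<le> i" "i \<le> n" "1 \<le> i" using i by auto
  interpret c: clifford_step G H \<theta> "HH (i - 1)" "HH i" "AA i" by (rule clifford_loc[OF i'(1,2)])
  interpret a: lin_sub G "AA i" "TT i" using N_lin_triple_D(8)[OF triple] i' by simp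
  have ker: "char_ker G (AA i) (TT i) = {a \<in> AA i. \<theta> a = 1}"
    using TT_theta[of i] i' by (auto simp: char_ker_def)
  have "C i \<subseteq> NK i"
    using c.Cset_subset_nrm Cset_eq(1)[OF i'(1,2)] by (simp add: NK_def ker)
  moreover have "NK i \<subseteq> C i"
  proof
    fix x assume x: "x \<in> NK i"
    then have xM: "x \<in> HH (i - 1)" by (simp add: NK_def nrm_def)
    have "\<exists>\<sigma>. fld_aut \<sigma> \<and> char_conj G x (induced G (HH n) (HH i) (TT n)) = \<sigma> \<circ> induced G (HH n) (HH i) (TT n)"
      using good x i' unfolding good_leaf_def Let_def NK_def by auto
    then obtain \<sigma> where "fld_aut \<sigma>" "char_conj G x (induced G H (HH i) \<theta>) = \<sigma> \<circ> induced G H (HH i) \<theta>"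
      unfolding node_last by blast
    then have "x \<in> c.Cset" by (rule c.good_in_Cset[OF xM])
    then show "x \<in> C i" using Cset_eq(1)[OF i'(1,2)] by simp
  qed
  ultimately show ?thesis by blast
qed

end

theorem theorem4:
  fixes G :: "('a,'b) monoid_scheme" and N H :: "'a set" and \<theta> :: "'a \<Rightarrow> complex"
    and Ac :: "'a triple \<Rightarrow> 'a set" and R :: "'a triple \<Rightarrow> ('a \<Rightarrow> complex) set"
    and vs :: "'a triple list"
  assumes "class_C G" and "N \<lhd> G"
    and "valid_Acal G N Ac" and "valid_reps G N Ac R"
    and "is_path G N Ac R vs" and "last vs = (H, H, \<theta>)"
  shows
   "(let n = length vs; K = char_ker G H \<theta>;
         idx = (\<lambda>C. (of_nat (card (Cen G (carrier G) (eps G H K))) /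
                     of_nat (card (Cen G (nodeH vs (n - 1)) (eps G H K)))) /
                   (\<Prod>i\<in>{2..n-1}. of_nat (card (C i)) / of_nat (card (nodeH vs i))) :: rat);
         cond = (\<lambda>C. \<forall>i\<in>{2..n-1}. C i =
                   Cen G (nodeH vs (i - 1)) (eps G H K) <#>\<^bsub>G\<^esub> nodeH vs i);
         CenE = (\<lambda>i. Cen G (nodeH vs (i - 1)) (e_sum G (nodeH vs i) H K));
         NK = (\<lambda>i. nrm G (nodeH vs (i - 1)) (char_ker G (nodeA vs i) (nodeT vs i)))
     in alpha G H K = idx CenE
        \<and> (alpha G H K = 1 \<longleftrightarrow> cond CenE)
        \<and> (good_leaf G vs \<longrightarrow> alpha G H K = idx NK \<and> (alpha G H K = 1 \<longleftrightarrow> cond NK)))"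
proof -
  have grp: "group G" and finG: "finite (carrier G)" using assms(1) by (auto simp: class_C_def)
  interpret leaf_path G N Ac R vs H \<theta>
    using grp finG assms(3-6) by (intro leaf_path.intro leaf_path_axioms.intro fin_group.intro fin_group_axioms.intro)
  have good: "(\<Prod>i\<in>{2..length vs - 1}. of_nat (card (NK i)) / of_nat (card (nodeH vs i)) :: rat) =
      (\<Prod>i\<in>{2..length vs - 1}. of_nat (card (C i)) / of_nat (card (nodeH vs i)))"
    "(\<forall>i\<in>{2..length vs - 1}. NK i = CH i) \<longleftrightarrow> (\<forall>i\<in>{2..length vs - 1}. C i = CH i)" if "good_leaf G vs"
  proof -
    have eq: "NK i = C i" if "i \<in> {2..length vs - 1}" for i using good_NK[OF \<open>good_leaf G vs\<close> that] .
    show "(\<Prod>i\<in>{2..length vs - 1}. of_nat (card (NK i)) / of_nat (card (nodeH vs i)) :: rat) =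
      (\<Prod>i\<in>{2..length vs - 1}. of_nat (card (C i)) / of_nat (card (nodeH vs i)))"
      by (intro prod.cong refl) (simp only: eq)
    show "(\<forall>i\<in>{2..length vs - 1}. NK i = CH i) \<longleftrightarrow> (\<forall>i\<in>{2..length vs - 1}. C i = CH i)"
      using eq by blast
  qed
  show ?thesis
    using alpha_formula alpha_eq_1_iff good
    unfolding Let_def K_def[symmetric] node_first[symmetric]
    unfolding d_def[symmetric] C_def[symmetric] NK_def[symmetric] CH_def[symmetric]
    by simp
qed

end
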